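(* Let $(M,g,f)$ be a compact gradient shrinking Ricci soliton, i.e. $(M,g)$ is a compact $n$-dimensional Riemannian manifold and $f$ is a smooth real-valued function on $M$ such that $\nabla^2 f+\mathrm{Ric}=\lambda g$ for some real constant $\lambda>0$. If the second invariant $S_2(f)$ of the Hessian $\nabla^2 f$ is constant on $M$, then the soliton is trivial, i.e., $M$ is Einstein.
   Context: All Riemannian manifolds are assumed complete, connected, orientable and without boundary. $\nabla^2 f$ denotes the Hessian of $f$ and $\mathrm{Ric}$ the Ricci tensor of $g$. The invariants $S_m(f)$, $0\le m\le n$, of the Hessian (viewed as an endomorphism of the tangent bundle via $g$) are the functions on $M$ defined by $\det(I+\alpha\nabla^2 f)=S_0(f)+\alpha S_1(f)+\cdots+\alpha^n S_n(f)$ for every scalar $\alpha$; thus $S_2(f)$ is the coefficient of $\alpha^2$. A gradient Ricci soliton is called trivial if $\nabla f$ is a Killing vector field or $f$ is constant. *)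

theory Defs
  imports "HOL-Analysis.Analysis" "HOL-Computational_Algebra.Polynomial"
begin

section \<open>Smooth functions on open subsets of Euclidean space\<close>

definition partial_deriv :: "'n::finite \<Rightarrow> (real^'n \<Rightarrow> real) \<Rightarrow> real^'n \<Rightarrow> real" where
  "partial_deriv i h x = frechet_derivative h (at x) (axis i 1)"

primrec iter_partial :: "'n::finite list \<Rightarrow> (real^'n \<Rightarrow> real) \<Rightarrow> real^'n \<Rightarrow> real" where
  "iter_partial [] h = h"
| "iter_partial (i # is) h = partial_deriv i (iter_partial is h)"

text \<open>Class \<open>C\<^sup>\<infinity>\<close>; meant for open \<open>S\<close>. If all iterated partial derivatives are differentiable,
  they are in particular all continuous.\<close>

definition smooth_on :: "(real^'n::finite) set \<Rightarrow> (real^'n \<Rightarrow> real) \<Rightarrow> bool" where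
  "smooth_on S h \<longleftrightarrow> (\<forall>is. iter_partial is h differentiable_on S)"


section \<open>Smooth manifolds\<close>

text \<open>The manifold is the set \<open>topspace X\<close>. A chart is a pair \<open>(U, \<phi>)\<close>; values of \<open>\<phi>\<close> outside \<open>U\<close>
  are irrelevant.\<close>

type_synonym ('a, 'n) chart = "'a set \<times> ('a \<Rightarrow> real^'n)"

definition coord_image :: "('a, 'n::finite) chart \<Rightarrow> (real^'n) set" where
  "coord_image c = snd c ` fst c"

definition coord_inv :: "('a, 'n::finite) chart \<Rightarrow> real^'n \<Rightarrow> 'a" where
  "coord_inv c = inv_into (fst c) (snd c)"

definition is_chart :: "'a topology \<Rightarrow> ('a, 'n::finite) chart \<Rightarrow> bool" where
  "is_chart X c \<longleftrightarrow> openin X (fst c) \<and> open (coord_image c) \<and>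
     homeomorphic_map (subtopology X (fst c)) (top_of_set (coord_image c)) (snd c)"

definition overlap :: "('a, 'n::finite) chart \<Rightarrow> ('a, 'n) chart \<Rightarrow> (real^'n) set" where
  "overlap c d = snd c ` (fst c \<inter> fst d)"

definition transition :: "('a, 'n::finite) chart \<Rightarrow> ('a, 'n) chart \<Rightarrow> real^'n \<Rightarrow> real^'n" where
  "transition c d = snd d \<circ> coord_inv c"

definition smooth_transition :: "('a, 'n::finite) chart \<Rightarrow> ('a, 'n) chart \<Rightarrow> bool" where
  "smooth_transition c d \<longleftrightarrow> (\<forall>i. smooth_on (overlap c d) (\<lambda>x. transition c d x $ i))"

definition smooth_atlas :: "'a topology \<Rightarrow> ('a, 'n::finite) chart set \<Rightarrow> bool" where
  "smooth_atlas X A \<longleftrightarrow> (\<forall>c\<in>A. is_chart X c) \<and> (\<Union>c\<in>A. fst c) = topspace X \<and>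
     (\<forall>c\<in>A. \<forall>d\<in>A. smooth_transition c d)"

definition smooth_manifold :: "'a topology \<Rightarrow> ('a, 'n::finite) chart set \<Rightarrow> bool" where
  "smooth_manifold X A \<longleftrightarrow> Hausdorff_space X \<and> second_countable X \<and> smooth_atlas X A"

text \<open>An oriented atlas defining the same smooth structure exists; it need not be contained in
  the given atlas \<open>A\<close>.\<close>

definition orientable :: "'a topology \<Rightarrow> ('a, 'n::finite) chart set \<Rightarrow> bool" where
  "orientable X A \<longleftrightarrow> (\<exists>B. smooth_atlas X (A \<union> B) \<and> smooth_atlas X B \<and>
     (\<forall>c\<in>B. \<forall>d\<in>B. \<forall>x\<in>overlap c d. 0 < det (jacobian (transition c d) (at x))))"

definition in_coords :: "('a, 'n::finite) chart \<Rightarrow> ('a \<Rightarrow> real) \<Rightarrow> real^'n \<Rightarrow> real" where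
  "in_coords c f = f \<circ> coord_inv c"

definition smooth_function :: "('a, 'n::finite) chart set \<Rightarrow> ('a \<Rightarrow> real) \<Rightarrow> bool" where
  "smooth_function A f \<longleftrightarrow> (\<forall>c\<in>A. smooth_on (coord_image c) (in_coords c f))"


section \<open>Riemannian metrics\<close>

text \<open>A field of bilinear forms is given by its component matrices: \<open>g c x\<close> is the matrix
  \<open>g(\<partial>\<^sub>i, \<partial>\<^sub>j)\<close> in the chart \<open>c\<close> at the point with coordinates \<open>x\<close>. The last conjunct is the
  transformation law of a \<open>(0,2)\<close>-tensor.\<close>

type_synonym ('a, 'n) tensor_field = "('a, 'n) chart \<Rightarrow> real^'n \<Rightarrow> real^'n^'n"

definition riemannian_metric :: "('a, 'n::finite) chart set \<Rightarrow> ('a, 'n) tensor_field \<Rightarrow> bool" where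
  "riemannian_metric A g \<longleftrightarrow>
     (\<forall>c\<in>A. \<forall>i j. smooth_on (coord_image c) (\<lambda>x. g c x $ i $ j)) \<and>
     (\<forall>c\<in>A. \<forall>x\<in>coord_image c. transpose (g c x) = g c x \<and> (\<forall>v. v \<noteq> 0 \<longrightarrow> 0 < v \<bullet> (g c x *v v))) \<and>
     (\<forall>c\<in>A. \<forall>d\<in>A. \<forall>x\<in>overlap c d.
        let J = jacobian (transition c d) (at x)
        in g c x = transpose J ** g d (transition c d x) ** J)"

text \<open>Completeness is not part of this definition: it is only used for compact manifolds, which are
  automatically complete.\<close>

definition riemannian_manifold ::
    "'a topology \<Rightarrow> ('a, 'n::finite) chart set \<Rightarrow> ('a, 'n) tensor_field \<Rightarrow> bool" where
  "riemannian_manifold X A g \<longleftrightarrow>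
     smooth_manifold X A \<and> connected_space X \<and> orientable X A \<and> riemannian_metric A g"


section \<open>Curvature and Hessian in coordinates\<close>

text \<open>In this section \<open>G\<close> is the matrix of the metric and \<open>h\<close> a function, both in coordinates.
  \<open>christoffel G k i j\<close> is \<open>\<Gamma>\<^sup>k\<^sub>i\<^sub>j\<close>, i.e. \<open>\<nabla>\<^bsub>\<partial>\<^sub>i\<^esub> \<partial>\<^sub>j = \<Sum>\<^sub>k \<Gamma>\<^sup>k\<^sub>i\<^sub>j \<partial>\<^sub>k\<close> for the Levi-Civita connection.\<close>

definition christoffel ::
    "(real^'n::finite \<Rightarrow> real^'n^'n) \<Rightarrow> 'n \<Rightarrow> 'n \<Rightarrow> 'n \<Rightarrow> real^'n \<Rightarrow> real" where
  "christoffel G k i j x = (1/2) * (\<Sum>l\<in>UNIV. matrix_inv (G x) $ k $ l *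
     (partial_deriv i (\<lambda>y. G y $ j $ l) x + partial_deriv j (\<lambda>y. G y $ i $ l) x
        - partial_deriv l (\<lambda>y. G y $ i $ j) x))"

text \<open>\<open>riemann_curv G l i j k\<close> is the \<open>\<partial>\<^sub>l\<close>-component of \<open>R(\<partial>\<^sub>i, \<partial>\<^sub>j)\<partial>\<^sub>k\<close>, where
  \<open>R(X,Y)Z = \<nabla>\<^sub>X \<nabla>\<^sub>Y Z - \<nabla>\<^sub>Y \<nabla>\<^sub>X Z - \<nabla>\<^bsub>[X,Y]\<^esub> Z\<close>.\<close>

definition riemann_curv ::
    "(real^'n::finite \<Rightarrow> real^'n^'n) \<Rightarrow> 'n \<Rightarrow> 'n \<Rightarrow> 'n \<Rightarrow> 'n \<Rightarrow> real^'n \<Rightarrow> real" where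
  "riemann_curv G l i j k x =
     partial_deriv i (christoffel G l j k) x - partial_deriv j (christoffel G l i k) x
     + (\<Sum>m\<in>UNIV. christoffel G m j k x * christoffel G l i m x
                  - christoffel G m i k x * christoffel G l j m x)"

text \<open>\<open>Ric(Y,Z)\<close> is the trace of \<open>X \<mapsto> R(X,Y)Z\<close>; round spheres have positive Ricci curvature.\<close>

definition ricci :: "(real^'n::finite \<Rightarrow> real^'n^'n) \<Rightarrow> real^'n \<Rightarrow> real^'n^'n" where
  "ricci G x = (\<chi> j k. \<Sum>i\<in>UNIV. riemann_curv G i i j k x)"

definition hessian ::
    "(real^'n::finite \<Rightarrow> real^'n^'n) \<Rightarrow> (real^'n \<Rightarrow> real) \<Rightarrow> real^'n \<Rightarrow> real^'n^'n" where
  "hessian G h x = (\<chi> i j. partial_deriv i (partial_deriv j h) x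
     - (\<Sum>k\<in>UNIV. christoffel G k i j x * partial_deriv k h x))"

definition hessian_endo ::
    "(real^'n::finite \<Rightarrow> real^'n^'n) \<Rightarrow> (real^'n \<Rightarrow> real) \<Rightarrow> real^'n \<Rightarrow> real^'n^'n" where
  "hessian_endo G h x = matrix_inv (G x) ** hessian G h x"

definition gradient ::
    "(real^'n::finite \<Rightarrow> real^'n^'n) \<Rightarrow> (real^'n \<Rightarrow> real) \<Rightarrow> real^'n \<Rightarrow> real^'n" where
  "gradient G h x = matrix_inv (G x) *v (\<chi> i. partial_deriv i h x)"

definition lie_deriv_metric ::
    "(real^'n::finite \<Rightarrow> real^'n) \<Rightarrow> (real^'n \<Rightarrow> real^'n^'n) \<Rightarrow> real^'n \<Rightarrow> real^'n^'n" where
  "lie_deriv_metric V G x = (\<chi> i j. \<Sum>k\<in>UNIV.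
     V x $ k * partial_deriv k (\<lambda>y. G y $ i $ j) x
     + G x $ k $ j * partial_deriv i (\<lambda>y. V y $ k) x
     + G x $ i $ k * partial_deriv j (\<lambda>y. V y $ k) x)"


section \<open>Invariants of an endomorphism\<close>

text \<open>The coefficient of \<open>\<alpha>\<^sup>m\<close> in \<open>det (I + \<alpha> H)\<close>, the determinant being taken over the polynomial
  ring \<open>\<real>[\<alpha>]\<close>. The lemma below is the defining identity for scalars \<open>\<alpha>\<close>.\<close>

definition endo_invariant :: "nat \<Rightarrow> real^'n^'n::finite \<Rightarrow> real" where
  "endo_invariant m H = coeff (det (\<chi> i j. [:mat 1 $ i $ j, H $ i $ j:])) m"

lemma det_endo_invariant:
  fixes H :: "real^'n^'n::finite"
  shows "det (mat 1 + \<alpha> *\<^sub>R H) = (\<Sum>m\<le>CARD('n). \<alpha> ^ m * endo_invariant m H)"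
proof -
  define P :: "real poly^'n^'n" where "P = (\<chi> i j. [:mat 1 $ i $ j, H $ i $ j:])"
  have ev: "poly (det P) \<alpha> = det (mat 1 + \<alpha> *\<^sub>R H)"
    unfolding det_def by (simp add: poly_sum poly_prod P_def)
  have "degree (\<Prod>i\<in>UNIV. P $ i $ p i) \<le> CARD('n)" for p
  proof -
    have "degree (\<Prod>i\<in>UNIV. P $ i $ p i) \<le> (\<Sum>i\<in>UNIV. degree (P $ i $ p i))"
      using degree_prod_sum_le[of "UNIV :: 'n set" "\<lambda>i. P $ i $ p i"] by (simp add: o_def)
    also have "\<dots> \<le> (\<Sum>i\<in>(UNIV :: 'n set). 1)"
      by (intro sum_mono) (simp add: P_def)
    finally show ?thesis by simp
  qed
  moreover have "degree (of_int k :: real poly) = 0" for k :: int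
    by (simp add: of_int_poly)
  ultimately have "degree (det P) \<le> CARD('n)"
    unfolding det_def
    by (intro degree_sum_le) (auto intro: order_trans[OF degree_mult_le])
  then have "poly (det P) \<alpha> = (\<Sum>m\<le>CARD('n). coeff (det P) m * \<alpha> ^ m)"
    by (subst poly_as_sum_of_monoms'[symmetric, of "det P" "CARD('n)"])
      (simp_all add: poly_sum poly_monom)
  then show ?thesis
    using ev by (simp add: endo_invariant_def P_def mult.commute)
qed


section \<open>Gradient Ricci solitons\<close>

definition gradient_ricci_soliton ::
    "('a, 'n::finite) chart set \<Rightarrow> ('a, 'n) tensor_field \<Rightarrow> ('a \<Rightarrow> real) \<Rightarrow> real \<Rightarrow> bool" where
  "gradient_ricci_soliton A g f lam \<longleftrightarrow> smooth_function A f \<and>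
     (\<forall>c\<in>A. \<forall>x\<in>coord_image c. hessian (g c) (in_coords c f) x + ricci (g c) x = lam *\<^sub>R g c x)"

text \<open>\<open>S\<^sub>m(f)\<close> as a function on \<open>M\<close>. It is computed in some chart around \<open>p\<close>; the matrices of the
  Hessian endomorphism in different charts are conjugate, so that the choice does not matter.\<close>

definition hessian_invariant ::
    "('a, 'n::finite) chart set \<Rightarrow> ('a, 'n) tensor_field \<Rightarrow> nat \<Rightarrow> ('a \<Rightarrow> real) \<Rightarrow> 'a \<Rightarrow> real" where
  "hessian_invariant A g m f p =
     (let c = (SOME c. c \<in> A \<and> p \<in> fst c)
      in endo_invariant m (hessian_endo (g c) (in_coords c f) (snd c p)))"

definition killing_gradient ::
    "('a, 'n::finite) chart set \<Rightarrow> ('a, 'n) tensor_field \<Rightarrow> ('a \<Rightarrow> real) \<Rightarrow> bool" where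
  "killing_gradient A g f \<longleftrightarrow> (\<forall>c\<in>A. \<forall>x\<in>coord_image c.
     lie_deriv_metric (gradient (g c) (in_coords c f)) (g c) x = 0)"

definition trivial_soliton ::
    "'a topology \<Rightarrow> ('a, 'n::finite) chart set \<Rightarrow> ('a, 'n) tensor_field \<Rightarrow> ('a \<Rightarrow> real) \<Rightarrow> bool" where
  "trivial_soliton X A g f \<longleftrightarrow> killing_gradient A g f \<or> f constant_on topspace X"

definition einstein :: "('a, 'n::finite) chart set \<Rightarrow> ('a, 'n) tensor_field \<Rightarrow> bool" where
  "einstein A g \<longleftrightarrow> (\<exists>\<rho>. \<forall>c\<in>A. \<forall>x\<in>coord_image c. ricci (g c) x = \<rho> *\<^sub>R g c x)"

end

theory Submission
  imports Defs
begin

text \<open>Write \<open>u = \<Delta>f\<close>. The soliton equation and the contracted Bianchi identity give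
  \<open>u = |\<nabla>f|\<^sup>2 - 2\<lambda>f + C\<close>, so that \<open>u = |\<nabla>F|\<^sup>2 - 2\<lambda>F\<close> for \<open>F = f - C/(2\<lambda>)\<close>, and the Bochner formula gives
  \<open>\<Delta>u = \<langle>\<nabla>F, \<nabla>u\<rangle> + 2 |\<nabla>\<^sup>2F|\<^sup>2 - 2\<lambda>u\<close>. If \<open>S\<^sub>2\<close> is the constant \<open>s\<close>, then
  \<open>|\<nabla>\<^sup>2F|\<^sup>2 = u\<^sup>2 - 2s\<close>.

  If \<open>s > 0\<close>, then \<open>u\<close> has no zero; but \<open>u \<le> 0\<close> at a maximum and \<open>u \<ge> 0\<close> at a minimum of \<open>f\<close>, which
  contradicts connectedness. If \<open>s \<le> 0\<close>, then \<open>w = (u - 2\<lambda>) exp (- F)\<close> satisfies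
  \<open>\<Delta>w + \<langle>\<nabla>F, \<nabla>w\<rangle> = exp (- F) (u\<^sup>2 - 4s) \<ge> exp (- F) u\<^sup>2\<close>. Evaluating this at the maxima of \<open>w + \<epsilon> F\<close>
  and letting \<open>\<epsilon> \<rightarrow> 0\<close> yields \<open>w \<le> - 2\<lambda>\<close>, i.e. \<open>u \<le> 2\<lambda> (1 - exp F)\<close>. Since \<open>u \<ge> - 2\<lambda>F\<close>, we get
  \<open>exp F \<le> 1 + F\<close>, hence \<open>F = 0\<close>. Only the maximum principle at a point is used; no integration.\<close>

section \<open>Calculus with partial derivatives\<close>

text \<open>The perturbation cannot be avoided by looking at a maximum of w itself. There u = 0, and
  then u = |\<nabla>F|^2 - 2\<lambda>F forces F \<ge> 0, so the maximal value - 2\<lambda> exp (- F)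
  of w may well lie above - 2\<lambda>: the sign of F is the wrong one. The term \<epsilon>F repairs
  this. It adds \<epsilon> (\<Delta>F + |\<nabla>F|^2) = 2\<epsilon> (u + \<lambda>F) to the drift
  Laplacian, so a maximum of w + \<epsilon>F satisfies u^2 + 2\<epsilon> exp F (u + \<lambda>F)
  \<le> 0, and completing the square gives F \<le> O(\<epsilon>) there.

  All differential identities are proved with component matrices inside one chart. Only three
  scalars have to be compared between charts: u, |\<nabla>f|^2 and the trace of the squared Hessian
  endomorphism. That trace is |Hess f|^2, and it is tied to the hypothesis by 2 S_2 = u^2 - |Hess
  f|^2.\<close>

lemma partial_deriv_eq:
  "(h has_derivative D) (at x) \<Longrightarrow> partial_deriv i h x = D (axis i 1)"
  unfolding partial_deriv_def using frechet_derivative_at by metis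

lemma partial_deriv_cong_open:
  assumes "open S" "x \<in> S" "\<And>y. y \<in> S \<Longrightarrow> h y = k y"
  shows "partial_deriv i h x = partial_deriv i k x"
proof -
  have "(h has_derivative D) (at x) \<longleftrightarrow> (k has_derivative D) (at x)" for D
    using has_derivative_transform_within_open[OF _ assms(1,2), of h D UNIV k]
      has_derivative_transform_within_open[OF _ assms(1,2), of k D UNIV h] assms(3)
    by fastforce
  then show ?thesis by (simp add: partial_deriv_def frechet_derivative_def)
qed

lemma partial_deriv_add:
  "h differentiable at x \<Longrightarrow> k differentiable at x \<Longrightarrow>
    partial_deriv i (\<lambda>y. h y + k y) x = partial_deriv i h x + partial_deriv i k x"
  by (subst partial_deriv_eq[OF has_derivative_add[OF frechet_derivative_works[THEN iffD1] frechet_derivative_works[THEN iffD1]]])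
     (auto simp: partial_deriv_def)

lemma partial_deriv_mult:
  "h differentiable at x \<Longrightarrow> k differentiable at x \<Longrightarrow>
    partial_deriv i (\<lambda>y. h y * k y) x = partial_deriv i h x * k x + h x * partial_deriv i k x"
  by (subst partial_deriv_eq[OF has_derivative_mult[OF frechet_derivative_works[THEN iffD1] frechet_derivative_works[THEN iffD1]]])
     (auto simp: partial_deriv_def)

lemma partial_deriv_const [simp]: "partial_deriv i (\<lambda>y. c) x = 0"
  by (simp add: partial_deriv_def)

lemma partial_deriv_component [simp]:
  "partial_deriv i (\<lambda>y::real^'n::finite. y $ j) x = (if i = j then 1 else 0)"
  by (subst partial_deriv_eq[where D = "\<lambda>h. h $ j"])
     (auto intro: bounded_linear_imp_has_derivative bounded_linear_vec_nth simp: axis_def)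

lemma partial_deriv_cmult:
  "h differentiable at x \<Longrightarrow> partial_deriv i (\<lambda>y. c * h y) x = c * partial_deriv i h x"
  by (subst partial_deriv_mult) auto

lemma partial_deriv_minus:
  "h differentiable at x \<Longrightarrow> partial_deriv i (\<lambda>y. - h y) x = - partial_deriv i h x"
  using partial_deriv_cmult[of h x i "-1"] by simp

lemma partial_deriv_diff:
  "h differentiable at x \<Longrightarrow> k differentiable at x \<Longrightarrow>
    partial_deriv i (\<lambda>y. h y - k y) x = partial_deriv i h x - partial_deriv i k x"
  using partial_deriv_add[of h x "\<lambda>y. - k y" i] by (simp add: partial_deriv_minus)

lemma partial_deriv_sum:
  "(\<And>a. a \<in> I \<Longrightarrow> h a differentiable at x) \<Longrightarrow>
    partial_deriv i (\<lambda>y. \<Sum>a\<in>I. h a y) x = (\<Sum>a\<in>I. partial_deriv i (h a) x)"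
proof (induction I rule: infinite_finite_induct)
  case (insert b I)
  have "(\<lambda>y. \<Sum>a\<in>I. h a y) differentiable at x"
    using insert by (intro differentiable_sum) auto
  with insert show ?case by (simp add: partial_deriv_add)
qed auto

lemma has_derivative_partial_deriv:
  fixes h :: "real^'n::finite \<Rightarrow> real"
  assumes "h differentiable at x"
  shows "(h has_derivative (\<lambda>v. \<Sum>i\<in>UNIV. v $ i * partial_deriv i h x)) (at x)"
proof -
  have D: "(h has_derivative frechet_derivative h (at x)) (at x)"
    using assms frechet_derivative_works by blast
  have "frechet_derivative h (at x) v = (\<Sum>i\<in>UNIV. v $ i * partial_deriv i h x)" for v
  proof -
    have "frechet_derivative h (at x) v = frechet_derivative h (at x) (\<Sum>i\<in>UNIV. v $ i *\<^sub>R axis i 1)"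
      by (simp add: basis_expansion flip: scalar_mult_eq_scaleR)
    also have "\<dots> = (\<Sum>i\<in>UNIV. v $ i * partial_deriv i h x)"
      using has_derivative_linear[OF D] by (simp add: linear_sum linear_cmul partial_deriv_def)
    finally show ?thesis .
  qed
  then have "frechet_derivative h (at x) = (\<lambda>v. \<Sum>i\<in>UNIV. v $ i * partial_deriv i h x)" by blast
  with D show ?thesis by simp
qed

lemma has_derivative_components:
  fixes T :: "real^'n::finite \<Rightarrow> real^'m::finite"
  assumes "\<And>m. (\<lambda>y. T y $ m) differentiable at x"
  shows "(T has_derivative (\<lambda>v. \<chi> m. frechet_derivative (\<lambda>y. T y $ m) (at x) v)) (at x)"
proof (subst has_derivative_componentwise_within, intro ballI)
  fix b :: "real^'m" assume "b \<in> Basis"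
  then obtain m where b: "b = axis m 1" by (auto simp: Basis_vec_def)
  have "((\<lambda>y. T y $ m) has_derivative frechet_derivative (\<lambda>y. T y $ m) (at x)) (at x)"
    using assms[of m] unfolding frechet_derivative_works .
  then show "((\<lambda>x. T x \<bullet> b) has_derivative
      (\<lambda>v. (\<chi> m. frechet_derivative (\<lambda>y. T y $ m) (at x) v) \<bullet> b)) (at x)"
    by (simp add: b inner_axis)
qed

lemma partial_deriv_compose:
  fixes T :: "real^'n::finite \<Rightarrow> real^'m::finite" and h :: "real^'m \<Rightarrow> real"
  assumes "h differentiable at (T x)" "\<And>m. (\<lambda>y. T y $ m) differentiable at x"
  shows "partial_deriv i (\<lambda>y. h (T y)) x =
    (\<Sum>m\<in>UNIV. partial_deriv m h (T x) * partial_deriv i (\<lambda>y. T y $ m) x)"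
proof -
  define D where "D m = frechet_derivative (\<lambda>y. T y $ m) (at x)" for m
  have "(T has_derivative (\<lambda>v. \<chi> m. D m v)) (at x)"
    using has_derivative_components[OF assms(2)] by (simp add: D_def)
  from diff_chain_at[OF this has_derivative_partial_deriv[OF assms(1)]]
  have "((\<lambda>y. h (T y)) has_derivative (\<lambda>v. \<Sum>m\<in>UNIV. D m v * partial_deriv m h (T x))) (at x)"
    by (simp add: o_def)
  from partial_deriv_eq[OF this, of i] show ?thesis
    by (simp add: D_def partial_deriv_def mult.commute)
qed

text \<open>A finite-order version of smoothness that suits induction: the product and chain rules
  express a derivative through functions of the next lower order, whereas the quantifier over all
  iterated partial derivatives offers nothing to induct on.\<close>

fun diff_order :: "(real^'n::finite) set \<Rightarrow> nat \<Rightarrow> (real^'n \<Rightarrow> real) \<Rightarrow> bool" where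
  "diff_order S 0 h \<longleftrightarrow> h differentiable_on S"
| "diff_order S (Suc n) h \<longleftrightarrow> h differentiable_on S \<and> (\<forall>i. diff_order S n (partial_deriv i h))"

lemma iter_partial_append: "iter_partial (xs @ ys) h = iter_partial xs (iter_partial ys h)"
  by (induction xs) auto

text \<open>\<open>iter_partial\<close> applies the head of the list last, while
  \<open>diff_order\<close> takes off the derivative that is applied first; lists are therefore
  split at their right end.\<close>

lemma smooth_on_iff_diff_order: "smooth_on S h \<longleftrightarrow> (\<forall>n. diff_order S n h)"
proof -
  have "diff_order S n h \<longleftrightarrow> (\<forall>is. length is \<le> n \<longrightarrow> iter_partial is h differentiable_on S)" for n
  proof (induction n arbitrary: h)
    case (Suc n)
    show ?case (is "?L \<longleftrightarrow> ?R")
    proof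
      assume L: ?L
      show ?R
      proof (intro allI impI)
        fix "is" :: "'a list" assume "length is \<le> Suc n"
        then show "iter_partial is h differentiable_on S"
          using L Suc by (cases "is" rule: rev_cases) (auto simp: iter_partial_append)
      qed
    next
      assume R: ?R
      have "iter_partial is (partial_deriv i h) differentiable_on S" if "length is \<le> n" for "is" i
        using R[rule_format, of "is @ [i]"] that by (simp add: iter_partial_append)
      moreover have "h differentiable_on S" using R[rule_format, of "[]"] by simp
      ultimately show ?L using Suc by simp
    qed
  qed auto
  then show ?thesis unfolding smooth_on_def by (meson order_refl)
qed

lemma diff_order_imp_differentiable: "diff_order S n h \<Longrightarrow> h differentiable_on S"
  by (cases n) auto

lemma diff_order_Suc_imp: "diff_order S (Suc n) h \<Longrightarrow> diff_order S n h"
  by (induction n arbitrary: h) auto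

lemma differentiable_on_cong:
  assumes "\<And>x. x \<in> S \<Longrightarrow> h x = k x"
  shows "h differentiable_on S \<longleftrightarrow> k differentiable_on S"
proof -
  have "k differentiable_on S" if "\<And>x. x \<in> S \<Longrightarrow> h x = k x" "h differentiable_on S" for h k
    using that unfolding differentiable_on_def
    by (metis differentiable_def has_derivative_transform)
  from this[of h k] this[of k h] assms show ?thesis by metis
qed

text \<open>Derivative formulas such as the product rule hold only at points of the open set. This
  rule lets them replace the derivative in the inductions below.\<close>

lemma diff_order_cong:
  assumes "open S" "\<And>x. x \<in> S \<Longrightarrow> h x = k x"
  shows "diff_order S n h \<longleftrightarrow> diff_order S n k"
  using assms(2)
proof (induction n arbitrary: h k)
  case 0
  then show ?case using differentiable_on_cong[of S h k] by simp
next
  case (Suc n)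
  have "diff_order S n (partial_deriv i h) = diff_order S n (partial_deriv i k)" for i
    by (rule Suc.IH) (rule partial_deriv_cong_open[OF assms(1)], auto simp: Suc.prems)
  moreover have "h differentiable_on S \<longleftrightarrow> k differentiable_on S"
    using Suc.prems by (rule differentiable_on_cong)
  ultimately show ?case by simp
qed

lemma smooth_on_cong:
  assumes "open S" "\<And>x. x \<in> S \<Longrightarrow> h x = k x"
  shows "smooth_on S h \<longleftrightarrow> smooth_on S k"
  using diff_order_cong[OF assms] by (simp add: smooth_on_iff_diff_order)

lemma smooth_on_subset: "smooth_on S h \<Longrightarrow> R \<subseteq> S \<Longrightarrow> smooth_on R h"
  unfolding smooth_on_def using differentiable_on_subset by blast

lemma smooth_on_imp_differentiable:
  assumes "smooth_on S h" "open S" "x \<in> S"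
  shows "h differentiable at x"
  using assms iter_partial.simps(1) differentiable_on_eq_differentiable_at
  unfolding smooth_on_def by metis

lemma smooth_on_partial_deriv: "smooth_on S h \<Longrightarrow> smooth_on S (partial_deriv i h)"
  unfolding smooth_on_def
proof
  fix "is" assume "\<forall>is. iter_partial is h differentiable_on S"
  from spec[OF this, of "is @ [i]"] show "iter_partial is (partial_deriv i h) differentiable_on S"
    by (simp add: iter_partial_append)
qed

lemma diff_order_const: "diff_order S n (\<lambda>x. c)"
proof (induction n arbitrary: c)
  case (Suc n)
  have "partial_deriv i (\<lambda>x. c) = (\<lambda>x. 0)" for i :: 'a by (rule ext) simp
  with Suc show ?case by simp
qed auto

lemma diff_order_component: "diff_order S n (\<lambda>x. x $ j)"
proof (cases n)
  case 0
  then show ?thesis by (auto intro!: linear_imp_differentiable_on bounded_linear.linear bounded_linear_vec_nth)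
next
  case (Suc m)
  have "partial_deriv i (\<lambda>x. x $ j) = (\<lambda>x. if i = j then 1 else 0)" for i :: 'a by auto
  with Suc show ?thesis
    by (auto intro!: linear_imp_differentiable_on bounded_linear.linear bounded_linear_vec_nth diff_order_const)
qed

lemma diff_order_add:
  assumes "open S" "diff_order S n h" "diff_order S n k"
  shows "diff_order S n (\<lambda>x. h x + k x)"
  using assms(2,3)
proof (induction n arbitrary: h k)
  case (Suc n)
  have "diff_order S n (partial_deriv i (\<lambda>x. h x + k x))" for i
  proof (subst diff_order_cong[OF assms(1)])
    fix x assume "x \<in> S"
    with Suc.prems assms(1)
    show "partial_deriv i (\<lambda>x. h x + k x) x = partial_deriv i h x + partial_deriv i k x"
      by (intro partial_deriv_add) (auto simp: differentiable_on_eq_differentiable_at)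
  qed (use Suc in auto)
  with Suc.prems show ?case by auto
qed auto

lemma diff_order_mult:
  assumes "open S" "diff_order S n h" "diff_order S n k"
  shows "diff_order S n (\<lambda>x. h x * k x)"
  using assms(2,3)
proof (induction n arbitrary: h k)
  case (Suc n)
  have "diff_order S n (partial_deriv i (\<lambda>x. h x * k x))" for i
  proof (subst diff_order_cong[OF assms(1)])
    fix x assume "x \<in> S"
    with Suc.prems assms(1)
    show "partial_deriv i (\<lambda>x. h x * k x) x = partial_deriv i h x * k x + h x * partial_deriv i k x"
      by (intro partial_deriv_mult) (auto simp: differentiable_on_eq_differentiable_at)
  qed (use Suc diff_order_Suc_imp[of S n] in \<open>auto intro!: diff_order_add[OF assms(1)]\<close>)
  with Suc.prems show ?case by auto
qed auto

text \<open>The derivative of 1/h contains 1/h again. The induction on the order is a bootstrap for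
  a fixed \<open>h\<close>: order n of 1/h gives order n of its derivative, hence order n + 1 of
  1/h. The exponential is treated in the same way.\<close>

lemma diff_order_inverse:
  assumes "open S" "diff_order S n h" "\<And>x. x \<in> S \<Longrightarrow> h x \<noteq> 0"
  shows "diff_order S n (\<lambda>x. inverse (h x))"
  using assms(2)
proof (induction n)
  case 0
  then show ?case using assms by (auto intro: differentiable_on_inverse)
next
  case (Suc n)
  note n = diff_order_Suc_imp[OF Suc.prems]
  have "diff_order S n (partial_deriv i (\<lambda>x. inverse (h x)))" for i
  proof (subst diff_order_cong[OF assms(1)])
    fix x assume "x \<in> S"
    with Suc.prems assms
    have "(h has_derivative frechet_derivative h (at x)) (at x)" "h x \<noteq> 0"
      by (auto simp: differentiable_on_eq_differentiable_at frechet_derivative_works)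
    from partial_deriv_eq[OF Deriv.has_derivative_inverse[OF this(2,1)], of i]
    show "partial_deriv i (\<lambda>x. inverse (h x)) x =
        - 1 * (inverse (h x) * (partial_deriv i h x * inverse (h x)))"
      by (simp add: partial_deriv_def)
  next
    have "diff_order S n (partial_deriv i h)" using Suc.prems by simp
    then show "diff_order S n (\<lambda>x. - 1 * (inverse (h x) * (partial_deriv i h x * inverse (h x))))"
      by (intro diff_order_mult[OF assms(1)] diff_order_const Suc.IH[OF n])
  qed
  moreover have "(\<lambda>x. inverse (h x)) differentiable_on S"
    using Suc.IH[OF n] by (rule diff_order_imp_differentiable)
  ultimately show ?case by simp
qed

lemma diff_order_exp:
  assumes "open S" "diff_order S n h"
  shows "diff_order S n (\<lambda>x. exp (h x))"
  using assms(2)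
proof (induction n)
  case 0
  then show ?case using assms
    by (auto simp: differentiable_on_eq_differentiable_at intro!: differentiable_compose[of exp]
        field_differentiable_imp_differentiable field_differentiable_within_exp)
next
  case (Suc n)
  note n = diff_order_Suc_imp[OF Suc.prems]
  have D: "((\<lambda>x. exp (h x)) has_derivative (\<lambda>v. exp (h x) * frechet_derivative h (at x) v)) (at x)" if "x \<in> S" for x
  proof -
    have "(h has_derivative frechet_derivative h (at x)) (at x)"
      using Suc.prems assms that by (auto simp: differentiable_on_eq_differentiable_at frechet_derivative_works)
    from has_derivative_exp[OF this] show ?thesis by (simp add: mult.commute)
  qed
  have "diff_order S n (partial_deriv i (\<lambda>x. exp (h x)))" for i
  proof (subst diff_order_cong[OF assms(1)])
    fix x assume "x \<in> S"
    from partial_deriv_eq[OF D[OF this], of i]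
    show "partial_deriv i (\<lambda>x. exp (h x)) x = exp (h x) * partial_deriv i h x"
      by (simp add: partial_deriv_def)
  qed (use Suc.prems Suc.IH[OF n] in \<open>auto intro!: diff_order_mult[OF assms(1)]\<close>)
  moreover have "(\<lambda>x. exp (h x)) differentiable_on S"
    using D assms(1) by (auto simp: differentiable_on_eq_differentiable_at differentiable_def)
  ultimately show ?case by auto
qed

lemma diff_order_sum:
  assumes "open S" "\<And>a. a \<in> I \<Longrightarrow> diff_order S n (h a)"
  shows "diff_order S n (\<lambda>x. \<Sum>a\<in>I. h a x)"
  using assms(2)
  by (induction I rule: infinite_finite_induct) (auto intro: diff_order_add[OF assms(1)] diff_order_const)

text \<open>By the chain rule the derivatives of h(T) involve the compositions of T with the partial
  derivatives of \<open>h\<close>, so the induction keeps T fixed and generalises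
  \<open>h\<close>.\<close>

lemma diff_order_compose:
  fixes T :: "real^'n::finite \<Rightarrow> real^'m::finite"
  assumes "open S" "open R" "T ` S \<subseteq> R" "\<And>m. diff_order S n (\<lambda>y. T y $ m)" "diff_order R n h"
  shows "diff_order S n (\<lambda>x. h (T x))"
  using assms(4,5)
proof (induction n arbitrary: h)
  case 0
  have "(\<lambda>x. h (T x)) differentiable at x" if "x \<in> S" for x
  proof -
    have "(\<lambda>y. T y $ m) differentiable at x" for m
      using 0(1)[of m] that assms(1) by (simp add: differentiable_on_eq_differentiable_at)
    then have "T differentiable at x"
      using has_derivative_components differentiable_def by blast
    moreover have "h differentiable at (T x)"
      using 0(2) assms(2,3) that by (auto simp: differentiable_on_eq_differentiable_at)
    ultimately show ?thesis by (auto intro: differentiable_compose)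
  qed
  then show ?case using assms(1) by (simp add: differentiable_on_eq_differentiable_at)
next
  case (Suc n)
  have T: "diff_order S n (\<lambda>y. T y $ m)" for m using diff_order_Suc_imp[OF Suc.prems(1)] .
  have "diff_order S n (\<lambda>x. h (T x))" using T diff_order_Suc_imp[OF Suc.prems(2)] by (rule Suc.IH)
  then have "(\<lambda>x. h (T x)) differentiable_on S" by (rule diff_order_imp_differentiable)
  moreover have "diff_order S n (partial_deriv i (\<lambda>x. h (T x)))" for i
  proof (subst diff_order_cong[OF assms(1)])
    fix x assume x: "x \<in> S"
    have "h differentiable at (T x)" using Suc.prems(2) x assms(2,3)
      by (auto simp: differentiable_on_eq_differentiable_at)
    moreover have "(\<lambda>y. T y $ m) differentiable at x" for m
      using Suc.prems(1)[of m] x assms(1) by (auto simp: differentiable_on_eq_differentiable_at)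
    ultimately show "partial_deriv i (\<lambda>y. h (T y)) x =
        (\<Sum>m\<in>UNIV. partial_deriv m h (T x) * partial_deriv i (\<lambda>y. T y $ m) x)"
      by (rule partial_deriv_compose)
  next
    have "diff_order S n (\<lambda>x. partial_deriv m h (T x))" for m
      by (rule Suc.IH[OF T]) (use Suc.prems(2) in simp)
    then have "diff_order S n (\<lambda>x. partial_deriv m h (T x) * partial_deriv i (\<lambda>y. T y $ m) x)" for m
      using Suc.prems(1)[of m] by (intro diff_order_mult[OF assms(1)]) simp_all
    then show "diff_order S n (\<lambda>x. \<Sum>m\<in>UNIV. partial_deriv m h (T x) * partial_deriv i (\<lambda>y. T y $ m) x)"
      by (rule diff_order_sum[OF assms(1)])
  qed
  ultimately show ?case by simp
qed

lemma smooth_on_const: "smooth_on S (\<lambda>x. c)"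
  and smooth_on_component: "smooth_on S (\<lambda>x. x $ j)"
  by (simp_all only: smooth_on_iff_diff_order diff_order_const diff_order_component simp_thms)

lemma smooth_on_add: "open S \<Longrightarrow> smooth_on S h \<Longrightarrow> smooth_on S k \<Longrightarrow> smooth_on S (\<lambda>x. h x + k x)"
  and smooth_on_mult: "open S \<Longrightarrow> smooth_on S h \<Longrightarrow> smooth_on S k \<Longrightarrow> smooth_on S (\<lambda>x. h x * k x)"
  and smooth_on_inverse: "open S \<Longrightarrow> smooth_on S h \<Longrightarrow> (\<And>x. x \<in> S \<Longrightarrow> h x \<noteq> 0) \<Longrightarrow>
      smooth_on S (\<lambda>x. inverse (h x))"
  and smooth_on_exp: "open S \<Longrightarrow> smooth_on S h \<Longrightarrow> smooth_on S (\<lambda>x. exp (h x))"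
  by (simp_all only: smooth_on_iff_diff_order diff_order_add diff_order_mult diff_order_inverse
      diff_order_exp simp_thms)

lemma smooth_on_sum:
  "open S \<Longrightarrow> (\<And>a. a \<in> I \<Longrightarrow> smooth_on S (h a)) \<Longrightarrow> smooth_on S (\<lambda>x. \<Sum>a\<in>I. h a x)"
  by (simp add: smooth_on_iff_diff_order diff_order_sum)

lemma smooth_on_prod:
  "open S \<Longrightarrow> (\<And>a. a \<in> I \<Longrightarrow> smooth_on S (h a)) \<Longrightarrow> smooth_on S (\<lambda>x. \<Prod>a\<in>I. h a x)"
  by (induction I rule: infinite_finite_induct) (auto intro: smooth_on_mult smooth_on_const)

lemma smooth_on_minus: "open S \<Longrightarrow> smooth_on S h \<Longrightarrow> smooth_on S (\<lambda>x. - h x)"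
  using smooth_on_mult[of S "\<lambda>x. -1" h] by (simp add: smooth_on_const)

lemma smooth_on_diff:
  "open S \<Longrightarrow> smooth_on S h \<Longrightarrow> smooth_on S k \<Longrightarrow> smooth_on S (\<lambda>x. h x - k x)"
  using smooth_on_add[of S h "\<lambda>x. - k x"] by (simp add: smooth_on_minus)

lemma smooth_on_compose:
  fixes T :: "real^'n::finite \<Rightarrow> real^'m::finite"
  assumes "open S" "open R" "T ` S \<subseteq> R" "\<And>m. smooth_on S (\<lambda>y. T y $ m)" "smooth_on R h"
  shows "smooth_on S (\<lambda>x. h (T x))"
  using assms diff_order_compose[OF assms(1-3)] by (simp add: smooth_on_iff_diff_order)

lemmas smooth_intros = smooth_on_const smooth_on_component smooth_on_add smooth_on_mult
  smooth_on_inverse smooth_on_exp smooth_on_sum smooth_on_prod smooth_on_minus smooth_on_diff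
  smooth_on_partial_deriv

lemma partial_deriv_exp:
  assumes "h differentiable at x"
  shows "partial_deriv i (\<lambda>y. exp (h y)) x = exp (h x) * partial_deriv i h x"
proof -
  have "(h has_derivative frechet_derivative h (at x)) (at x)"
    using assms frechet_derivative_works by blast
  from partial_deriv_eq[OF has_derivative_exp[OF this], of i] show ?thesis
    by (simp add: partial_deriv_def)
qed

section \<open>Symmetry of second partial derivatives\<close>

lemma DERIV_along_line:
  fixes h :: "real^'n::finite \<Rightarrow> real"
  assumes "h differentiable at (x + t *\<^sub>R v)"
  shows "((\<lambda>t. h (x + t *\<^sub>R v)) has_real_derivative (\<Sum>i\<in>UNIV. v $ i * partial_deriv i h (x + t *\<^sub>R v))) (at t)"
proof -
  have "((\<lambda>t. x + t *\<^sub>R v) has_derivative (\<lambda>t. t *\<^sub>R v)) (at t)"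
    by (auto intro!: derivative_eq_intros)
  from diff_chain_at[OF this has_derivative_partial_deriv[OF assms]]
  have "((\<lambda>t. h (x + t *\<^sub>R v)) has_derivative
      (\<lambda>s. \<Sum>i\<in>UNIV. (s *\<^sub>R v) $ i * partial_deriv i h (x + t *\<^sub>R v))) (at t)"
    by (simp add: o_def)
  moreover have "(\<lambda>s. \<Sum>i\<in>UNIV. (s *\<^sub>R v) $ i * partial_deriv i h (x + t *\<^sub>R v)) =
      (*) (\<Sum>i\<in>UNIV. v $ i * partial_deriv i h (x + t *\<^sub>R v))"
    by (rule ext) (simp add: sum_distrib_left mult_ac)
  ultimately show ?thesis by (simp add: has_field_derivative_def)
qed

lemma DERIV_along_axis:
  fixes h :: "real^'n::finite \<Rightarrow> real"
  assumes "h differentiable at (x + t *\<^sub>R axis i 1)"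
  shows "((\<lambda>t. h (x + t *\<^sub>R axis i 1)) has_real_derivative partial_deriv i h (x + t *\<^sub>R axis i 1)) (at t)"
proof -
  have "(\<Sum>j\<in>UNIV. axis i 1 $ j * partial_deriv j h (x + t *\<^sub>R axis i 1)) =
      (\<Sum>j\<in>UNIV. if j = i then partial_deriv j h (x + t *\<^sub>R axis i 1) else 0)"
    by (intro sum.cong) (auto simp: axis_def)
  with DERIV_along_line[OF assms] show ?thesis by simp
qed

text \<open>The mean value theorem is used twice: along axis i for the difference of
  \<open>h\<close> in direction j, then along axis j for \<open>partial_deriv i h\<close>. The
  second difference becomes \<open>t\<^sup>2\<close> times the mixed derivative at a nearby point,
  and continuity of that derivative finishes.\<close>

lemma mixed_difference_quotient:
  fixes h :: "real^'n::finite \<Rightarrow> real"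
  assumes S: "open S" "x \<in> S" and h: "smooth_on S h" and e: "0 < e"
  shows "\<exists>d>0. \<forall>t. 0 < t \<and> t < d \<longrightarrow>
    \<bar>h (x + t *\<^sub>R axis i 1 + t *\<^sub>R axis j 1) - h (x + t *\<^sub>R axis i 1) - h (x + t *\<^sub>R axis j 1) + h x
      - t\<^sup>2 * partial_deriv j (partial_deriv i h) x\<bar> \<le> e * t\<^sup>2"
proof -
  define H where "H = partial_deriv j (partial_deriv i h)"
  have D: "h differentiable at y" "partial_deriv i h differentiable at y" "H differentiable at y" if "y \<in> S" for y
    using that smooth_on_imp_differentiable[OF _ S(1)] smooth_on_partial_deriv h unfolding H_def by blast+
  have "isCont H x" using D(3)[OF S(2)] by (rule differentiable_imp_continuous_within)
  then obtain d0 where d0: "d0 > 0" "\<And>y. dist y x < d0 \<Longrightarrow> dist (H y) (H x) < e"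
    using e unfolding continuous_at_eps_delta by (metis dist_commute)
  obtain d1 where d1: "d1 > 0" "ball x d1 \<subseteq> S" using S open_contains_ball by blast
  \<comment> \<open>Two offsets below \<open>d\<close>, one along each axis, add up to a
    displacement shorter than both radii.\<close>
  define d where "d = min d0 d1 / 2"
  have near: "x + s *\<^sub>R axis i 1 + r *\<^sub>R axis j 1 \<in> S" "dist (x + s *\<^sub>R axis i 1 + r *\<^sub>R axis j 1) x < d0"
    if "0 \<le> s" "s < d" "0 \<le> r" "r < d" for s r
  proof -
    have "norm (s *\<^sub>R axis i (1::real) + r *\<^sub>R axis j 1) \<le> s + r"
      using norm_triangle_ineq[of "s *\<^sub>R axis i (1::real)" "r *\<^sub>R axis j 1"] that by simp
    then have *: "dist (x + s *\<^sub>R axis i 1 + r *\<^sub>R axis j 1) x < min d0 d1"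
      using that by (simp add: dist_norm d_def)
    then show "dist (x + s *\<^sub>R axis i 1 + r *\<^sub>R axis j 1) x < d0" by simp
    show "x + s *\<^sub>R axis i 1 + r *\<^sub>R axis j 1 \<in> S"
      using * d1 by (auto simp: dist_commute)
  qed
  show ?thesis
  proof (intro exI[of _ d] conjI allI impI)
    show "0 < d" using d0 d1 by (simp add: d_def)
    fix t :: real assume t: "0 < t \<and> t < d"
    define p where "p s = h ((x + t *\<^sub>R axis j 1) + s *\<^sub>R axis i 1) - h (x + s *\<^sub>R axis i 1)" for s
    have "\<exists>s>0. s < t \<and> p t - p 0 = (t - 0) *
        (partial_deriv i h ((x + t *\<^sub>R axis j 1) + s *\<^sub>R axis i 1) - partial_deriv i h (x + s *\<^sub>R axis i 1))"
    proof (rule MVT2)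
      fix s assume s: "0 \<le> s" "s \<le> t"
      show "(p has_real_derivative partial_deriv i h ((x + t *\<^sub>R axis j 1) + s *\<^sub>R axis i 1)
          - partial_deriv i h (x + s *\<^sub>R axis i 1)) (at s)"
        unfolding p_def
      proof (rule DERIV_diff; rule DERIV_along_axis; rule D(1))
        show "x + t *\<^sub>R axis j 1 + s *\<^sub>R axis i 1 \<in> S"
          using near(1)[of s t] s t by (simp add: add_ac)
        show "x + s *\<^sub>R axis i 1 \<in> S"
          using near(1)[of s 0] s t by simp
      qed
    qed (use t in auto)
    then obtain s where s: "0 < s" "s < t" and p: "p t - p 0 = t *
        (partial_deriv i h ((x + s *\<^sub>R axis i 1) + t *\<^sub>R axis j 1) - partial_deriv i h ((x + s *\<^sub>R axis i 1) + 0 *\<^sub>R axis j 1))"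
      by (auto simp: algebra_simps)
    have "\<exists>r>0. r < t \<and> partial_deriv i h ((x + s *\<^sub>R axis i 1) + t *\<^sub>R axis j 1)
        - partial_deriv i h ((x + s *\<^sub>R axis i 1) + 0 *\<^sub>R axis j 1) = (t - 0) * H ((x + s *\<^sub>R axis i 1) + r *\<^sub>R axis j 1)"
      unfolding H_def
    proof (rule MVT2)
      fix r assume "0 \<le> r" "r \<le> t"
      then show "((\<lambda>r. partial_deriv i h ((x + s *\<^sub>R axis i 1) + r *\<^sub>R axis j 1)) has_real_derivative
          partial_deriv j (partial_deriv i h) ((x + s *\<^sub>R axis i 1) + r *\<^sub>R axis j 1)) (at r)"
        by (intro DERIV_along_axis D(2) near(1)) (use s t in auto)
    qed (use t in auto)
    then obtain r where r: "0 < r" "r < t" "p t - p 0 = t * (t * H ((x + s *\<^sub>R axis i 1) + r *\<^sub>R axis j 1))"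
      using p by auto
    have "dist (H ((x + s *\<^sub>R axis i 1) + r *\<^sub>R axis j 1)) (H x) < e"
      using near(2)[of s r] r s t by (intro d0) auto
    then have "\<bar>H ((x + s *\<^sub>R axis i 1) + r *\<^sub>R axis j 1) - H x\<bar> * t\<^sup>2 \<le> e * t\<^sup>2"
      by (intro mult_right_mono) (auto simp: dist_real_def)
    moreover have "p t - p 0 = h (x + t *\<^sub>R axis i 1 + t *\<^sub>R axis j 1) - h (x + t *\<^sub>R axis i 1)
        - h (x + t *\<^sub>R axis j 1) + h x"
      by (simp add: p_def algebra_simps)
    moreover have "p t - p 0 - t\<^sup>2 * H x = (H ((x + s *\<^sub>R axis i 1) + r *\<^sub>R axis j 1) - H x) * t\<^sup>2"
      using r(3) by (simp add: power2_eq_square algebra_simps)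
    ultimately show "\<bar>h (x + t *\<^sub>R axis i 1 + t *\<^sub>R axis j 1) - h (x + t *\<^sub>R axis i 1) - h (x + t *\<^sub>R axis j 1) + h x
      - t\<^sup>2 * partial_deriv j (partial_deriv i h) x\<bar> \<le> e * t\<^sup>2"
      by (simp add: abs_mult H_def)
  qed
qed

text \<open>The second difference is symmetric in i and j, so both mixed derivatives are limits of
  the same quotient.\<close>

lemma partial_deriv_commute:
  fixes h :: "real^'n::finite \<Rightarrow> real"
  assumes S: "open S" "x \<in> S" and h: "smooth_on S h"
  shows "partial_deriv i (partial_deriv j h) x = partial_deriv j (partial_deriv i h) x" (is "?a = ?b")
proof (rule ccontr)
  assume ne: "?a \<noteq> ?b"
  \<comment> \<open>The two estimates together bound the gap by 2e, whereas the gap is 3e.\<close>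
  define e where "e = \<bar>?a - ?b\<bar> / 3"
  have e: "e > 0" using ne by (simp add: e_def)
  obtain d1 where d1: "d1 > 0" "\<And>t. 0 < t \<Longrightarrow> t < d1 \<Longrightarrow> \<bar>h (x + t *\<^sub>R axis i 1 + t *\<^sub>R axis j 1)
      - h (x + t *\<^sub>R axis i 1) - h (x + t *\<^sub>R axis j 1) + h x - t\<^sup>2 * ?b\<bar> \<le> e * t\<^sup>2"
    using mixed_difference_quotient[OF S h e, of i j] by blast
  obtain d2 where d2: "d2 > 0" "\<And>t. 0 < t \<Longrightarrow> t < d2 \<Longrightarrow> \<bar>h (x + t *\<^sub>R axis j 1 + t *\<^sub>R axis i 1)
      - h (x + t *\<^sub>R axis j 1) - h (x + t *\<^sub>R axis i 1) + h x - t\<^sup>2 * ?a\<bar> \<le> e * t\<^sup>2"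
    using mixed_difference_quotient[OF S h e, of j i] by blast
  define t where "t = min d1 d2 / 2"
  have t: "0 < t" "t < d1" "t < d2" using d1(1) d2(1) by (auto simp: t_def)
  have "x + t *\<^sub>R axis j 1 + t *\<^sub>R axis i 1 = x + t *\<^sub>R axis i 1 + t *\<^sub>R axis j 1" by (simp add: algebra_simps)
  with d1(2)[OF t(1,2)] d2(2)[OF t(1,3)] have "\<bar>t\<^sup>2 * ?a - t\<^sup>2 * ?b\<bar> \<le> 2 * (e * t\<^sup>2)" by (smt (verit))
  moreover have "t\<^sup>2 * ?a - t\<^sup>2 * ?b = t\<^sup>2 * (?a - ?b)" by (rule right_diff_distrib[symmetric])
  ultimately have "t\<^sup>2 * \<bar>?a - ?b\<bar> \<le> t\<^sup>2 * (2 * e)"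
    by (simp add: abs_mult mult_ac)
  then have "\<bar>?a - ?b\<bar> \<le> 2 * e" using t(1) by simp
  with e show False by (simp add: e_def)
qed

section \<open>Riemannian geometry in coordinates\<close>

lemma matrix_add_rdist: "(A + B) ** C = A ** C + B ** (C::'a::semiring_1^_^_)"
  and matrix_diff_rdistrib: "(A' - B') ** C' = A' ** C' - B' ** (C'::'b::ring_1^_^_)"
  and matrix_diff_ldistrib: "C'' ** (A' - B') = C'' ** A' - C'' ** (B'::'b::ring_1^_^_)"
  and matrix_minus_left: "(- A') ** C' = - (A' ** C')"
  and matrix_minus_right: "C'' ** (- A') = - (C'' ** A')"
  and transpose_add: "transpose (A + B) = transpose A + transpose B"
  and transpose_diff: "transpose (A' - B') = transpose A' - transpose B'"
  and transpose_minus: "transpose (- A') = - transpose A'"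
  by (simp_all add: vec_eq_iff matrix_matrix_mult_def transpose_def algebra_simps sum.distrib
      sum_subtractf sum_negf)

lemma trace_transpose: "trace (transpose (M::real^'k^'k)) = trace M"
  by (simp add: trace_def transpose_def)

lemmas matrix_ring_simps = matrix_add_ldistrib matrix_add_rdist matrix_diff_rdistrib matrix_diff_ldistrib
  matrix_minus_left matrix_minus_right transpose_add transpose_diff transpose_minus
  matrix_transpose_mul matrix_mul_assoc

section \<open>Matrix-valued and vector-valued functions of the coordinates\<close>

definition mderiv :: "'n::finite \<Rightarrow> (real^'n \<Rightarrow> real^'n^'n) \<Rightarrow> real^'n \<Rightarrow> real^'n^'n" where
  "mderiv i M x = (\<chi> a b. partial_deriv i (\<lambda>y. M y $ a $ b) x)"

definition vderiv :: "'n::finite \<Rightarrow> (real^'n \<Rightarrow> real^'n) \<Rightarrow> real^'n \<Rightarrow> real^'n" where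
  "vderiv i V x = (\<chi> a. partial_deriv i (\<lambda>y. V y $ a) x)"

definition smooth_matrix_on :: "(real^'n::finite) set \<Rightarrow> (real^'n \<Rightarrow> real^'n^'n) \<Rightarrow> bool" where
  "smooth_matrix_on S M \<longleftrightarrow> (\<forall>a b. smooth_on S (\<lambda>x. M x $ a $ b))"

definition smooth_vector_on :: "(real^'n::finite) set \<Rightarrow> (real^'n \<Rightarrow> real^'n) \<Rightarrow> bool" where
  "smooth_vector_on S V \<longleftrightarrow> (\<forall>a. smooth_on S (\<lambda>x. V x $ a))"

lemma smooth_matrix_onI: "(\<And>a b. smooth_on S (\<lambda>x. M x $ a $ b)) \<Longrightarrow> smooth_matrix_on S M"
  and smooth_vector_onI: "(\<And>a. smooth_on S (\<lambda>x. V x $ a)) \<Longrightarrow> smooth_vector_on S V"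
  and smooth_matrix_onD: "smooth_matrix_on S M \<Longrightarrow> smooth_on S (\<lambda>x. M x $ a $ b)"
  and smooth_vector_onD: "smooth_vector_on S V \<Longrightarrow> smooth_on S (\<lambda>x. V x $ a)"
  by (simp_all add: smooth_matrix_on_def smooth_vector_on_def)

context
  fixes S :: "(real^'n::finite) set"
  assumes S: "open S"
begin

lemma smooth_matrix_on_mult:
  "smooth_matrix_on S M \<Longrightarrow> smooth_matrix_on S N \<Longrightarrow> smooth_matrix_on S (\<lambda>x. M x ** N x)"
  unfolding smooth_matrix_on_def matrix_matrix_mult_def by (auto intro!: smooth_intros S)

lemma smooth_matrix_on_add:
  "smooth_matrix_on S M \<Longrightarrow> smooth_matrix_on S N \<Longrightarrow> smooth_matrix_on S (\<lambda>x. M x + N x)"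
  unfolding smooth_matrix_on_def by (auto intro!: smooth_on_add S)

lemma smooth_matrix_on_diff:
  "smooth_matrix_on S M \<Longrightarrow> smooth_matrix_on S N \<Longrightarrow> smooth_matrix_on S (\<lambda>x. M x - N x)"
  unfolding smooth_matrix_on_def by (auto intro!: smooth_on_diff S)

lemma smooth_matrix_on_transpose:
  "smooth_matrix_on S M \<Longrightarrow> smooth_matrix_on S (\<lambda>x. transpose (M x))"
  unfolding smooth_matrix_on_def transpose_def by auto

lemma smooth_matrix_on_mderiv: "smooth_matrix_on S M \<Longrightarrow> smooth_matrix_on S (mderiv i M)"
  unfolding smooth_matrix_on_def mderiv_def by (auto intro!: smooth_on_partial_deriv)

lemma smooth_vector_on_mult:
  "smooth_matrix_on S M \<Longrightarrow> smooth_vector_on S V \<Longrightarrow> smooth_vector_on S (\<lambda>x. M x *v V x)"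
  unfolding smooth_matrix_on_def smooth_vector_on_def matrix_vector_mult_def by (auto intro!: smooth_intros S)

lemma smooth_vector_on_add:
  "smooth_vector_on S V \<Longrightarrow> smooth_vector_on S W \<Longrightarrow> smooth_vector_on S (\<lambda>x. V x + W x)"
  unfolding smooth_vector_on_def by (auto intro!: smooth_on_add S)

lemma smooth_vector_on_vderiv: "smooth_vector_on S V \<Longrightarrow> smooth_vector_on S (vderiv i V)"
  unfolding smooth_vector_on_def vderiv_def by (auto intro!: smooth_on_partial_deriv)

lemmas smooth_tensor_intros = smooth_matrix_on_mult smooth_matrix_on_add smooth_matrix_on_diff
  smooth_matrix_on_transpose smooth_matrix_on_mderiv smooth_vector_on_mult smooth_vector_on_add
  smooth_vector_on_vderiv

context
  fixes x assumes x: "x \<in> S"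
begin

lemmas smooth_diff_at = smooth_on_imp_differentiable[OF _ S x]

lemma mderiv_mult:
  assumes "smooth_matrix_on S M" "smooth_matrix_on S N"
  shows "mderiv i (\<lambda>y. M y ** N y) x = mderiv i M x ** N x + M x ** mderiv i N x"
proof -
  have "(\<lambda>x. M x $ a $ b) differentiable at x" "(\<lambda>x. N x $ a $ b) differentiable at x" for a b
    using assms by (auto intro!: smooth_diff_at smooth_matrix_onD)
  then show ?thesis
    by (simp add: vec_eq_iff mderiv_def matrix_matrix_mult_def partial_deriv_sum partial_deriv_mult sum.distrib)
qed

lemma mderiv_add:
  assumes "smooth_matrix_on S M" "smooth_matrix_on S N"
  shows "mderiv i (\<lambda>y. M y + N y) x = mderiv i M x + mderiv i N x"
  using assms by (simp add: vec_eq_iff mderiv_def partial_deriv_add smooth_diff_at smooth_matrix_onD)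

lemma mderiv_diff:
  assumes "smooth_matrix_on S M" "smooth_matrix_on S N"
  shows "mderiv i (\<lambda>y. M y - N y) x = mderiv i M x - mderiv i N x"
  using assms by (simp add: vec_eq_iff mderiv_def partial_deriv_diff smooth_diff_at smooth_matrix_onD)

lemma mderiv_transpose: "mderiv i (\<lambda>y. transpose (M y)) x = transpose (mderiv i M x)"
  by (simp add: vec_eq_iff mderiv_def transpose_def)

lemma mderiv_commute:
  assumes "smooth_matrix_on S M"
  shows "mderiv i (mderiv j M) x = mderiv j (mderiv i M) x"
  using partial_deriv_commute[OF S x smooth_matrix_onD[OF assms], of i j]
  by (simp add: vec_eq_iff mderiv_def)

lemma mderiv_cong:
  assumes "\<And>y. y \<in> S \<Longrightarrow> M y = N y"
  shows "mderiv i M x = mderiv i N x"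
  unfolding mderiv_def vec_eq_iff using assms by (auto intro!: partial_deriv_cong_open[OF S x])

lemma vderiv_mult:
  assumes "smooth_matrix_on S M" "smooth_vector_on S V"
  shows "vderiv i (\<lambda>y. M y *v V y) x = mderiv i M x *v V x + M x *v vderiv i V x"
proof -
  have "(\<lambda>x. M x $ a $ b) differentiable at x" "(\<lambda>x. V x $ a) differentiable at x" for a b
    using smooth_diff_at smooth_matrix_onD[OF assms(1)] smooth_vector_onD[OF assms(2)] by auto
  then show ?thesis
    by (simp add: vec_eq_iff vderiv_def mderiv_def matrix_vector_mult_def partial_deriv_sum partial_deriv_mult sum.distrib)
qed

lemma vderiv_add:
  assumes "smooth_vector_on S V" "smooth_vector_on S W"
  shows "vderiv i (\<lambda>y. V y + W y) x = vderiv i V x + vderiv i W x"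
  using assms by (simp add: vec_eq_iff vderiv_def partial_deriv_add smooth_diff_at smooth_vector_onD)

lemma vderiv_commute:
  assumes "smooth_vector_on S V"
  shows "vderiv i (vderiv j V) x = vderiv j (vderiv i V) x"
  using partial_deriv_commute[OF S x smooth_vector_onD[OF assms], of i j]
  by (simp add: vec_eq_iff vderiv_def)

lemma vderiv_cong:
  assumes "\<And>y. y \<in> S \<Longrightarrow> V y = W y"
  shows "vderiv i V x = vderiv i W x"
  unfolding vderiv_def vec_eq_iff using assms by (auto intro!: partial_deriv_cong_open[OF S x])

end

end

text \<open>Cramer's rule writes each entry of the inverse as a quotient of two determinants, which
  are polynomials in smooth entries.\<close>

lemma smooth_matrix_on_inverse:
  fixes M N :: "real^'n::finite \<Rightarrow> real^'n^'n"
  assumes "open S" "smooth_matrix_on S M" "\<And>x. x \<in> S \<Longrightarrow> M x ** N x = mat 1"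
  shows "smooth_matrix_on S N"
proof (rule smooth_matrix_onI)
  fix a b
  have det: "det (M x) \<noteq> 0" if "x \<in> S" for x
    using assms(3)[OF that] det_mul[of "M x" "N x"] by (metis det_I mult_zero_left zero_neq_one)
  \<comment> \<open>This is M with column a replaced by the b-th unit vector, the numerator matrix
    in Cramer's rule.\<close>
  define A where "A x = (\<chi> i j. if j = a then (axis b 1 :: real^_) $ i else M x $ i $ j)" for x
  have "N x $ a $ b = det (A x) * inverse (det (M x))" if "x \<in> S" for x
  proof -
    have "M x *v (N x *v axis b 1) = axis b 1"
      using assms(3)[OF that] by (simp add: matrix_vector_mul_assoc)
    then have "N x *v axis b 1 = (\<chi> k. det (\<chi> i j. if j = k then (axis b 1 :: real^_) $ i else M x $ i $ j) / det (M x))"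
      using cramer[OF det[OF that]] by blast
    then have "(N x *v axis b 1) $ a = det (A x) / det (M x)" by (simp add: A_def)
    moreover have "(N x *v axis b 1) $ a = N x $ a $ b"
      by (simp add: matrix_vector_mult_basis column_def)
    ultimately show ?thesis by (simp add: divide_inverse)
  qed
  moreover have "smooth_on S (\<lambda>x. det (A x) * inverse (det (M x)))"
  proof -
    have A: "smooth_on S (\<lambda>x. A x $ i $ j)" for i j
      using assms(2) by (cases "j = a") (auto simp: A_def smooth_on_const smooth_matrix_onD)
    have "smooth_on S (\<lambda>x. det (B x))" if "\<And>i j. smooth_on S (\<lambda>x. B x $ i $ j)" for B :: "real^'n \<Rightarrow> real^'n^'n"
      unfolding det_def
    proof (rule smooth_on_sum[OF assms(1)])
      fix p show "smooth_on S (\<lambda>x. of_int (sign p) * (\<Prod>i\<in>UNIV. B x $ i $ p i))"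
        by (rule smooth_on_mult[OF assms(1) smooth_on_const], rule smooth_on_prod[OF assms(1)], rule that)
    qed
    note D = this
    show ?thesis
      by (rule smooth_on_mult[OF assms(1)], rule D[OF A], rule smooth_on_inverse[OF assms(1)],
          rule D[OF smooth_matrix_onD[OF assms(2)]], rule det)
  qed
  ultimately show "smooth_on S (\<lambda>x. N x $ a $ b)"
    by (subst smooth_on_cong[OF assms(1)])
qed

text \<open>This is \<langle>\<nabla>a, \<nabla>b\<rangle>, computed by applying the inverse metric
  to the two differentials.\<close>

definition grad_prod :: "(real^'n::finite \<Rightarrow> real^'n^'n) \<Rightarrow> (real^'n \<Rightarrow> real) \<Rightarrow> (real^'n \<Rightarrow> real) \<Rightarrow> real^'n \<Rightarrow> real" where
  "grad_prod G a b x = (\<Sum>i\<in>UNIV. \<Sum>j\<in>UNIV. matrix_inv (G x) $ i $ j * partial_deriv i a x * partial_deriv j b x)"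

lemma grad_prod_inner:
  "grad_prod H a b x = (\<chi> i. partial_deriv i a x) \<bullet> (matrix_inv (H x) *v (\<chi> i. partial_deriv i b x))"
  by (simp add: grad_prod_def inner_vec_def matrix_vector_mult_def sum_distrib_left mult_ac)

definition laplacian :: "(real^'n::finite \<Rightarrow> real^'n^'n) \<Rightarrow> (real^'n \<Rightarrow> real) \<Rightarrow> real^'n \<Rightarrow> real" where
  "laplacian G h x = trace (hessian_endo G h x)"

section \<open>Levi-Civita connection and curvature of a metric on an open set\<close>

locale riemannian_coords =
  fixes S :: "(real^'n::finite) set" and G :: "real^'n \<Rightarrow> real^'n^'n"
  assumes open_S: "open S"
    and smooth_G: "smooth_matrix_on S G"
    and sym_G: "x \<in> S \<Longrightarrow> transpose (G x) = G x"
    and pos_G: "x \<in> S \<Longrightarrow> v \<noteq> 0 \<Longrightarrow> 0 < v \<bullet> (G x *v v)"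
begin

abbreviation Ginv :: "real^'n \<Rightarrow> real^'n^'n" where "Ginv x \<equiv> matrix_inv (G x)"

lemma differentiable_S: "smooth_on S h \<Longrightarrow> x \<in> S \<Longrightarrow> h differentiable at x"
  using smooth_on_imp_differentiable open_S by blast

text \<open>Positive definiteness makes the kernel of G trivial, which yields a left inverse; for
  square matrices it is two-sided, so the choice hidden in \<open>matrix_inv\<close> is a genuine
  inverse.\<close>

lemma Ginv: "x \<in> S \<Longrightarrow> G x ** Ginv x = mat 1" "x \<in> S \<Longrightarrow> Ginv x ** G x = mat 1"
proof -
  assume x: "x \<in> S"
  have "\<forall>v. G x *v v = 0 \<longrightarrow> v = 0"
    using pos_G[OF x] by (metis inner_zero_right less_irrefl)
  then obtain B where "B ** G x = mat 1" using matrix_left_invertible_ker by blast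
  then have "\<exists>B. G x ** B = mat 1 \<and> B ** G x = mat 1" using matrix_left_right_inverse by blast
  from someI_ex[OF this] show "G x ** Ginv x = mat 1" "Ginv x ** G x = mat 1"
    by (simp_all add: matrix_inv_def)
qed

lemma sym_Ginv: "x \<in> S \<Longrightarrow> transpose (Ginv x) = Ginv x"
proof -
  assume x: "x \<in> S"
  have "G x ** transpose (Ginv x) = transpose (Ginv x ** G x)"
    using sym_G[OF x] by (simp add: matrix_transpose_mul)
  then have "G x ** transpose (Ginv x) = mat 1" using Ginv(2)[OF x] by simp
  then have "(Ginv x ** G x) ** transpose (Ginv x) = Ginv x" by (simp flip: matrix_mul_assoc)
  then show ?thesis using Ginv(2)[OF x] by simp
qed

lemma sym_comp: "x \<in> S \<Longrightarrow> G x $ i $ j = G x $ j $ i" "x \<in> S \<Longrightarrow> Ginv x $ i $ j = Ginv x $ j $ i"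
  using arg_cong[OF sym_G, of x "\<lambda>A. A $ j $ i"] arg_cong[OF sym_Ginv, of x "\<lambda>A. A $ j $ i"]
  by (simp_all add: transpose_def)

lemma psd_Ginv: "x \<in> S \<Longrightarrow> 0 \<le> v \<bullet> (Ginv x *v v)"
proof -
  assume x: "x \<in> S"
  have "v = G x *v (Ginv x *v v)" using Ginv(1)[OF x] by (simp add: matrix_vector_mul_assoc)
  then have "v \<bullet> (Ginv x *v v) = (Ginv x *v v) \<bullet> (G x *v (Ginv x *v v))" by (metis inner_commute)
  also have "\<dots> \<ge> 0" using pos_G[OF x] by (metis inner_zero_left order.strict_implies_order order_refl)
  finally show ?thesis .
qed

lemma smooth_Ginv: "smooth_matrix_on S Ginv"
  using open_S smooth_G Ginv(1) by (rule smooth_matrix_on_inverse)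

text \<open>Matrices act on upper indices: \<open>conn i\<close> is the connection matrix of \<open>\<nabla>\<^bsub>\<partial>\<^sub>i\<^esub>\<close> and \<open>curv i j\<close> that of
  \<open>R(\<partial>\<^sub>i, \<partial>\<^sub>j)\<close>, the row being the upper index. With this convention the second Bianchi identity becomes
  an identity in the noncommutative ring of matrices with commuting derivations.\<close>

definition conn :: "'n \<Rightarrow> real^'n \<Rightarrow> real^'n^'n" where
  "conn i x = (\<chi> k j. christoffel G k i j x)"

definition curv :: "'n \<Rightarrow> 'n \<Rightarrow> real^'n \<Rightarrow> real^'n^'n" where
  "curv i j x = (\<chi> l k. riemann_curv G l i j k x)"

text \<open>The Christoffel symbols of the first kind, with the lowered index as the row.\<close>

definition lowered_conn :: "'n \<Rightarrow> real^'n \<Rightarrow> real^'n^'n" where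
  "lowered_conn i x = (\<chi> l j. (1/2) * (partial_deriv i (\<lambda>y. G y $ j $ l) x
     + partial_deriv j (\<lambda>y. G y $ i $ l) x - partial_deriv l (\<lambda>y. G y $ i $ j) x))"

lemma partial_sym: "x \<in> S \<Longrightarrow> partial_deriv i (\<lambda>y. G y $ j $ k) x = partial_deriv i (\<lambda>y. G y $ k $ j) x"
  by (rule partial_deriv_cong_open[OF open_S]) (auto simp: sym_comp)

lemma conn_eq: "conn i x = Ginv x ** lowered_conn i x"
  by (simp add: vec_eq_iff conn_def christoffel_def lowered_conn_def matrix_matrix_mult_def sum_distrib_left
      mult.left_commute)

lemma conn_torsion_free: "x \<in> S \<Longrightarrow> conn i x $ k $ j = conn j x $ k $ i"
  by (simp add: conn_def christoffel_def partial_sym[of x _ i j] add_ac)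

lemma smooth_conn: "smooth_matrix_on S (conn i)"
proof -
  have "smooth_matrix_on S (lowered_conn i)"
    unfolding lowered_conn_def
    by (intro smooth_matrix_onI)
      (auto intro!: smooth_intros open_S smooth_matrix_onD[OF smooth_G] simp del: times_divide_eq_left)
  then have "smooth_matrix_on S (\<lambda>x. Ginv x ** lowered_conn i x)"
    by (intro smooth_matrix_on_mult open_S smooth_Ginv)
  moreover have "conn i = (\<lambda>x. Ginv x ** lowered_conn i x)" by (rule ext) (rule conn_eq)
  ultimately show ?thesis by simp
qed

text \<open>The last two terms of \<open>lowered_conn\<close> are antisymmetric in row and column
  and vanish when the transpose is added; what remains is the derivative of G.\<close>

lemma metric_compatible:
  assumes x: "x \<in> S"
  shows "mderiv i G x = transpose (conn i x) ** G x + G x ** conn i x"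
proof -
  have L: "G x ** conn i x = lowered_conn i x"
    using Ginv(1)[OF x] by (simp add: conn_eq matrix_mul_assoc)
  then have "transpose (conn i x) ** G x = transpose (lowered_conn i x)"
    using sym_G[OF x] by (metis matrix_transpose_mul)
  moreover have "mderiv i G x = transpose (lowered_conn i x) + lowered_conn i x"
    using partial_sym[OF x, of i] by (simp add: vec_eq_iff transpose_def lowered_conn_def mderiv_def field_simps)
  ultimately show ?thesis using L by simp
qed

text \<open>Differentiate Ginv G = I and insert metric compatibility: the inverse metric is parallel
  too.\<close>

lemma mderiv_Ginv:
  assumes x: "x \<in> S"
  shows "mderiv i Ginv x = - (conn i x ** Ginv x + Ginv x ** transpose (conn i x))"
proof -
  have "mderiv i (\<lambda>y. Ginv y ** G y) x = mderiv i (\<lambda>y. mat 1) x"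
    using Ginv(2) by (intro mderiv_cong[OF open_S x])
  then have "mderiv i Ginv x ** G x + Ginv x ** mderiv i G x = 0"
    by (simp add: mderiv_mult[OF open_S x smooth_Ginv smooth_G]) (simp add: mderiv_def vec_eq_iff)
  then have "(mderiv i Ginv x ** G x + Ginv x ** mderiv i G x) ** Ginv x = 0"
    by (simp add: vec_eq_iff matrix_matrix_mult_def)
  then have "mderiv i Ginv x ** (G x ** Ginv x) + Ginv x ** transpose (conn i x) ** (G x ** Ginv x)
      + Ginv x ** G x ** conn i x ** Ginv x = 0"
    unfolding metric_compatible[OF x] by (simp add: matrix_ring_simps add_ac)
  then show ?thesis
    using Ginv[OF x] by (simp add: eq_neg_iff_add_eq_0 add_ac del: minus_add_distrib)
qed

lemma curv_eq:
  "curv i j x = mderiv i (conn j) x - mderiv j (conn i) x + conn i x ** conn j x - conn j x ** conn i x"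
  by (simp add: vec_eq_iff curv_def riemann_curv_def mderiv_def conn_def matrix_matrix_mult_def
      sum_subtractf algebra_simps)

lemma curv_antisym: "curv j i x = - curv i j x"
  by (simp add: curv_eq)

lemma smooth_curv: "smooth_matrix_on S (curv i j)"
proof -
  have "curv i j = (\<lambda>x. mderiv i (conn j) x - mderiv j (conn i) x + conn i x ** conn j x - conn j x ** conn i x)"
    by (rule ext) (rule curv_eq)
  then show ?thesis by (simp add: smooth_tensor_intros open_S smooth_conn)
qed

lemma mderiv_curv:
  assumes x: "x \<in> S"
  shows "mderiv k (curv i j) x = mderiv k (mderiv i (conn j)) x - mderiv k (mderiv j (conn i)) x
    + mderiv k (conn i) x ** conn j x + conn i x ** mderiv k (conn j) x
    - mderiv k (conn j) x ** conn i x - conn j x ** mderiv k (conn i) x"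
proof -
  have "curv i j = (\<lambda>x. mderiv i (conn j) x - mderiv j (conn i) x + conn i x ** conn j x - conn j x ** conn i x)"
    by (rule ext) (rule curv_eq)
  then show ?thesis
    by (simp add: mderiv_add[OF open_S x] mderiv_diff[OF open_S x] mderiv_mult[OF open_S x]
        smooth_tensor_intros open_S smooth_conn)
qed

text \<open>Each bracket differentiates the endomorphism only and treats the two form indices as
  labels. In the full covariant derivative the connection terms on those indices cancel in the
  cyclic sum, since the connection is torsion free. After expansion the second derivatives cancel by
  commutation and the products cancel as words in the ring.\<close>

lemma second_bianchi:
  assumes x: "x \<in> S"
  shows "(mderiv k (curv i j) x + conn k x ** curv i j x - curv i j x ** conn k x)
    + (mderiv i (curv j k) x + conn i x ** curv j k x - curv j k x ** conn i x)
    + (mderiv j (curv k i) x + conn j x ** curv k i x - curv k i x ** conn j x) = 0"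
  unfolding mderiv_curv[OF x] unfolding curv_eq
  using mderiv_commute[OF open_S x smooth_conn, of k i j] mderiv_commute[OF open_S x smooth_conn, of k j i]
    mderiv_commute[OF open_S x smooth_conn, of i j k]
  by (simp add: matrix_ring_simps)

text \<open>This is \<open>\<partial>\<^sub>i \<partial>\<^sub>j G = \<partial>\<^sub>j \<partial>\<^sub>i G\<close>, expanded by metric compatibility.\<close>

lemma curv_metric_antisym:
  assumes x: "x \<in> S"
  shows "transpose (curv i j x) ** G x + G x ** curv i j x = 0"
proof -
  have D: "mderiv i (mderiv j G) x = transpose (mderiv i (conn j) x) ** G x
      + transpose (conn j x) ** (transpose (conn i x) ** G x + G x ** conn i x)
      + (transpose (conn i x) ** G x + G x ** conn i x) ** conn j x + G x ** mderiv i (conn j) x" for i j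
  proof -
    have "mderiv i (mderiv j G) x = mderiv i (\<lambda>y. transpose (conn j y) ** G y + G y ** conn j y) x"
      using metric_compatible by (intro mderiv_cong[OF open_S x])
    then show ?thesis
      by (simp add: mderiv_add[OF open_S x] mderiv_mult[OF open_S x] mderiv_transpose[OF open_S x]
          smooth_tensor_intros open_S smooth_conn smooth_G metric_compatible[OF x] add.assoc)
  qed
  have "mderiv i (mderiv j G) x = mderiv j (mderiv i G) x"
    by (rule mderiv_commute[OF open_S x smooth_G])
  then show ?thesis
    unfolding D curv_eq by (simp add: matrix_ring_simps algebra_simps)
qed

text \<open>With both matrix indices upper, skew-adjointness with respect to the metric becomes
  plain antisymmetry of the matrix, and later contractions are sums without metric factors.\<close>

definition raised_curv :: "'n \<Rightarrow> 'n \<Rightarrow> real^'n \<Rightarrow> real^'n^'n" where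
  "raised_curv i j x = curv i j x ** Ginv x"

lemma smooth_raised_curv: "smooth_matrix_on S (raised_curv i j)"
  unfolding raised_curv_def by (intro smooth_matrix_on_mult open_S smooth_curv smooth_Ginv)

lemma raised_curv_antisym: "raised_curv j i x = - raised_curv i j x"
  by (simp add: raised_curv_def curv_antisym[of j i] matrix_minus_left)

lemma transpose_raised_curv:
  assumes x: "x \<in> S"
  shows "transpose (raised_curv i j x) = - raised_curv i j x"
proof -
  have "Ginv x ** (transpose (curv i j x) ** G x + G x ** curv i j x) ** Ginv x = 0"
    using curv_metric_antisym[OF x] by (simp add: vec_eq_iff matrix_matrix_mult_def)
  then have "Ginv x ** transpose (curv i j x) ** (G x ** Ginv x) + (Ginv x ** G x) ** curv i j x ** Ginv x = 0"
    by (simp add: matrix_ring_simps)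
  then show ?thesis
    using Ginv[OF x] sym_Ginv[OF x] by (simp add: raised_curv_def matrix_transpose_mul eq_neg_iff_add_eq_0)
qed

text \<open>The connection acts on the two matrix indices only; the corrections for the lower i and
  j are left out, as in the second Bianchi identity above.\<close>

definition cov_raised_curv :: "'n \<Rightarrow> 'n \<Rightarrow> 'n \<Rightarrow> real^'n \<Rightarrow> real^'n^'n" where
  "cov_raised_curv k i j x = mderiv k (raised_curv i j) x + conn k x ** raised_curv i j x
     + raised_curv i j x ** transpose (conn k x)"

lemma cov_raised_curv_cyclic:
  assumes x: "x \<in> S"
  shows "cov_raised_curv k i j x + cov_raised_curv i j k x + cov_raised_curv j k i x = 0"
proof -
  \<comment> \<open>Because the inverse metric is parallel, raising the index commutes with
    covariant differentiation.\<close>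
  have E: "cov_raised_curv k i j x
      = (mderiv k (curv i j) x + conn k x ** curv i j x - curv i j x ** conn k x) ** Ginv x" for k i j
    unfolding cov_raised_curv_def raised_curv_def
    by (simp add: mderiv_mult[OF open_S x] smooth_curv smooth_Ginv mderiv_Ginv[OF x] matrix_ring_simps)
  show ?thesis
    unfolding E using second_bianchi[OF x, of k i j]
    by (simp flip: matrix_add_rdist)
qed

text \<open>The connection enters once as \<open>conn k\<close> on the left and once transposed on
  the right, so transposition commutes with this derivative and both antisymmetries of the raised
  curvature are inherited.\<close>

lemma cov_raised_curv_antisym:
  assumes x: "x \<in> S"
  shows "cov_raised_curv k j i x $ a $ b = - cov_raised_curv k i j x $ a $ b"
    "cov_raised_curv k i j x $ b $ a = - cov_raised_curv k i j x $ a $ b"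
proof -
  have "mderiv k (raised_curv j i) x = - mderiv k (raised_curv i j) x"
    using raised_curv_antisym[of j i]
    by (simp add: vec_eq_iff mderiv_def partial_deriv_minus differentiable_S[OF _ x] smooth_matrix_onD[OF smooth_raised_curv])
  then have anti: "cov_raised_curv k j i x = - cov_raised_curv k i j x"
    by (simp add: cov_raised_curv_def raised_curv_antisym[of j i] matrix_ring_simps)
  then show "cov_raised_curv k j i x $ a $ b = - cov_raised_curv k i j x $ a $ b" by simp
  have "mderiv k (\<lambda>y. transpose (raised_curv i j y)) x = mderiv k (raised_curv j i) x"
    using transpose_raised_curv raised_curv_antisym by (intro mderiv_cong[OF open_S x]) metis
  then have "transpose (cov_raised_curv k i j x) = cov_raised_curv k j i x"
    using transpose_raised_curv[OF x, of i j] raised_curv_antisym[of j i x]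
    by (simp add: cov_raised_curv_def mderiv_transpose[OF open_S x] matrix_ring_simps)
  then have "transpose (cov_raised_curv k i j x) = - cov_raised_curv k i j x"
    unfolding anti .
  then have "transpose (cov_raised_curv k i j x) $ a $ b = (- cov_raised_curv k i j x) $ a $ b"
    by (rule arg_cong)
  then show "cov_raised_curv k i j x $ b $ a = - cov_raised_curv k i j x $ a $ b"
    by (simp add: transpose_def)
qed

text \<open>In \<open>raised_ricci\<close>, \<open>divg\<close> and \<open>raised_hess\<close> the first index is the lower one and the second the
  raised one, i.e. the matrices are the transposes of the corresponding endomorphisms.\<close>

definition raised_ricci :: "real^'n \<Rightarrow> real^'n^'n" where
  "raised_ricci x = ricci G x ** Ginv x"

lemma raised_ricci_eq:
  assumes x: "x \<in> S"
  shows "raised_ricci x $ i $ m = (\<Sum>l\<in>UNIV. raised_curv i l x $ m $ l)"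
proof -
  have "raised_ricci x $ i $ m = (\<Sum>k\<in>UNIV. \<Sum>l\<in>UNIV. curv l i x $ l $ k * Ginv x $ k $ m)"
    by (simp add: raised_ricci_def matrix_matrix_mult_def ricci_def curv_def sum_distrib_right)
  also have "\<dots> = (\<Sum>l\<in>UNIV. raised_curv l i x $ l $ m)"
    by (subst sum.swap) (simp add: raised_curv_def matrix_matrix_mult_def)
  also have "\<dots> = (\<Sum>l\<in>UNIV. raised_curv i l x $ m $ l)"
  proof (rule sum.cong[OF refl])
    fix l
    have "raised_curv l i x = transpose (raised_curv i l x)"
      using transpose_raised_curv[OF x, of i l] raised_curv_antisym[of l i x] by simp
    then show "raised_curv l i x $ l $ m = raised_curv i l x $ m $ l" by (simp add: transpose_def)
  qed
  finally show ?thesis .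
qed

definition divg :: "(real^'n \<Rightarrow> real^'n^'n) \<Rightarrow> 'n \<Rightarrow> real^'n \<Rightarrow> real" where
  "divg M i x = (\<Sum>k\<in>UNIV. partial_deriv k (\<lambda>y. M y $ i $ k) x)
     + (\<Sum>k\<in>UNIV. \<Sum>m\<in>UNIV. conn k x $ k $ m * M x $ i $ m)
     - (\<Sum>k\<in>UNIV. \<Sum>m\<in>UNIV. conn i x $ k $ m * M x $ k $ m)"

text \<open>Contract the cyclic identity for the raised curvature over both pairs of indices; by the two
  antisymmetries the third cyclic term contributes the same as the first.\<close>

lemma contracted_bianchi:
  assumes x: "x \<in> S"
  shows "divg raised_ricci i x = (1/2) * partial_deriv i (\<lambda>y. trace (raised_ricci y)) x"
proof -
  define D where "D k i j a b = cov_raised_curv k i j x $ a $ b" for k i j a b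
  define q where "q i j a b = raised_curv i j x $ a $ b" for i j a b
  define dq where "dq k i j a b = partial_deriv k (\<lambda>y. raised_curv i j y $ a $ b) x" for k i j a b
  define C where "C i k m = conn i x $ k $ m" for i k m
  define E where "E i m = raised_ricci x $ i $ m" for i m
  have diff: "(\<lambda>y. raised_curv i j y $ a $ b) differentiable at x" for i j a b
    using smooth_matrix_onD[OF smooth_raised_curv] differentiable_S x by blast
  have D: "D k i j a b = dq k i j a b + (\<Sum>m\<in>UNIV. C k a m * q i j m b) + (\<Sum>m\<in>UNIV. q i j a m * C k b m)"
    for k i j a b
    by (simp add: D_def dq_def C_def q_def cov_raised_curv_def matrix_matrix_mult_def transpose_def mderiv_def)
  have Danti: "D k j i a b = - D k i j a b" "D k i j b a = - D k i j a b" for k i j a b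
    unfolding D_def by (rule cov_raised_curv_antisym[OF x])+
  have Dcyc: "D k i j a b + D i j k a b + D j k i a b = 0" for k i j a b
    using arg_cong[OF cov_raised_curv_cyclic[OF x], of "\<lambda>A. A $ a $ b" k i j] by (simp add: D_def)
  have qanti: "q j i a b = - q i j a b" for i j a b
    unfolding q_def using raised_curv_antisym[of j i x] by simp
  have qanti': "q i j b a = - q i j a b" for i j a b
    using arg_cong[OF transpose_raised_curv[OF x], of "\<lambda>A. A $ a $ b" i j] by (simp add: q_def transpose_def)
  have C: "C k j m = C m j k" for k j m unfolding C_def by (rule conn_torsion_free[OF x])
  have E: "E i m = (\<Sum>l\<in>UNIV. q i l m l)" for i m
    unfolding E_def q_def by (rule raised_ricci_eq[OF x])
  have dE: "partial_deriv k (\<lambda>y. raised_ricci y $ i $ m) x = (\<Sum>l\<in>UNIV. dq k i l m l)" for k i m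
  proof -
    have "partial_deriv k (\<lambda>y. raised_ricci y $ i $ m) x = partial_deriv k (\<lambda>y. \<Sum>l\<in>UNIV. raised_curv i l y $ m $ l) x"
      by (rule partial_deriv_cong_open[OF open_S x]) (rule raised_ricci_eq)
    then show ?thesis using diff by (simp add: partial_deriv_sum dq_def)
  qed
  have dtr: "partial_deriv i (\<lambda>y. trace (raised_ricci y)) x = (\<Sum>k\<in>UNIV. \<Sum>l\<in>UNIV. dq i k l k l)"
  proof -
    have "partial_deriv i (\<lambda>y. trace (raised_ricci y)) x
        = partial_deriv i (\<lambda>y. \<Sum>k\<in>UNIV. \<Sum>l\<in>UNIV. raised_curv k l y $ k $ l) x"
      by (rule partial_deriv_cong_open[OF open_S x]) (simp add: trace_def raised_ricci_eq)
    then show ?thesis using diff by (simp add: partial_deriv_sum differentiable_sum dq_def)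
  qed
  \<comment> \<open>\<open>q\<close> is antisymmetric in its matrix indices k and m, while
    \<open>C k j m\<close> is symmetric in k and m because the connection is torsion free.\<close>
  have zero: "(\<Sum>k\<in>UNIV. \<Sum>j\<in>UNIV. \<Sum>m\<in>UNIV. q i j k m * C k j m) = 0" (is "?X = 0")
  proof -
    have "?X = (\<Sum>j\<in>UNIV. \<Sum>k\<in>UNIV. \<Sum>m\<in>UNIV. q i j k m * C k j m)" by (rule sum.swap)
    also have "\<dots> = (\<Sum>j\<in>UNIV. \<Sum>m\<in>UNIV. \<Sum>k\<in>UNIV. q i j k m * C k j m)" by (intro sum.cong refl sum.swap)
    also have "\<dots> = (\<Sum>j\<in>UNIV. \<Sum>m\<in>UNIV. \<Sum>k\<in>UNIV. - (q i j m k * C m j k))"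
      by (intro sum.cong refl) (subst C, subst qanti', simp)
    also have "\<dots> = - (\<Sum>j\<in>UNIV. \<Sum>m\<in>UNIV. \<Sum>k\<in>UNIV. q i j m k * C m j k)" by (simp add: sum_negf)
    also have "(\<Sum>j\<in>UNIV. \<Sum>m\<in>UNIV. \<Sum>k\<in>UNIV. q i j m k * C m j k) = ?X" by (rule sum.swap)
    finally show ?thesis by simp
  qed
  \<comment> \<open>\<open>divg\<close> contains the connection term for the lower index i, but
    \<open>cov_raised_curv\<close> does not; the difference is the extra sum. In \<open>sum2\<close>
    the same sum occurs twice, which is exactly what 2 * \<open>sum1\<close> needs for
    cancellation.\<close>
  have sum1: "(\<Sum>k\<in>UNIV. \<Sum>j\<in>UNIV. D k i j k j)
      = divg raised_ricci i x + (\<Sum>k\<in>UNIV. \<Sum>m\<in>UNIV. C i k m * E k m)"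
  proof -
    have "(\<Sum>k\<in>UNIV. \<Sum>j\<in>UNIV. \<Sum>m\<in>UNIV. C k k m * q i j m j) = (\<Sum>k\<in>UNIV. \<Sum>m\<in>UNIV. C k k m * E i m)"
      unfolding E sum_distrib_left by (intro sum.cong refl sum.swap)
    then show ?thesis
      by (simp add: D sum.distrib zero divg_def dE flip: C_def E_def)
  qed
  have sum2: "(\<Sum>k\<in>UNIV. \<Sum>j\<in>UNIV. D i k j k j)
      = partial_deriv i (\<lambda>y. trace (raised_ricci y)) x + 2 * (\<Sum>k\<in>UNIV. \<Sum>m\<in>UNIV. C i k m * E k m)"
  proof -
    have 1: "(\<Sum>k\<in>UNIV. \<Sum>j\<in>UNIV. \<Sum>m\<in>UNIV. C i k m * q k j m j) = (\<Sum>k\<in>UNIV. \<Sum>m\<in>UNIV. C i k m * E k m)"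
      unfolding E sum_distrib_left by (intro sum.cong refl sum.swap)
    have "(\<Sum>k\<in>UNIV. \<Sum>j\<in>UNIV. \<Sum>m\<in>UNIV. q k j k m * C i j m)
        = (\<Sum>j\<in>UNIV. \<Sum>k\<in>UNIV. \<Sum>m\<in>UNIV. q k j k m * C i j m)" by (rule sum.swap)
    also have "\<dots> = (\<Sum>j\<in>UNIV. \<Sum>k\<in>UNIV. \<Sum>m\<in>UNIV. C i j m * q j k m k)"
      by (intro sum.cong refl) (subst qanti, subst qanti', simp)
    also note 1
    finally show ?thesis using 1 by (simp add: D sum.distrib dtr)
  qed
  have "D k i j k j - D i k j k j + D j k i k j = 0" for j k
    using Dcyc[of k i j k j] Danti(1)[of i k j k j] by simp
  then have "0 = (\<Sum>k\<in>UNIV. \<Sum>j\<in>UNIV. D k i j k j - D i k j k j + D j k i k j)" by simp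
  also have "\<dots> = (\<Sum>k\<in>UNIV. \<Sum>j\<in>UNIV. D k i j k j) - (\<Sum>k\<in>UNIV. \<Sum>j\<in>UNIV. D i k j k j)
      + (\<Sum>k\<in>UNIV. \<Sum>j\<in>UNIV. D j k i k j)"
    by (simp add: sum.distrib sum_subtractf)
  also have "(\<Sum>k\<in>UNIV. \<Sum>j\<in>UNIV. D j k i k j) = (\<Sum>j\<in>UNIV. \<Sum>k\<in>UNIV. D j k i k j)" by (rule sum.swap)
  also have "\<dots> = (\<Sum>j\<in>UNIV. \<Sum>k\<in>UNIV. D j i k j k)"
    by (intro sum.cong refl) (subst Danti(1), subst Danti(2), simp)
  finally have "2 * (\<Sum>k\<in>UNIV. \<Sum>j\<in>UNIV. D k i j k j) = (\<Sum>k\<in>UNIV. \<Sum>j\<in>UNIV. D i k j k j)" by simp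
  then show ?thesis unfolding sum1 sum2 by simp
qed

section \<open>Gradient, Hessian and the Bochner formula\<close>

lemma smooth_gradient: "smooth_on S h \<Longrightarrow> smooth_vector_on S (gradient G h)"
  unfolding gradient_def
  by (rule smooth_vector_on_mult[OF open_S smooth_Ginv]) (auto intro!: smooth_vector_onI smooth_on_partial_deriv)

definition cov_grad :: "(real^'n \<Rightarrow> real) \<Rightarrow> 'n \<Rightarrow> real^'n \<Rightarrow> real^'n" where
  "cov_grad h i x = vderiv i (gradient G h) x + conn i x *v gradient G h x"

definition raised_hess :: "(real^'n \<Rightarrow> real) \<Rightarrow> real^'n \<Rightarrow> real^'n^'n" where
  "raised_hess h x = hessian G h x ** Ginv x"

lemma G_gradient: "x \<in> S \<Longrightarrow> G x *v gradient G h x = (\<chi> i. partial_deriv i h x)"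
  using Ginv by (simp add: gradient_def matrix_vector_mul_assoc)

text \<open>Differentiate G \<nabla>h = dh. Metric compatibility moves the connection onto dh, which
  is the Christoffel term of the Hessian.\<close>

lemma G_cov_grad:
  assumes x: "x \<in> S" and h: "smooth_on S h"
  shows "G x *v cov_grad h i x = hessian G h x $ i"
proof -
  let ?V = "gradient G h"
  have "vderiv i (\<lambda>y. \<chi> j. partial_deriv j h y) x = vderiv i (\<lambda>y. G y *v ?V y) x"
    by (rule vderiv_cong[OF open_S x]) (simp add: G_gradient)
  also have "\<dots> = mderiv i G x *v ?V x + G x *v vderiv i ?V x"
    by (rule vderiv_mult[OF open_S x smooth_G smooth_gradient[OF h]])
  also have "\<dots> = transpose (conn i x) *v (G x *v ?V x) + G x *v cov_grad h i x"
    unfolding metric_compatible[OF x] cov_grad_def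
    by (simp add: matrix_vector_mult_add_rdistrib matrix_vector_right_distrib del: transpose_matrix_vector)
       (simp add: matrix_vector_mul_assoc del: transpose_matrix_vector)
  finally have "vderiv i (\<lambda>y. \<chi> j. partial_deriv j h y) x
      = transpose (conn i x) *v (\<chi> i. partial_deriv i h x) + G x *v cov_grad h i x"
    by (simp only: G_gradient[OF x])
  then have "(vderiv i (\<lambda>y. \<chi> j. partial_deriv j h y) x) $ j
      = (transpose (conn i x) *v (\<chi> i. partial_deriv i h x)) $ j + (G x *v cov_grad h i x) $ j" for j
    by simp
  then show ?thesis
    by (simp add: vec_eq_iff vderiv_def hessian_def matrix_vector_mult_def transpose_def conn_def
        del: transpose_matrix_vector)
qed

lemma hessian_sym:
  assumes x: "x \<in> S" and h: "smooth_on S h"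
  shows "hessian G h x $ i $ j = hessian G h x $ j $ i"
  using partial_deriv_commute[OF open_S x h, of i j] conn_torsion_free[OF x, of i _ j]
  by (simp add: hessian_def conn_def)

lemma transpose_hessian: "x \<in> S \<Longrightarrow> smooth_on S h \<Longrightarrow> transpose (hessian G h x) = hessian G h x"
  unfolding vec_eq_iff transpose_def vec_lambda_beta using hessian_sym by blast

lemma cov_grad_eq:
  assumes x: "x \<in> S" and h: "smooth_on S h"
  shows "cov_grad h i x $ m = raised_hess h x $ i $ m"
proof -
  have "cov_grad h i x = Ginv x *v (G x *v cov_grad h i x)"
    using Ginv(2)[OF x] by (simp add: matrix_vector_mul_assoc)
  also have "\<dots> = Ginv x *v (hessian G h x $ i)" by (simp only: G_cov_grad[OF x h])
  finally show ?thesis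
    using sym_comp(2)[OF x, of m] by (simp add: matrix_vector_mult_def raised_hess_def matrix_matrix_mult_def mult.commute)
qed

lemma hessian_endo_eq:
  assumes x: "x \<in> S" and h: "smooth_on S h"
  shows "hessian_endo G h x = transpose (raised_hess h x)"
  by (simp add: hessian_endo_def raised_hess_def matrix_transpose_mul transpose_hessian[OF x h] sym_Ginv[OF x])

lemma laplacian_eq: "x \<in> S \<Longrightarrow> smooth_on S h \<Longrightarrow> laplacian G h x = trace (raised_hess h x)"
  by (simp add: laplacian_def hessian_endo_eq trace_transpose)

lemma trace_hessian_endo_sq:
  "x \<in> S \<Longrightarrow> smooth_on S h \<Longrightarrow>
    trace (hessian_endo G h x ** hessian_endo G h x) = trace (raised_hess h x ** raised_hess h x)"
  by (simp add: hessian_endo_eq trace_transpose flip: matrix_transpose_mul)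

lemma smooth_hessian:
  assumes h: "smooth_on S h"
  shows "smooth_matrix_on S (hessian G h)"
proof -
  have "smooth_on S (christoffel G k i j)" for k i j
    using smooth_matrix_onD[OF smooth_conn, of i k j] by (simp add: conn_def)
  then show ?thesis
    unfolding hessian_def
    by (intro smooth_matrix_onI) (auto intro!: smooth_on_diff smooth_on_sum smooth_on_mult smooth_on_partial_deriv open_S h)
qed

lemma smooth_raised_hess: "smooth_on S h \<Longrightarrow> smooth_matrix_on S (raised_hess h)"
  unfolding raised_hess_def by (intro smooth_matrix_on_mult open_S smooth_Ginv smooth_hessian)

lemma smooth_laplacian:
  assumes h: "smooth_on S h"
  shows "smooth_on S (laplacian G h)"
proof -
  have "smooth_on S (\<lambda>x. trace (raised_hess h x))"
    unfolding trace_def by (intro smooth_on_sum open_S smooth_matrix_onD smooth_raised_hess h)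
  then show ?thesis by (subst smooth_on_cong[OF open_S laplacian_eq[OF _ h]])
qed

text \<open>Commuting two covariant derivatives of \<nabla>h produces the curvature applied to
  \<nabla>h, and the trace of this over the differentiation index is the Ricci term.\<close>

lemma divg_raised_hess:
  assumes x: "x \<in> S" and h: "smooth_on S h"
  shows "divg (raised_hess h) i x = partial_deriv i (laplacian G h) x + (ricci G x *v gradient G h x) $ i"
proof -
  let ?V = "gradient G h"
  note V = smooth_gradient[OF h]
  have dB: "vderiv k (cov_grad h i) x = vderiv k (vderiv i ?V) x + mderiv k (conn i) x *v ?V x + conn i x *v vderiv k ?V x" for k i
  proof -
    have "cov_grad h i = (\<lambda>y. vderiv i ?V y + conn i y *v ?V y)" by (rule ext) (rule cov_grad_def)
    then show ?thesis
      by (simp add: vderiv_add[OF open_S x] vderiv_mult[OF open_S x] smooth_tensor_intros open_S smooth_conn V)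
  qed
  \<comment> \<open>The lower-index corrections are symmetric in k and i and drop out of the
    commutator. After the trace over k, the term with \<open>conn i\<close> becomes the third sum in
    \<open>divg\<close>.\<close>
  have R: "vderiv k (cov_grad h i) x + conn k x *v cov_grad h i x - vderiv i (cov_grad h k) x - conn i x *v cov_grad h k x
      = curv k i x *v ?V x" for k
    unfolding dB curv_eq unfolding cov_grad_def vderiv_commute[OF open_S x V, of k i]
    by (simp add: matrix_vector_mult_add_rdistrib matrix_vector_right_distrib matrix_vector_mult_diff_rdistrib
        matrix_vector_mul_assoc)
  have c: "vderiv k (cov_grad h j) x $ m = partial_deriv k (\<lambda>y. raised_hess h y $ j $ m) x" for k j m
    unfolding vderiv_def by (simp, rule partial_deriv_cong_open[OF open_S x cov_grad_eq[OF _ h]])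
  have "(\<Sum>k\<in>UNIV. (vderiv k (cov_grad h i) x + conn k x *v cov_grad h i x - vderiv i (cov_grad h k) x
      - conn i x *v cov_grad h k x) $ k) = (\<Sum>k\<in>UNIV. (curv k i x *v ?V x) $ k)"
    unfolding R ..
  also have "\<dots> = (\<Sum>k\<in>UNIV. \<Sum>m\<in>UNIV. riemann_curv G k k i m x * ?V x $ m)"
    by (simp add: matrix_vector_mult_def curv_def)
  also have "\<dots> = (ricci G x *v ?V x) $ i"
    by (subst sum.swap) (simp add: matrix_vector_mult_def ricci_def sum_distrib_right)
  finally have *: "(\<Sum>k\<in>UNIV. (vderiv k (cov_grad h i) x + conn k x *v cov_grad h i x - vderiv i (cov_grad h k) x
      - conn i x *v cov_grad h k x) $ k) = (ricci G x *v ?V x) $ i" .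
  have "partial_deriv i (laplacian G h) x = partial_deriv i (\<lambda>y. \<Sum>k\<in>UNIV. raised_hess h y $ k $ k) x"
    by (rule partial_deriv_cong_open[OF open_S x]) (simp add: laplacian_eq h trace_def)
  also have "\<dots> = (\<Sum>k\<in>UNIV. partial_deriv i (\<lambda>y. raised_hess h y $ k $ k) x)"
    by (rule partial_deriv_sum) (rule differentiable_S[OF smooth_matrix_onD[OF smooth_raised_hess[OF h]] x])
  finally show ?thesis
    using * by (simp add: sum.distrib sum_subtractf c divg_def matrix_vector_mult_def cov_grad_eq[OF x h])
qed

lemma grad_prod_eq: "x \<in> S \<Longrightarrow> grad_prod G a b x = (\<Sum>j\<in>UNIV. gradient G a x $ j * partial_deriv j b x)"
  unfolding grad_prod_def
  by (subst sum.swap) (simp add: gradient_def matrix_vector_mult_def sum_distrib_right sym_comp(2)[of x])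

lemma grad_prod_sym: "x \<in> S \<Longrightarrow> grad_prod G a b x = grad_prod G b a x"
  unfolding grad_prod_def
  by (subst sum.swap) (intro sum.cong refl, subst sym_comp(2), auto)

lemma smooth_grad_prod:
  assumes "smooth_on S a" "smooth_on S b"
  shows "smooth_on S (grad_prod G a b)"
  unfolding grad_prod_def
  by (intro smooth_on_sum smooth_on_mult smooth_on_partial_deriv open_S smooth_matrix_onD[OF smooth_Ginv] assms)

text \<open>The product is read as dual pairing of the vector \<nabla>a with the covector db.
  Passing to covariant derivatives introduces connection terms of opposite signs on the two factors,
  which cancel after renaming indices.\<close>

lemma partial_deriv_grad_prod:
  assumes x: "x \<in> S" and a: "smooth_on S a" and b: "smooth_on S b"
  shows "partial_deriv k (grad_prod G a b) x
    = (hessian G a x *v gradient G b x) $ k + (hessian G b x *v gradient G a x) $ k"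
proof -
  let ?V = "\<lambda>j. gradient G a x $ j"
  have "partial_deriv k (grad_prod G a b) x = partial_deriv k (\<lambda>y. \<Sum>j\<in>UNIV. gradient G a y $ j * partial_deriv j b y) x"
    by (rule partial_deriv_cong_open[OF open_S x grad_prod_eq])
  also have "\<dots> = (\<Sum>j\<in>UNIV. partial_deriv k (\<lambda>y. gradient G a y $ j) x * partial_deriv j b x
      + ?V j * partial_deriv k (partial_deriv j b) x)"
  proof (subst partial_deriv_sum)
    have d: "(\<lambda>y. gradient G a y $ j) differentiable at x" "partial_deriv j b differentiable at x" for j
      using differentiable_S[OF _ x] smooth_vector_onD[OF smooth_gradient[OF a]] smooth_on_partial_deriv[OF b] by auto
    then show "(\<lambda>y. gradient G a y $ j * partial_deriv j b y) differentiable at x" for j by auto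
    show "(\<Sum>j\<in>UNIV. partial_deriv k (\<lambda>y. gradient G a y $ j * partial_deriv j b y) x)
      = (\<Sum>j\<in>UNIV. partial_deriv k (\<lambda>y. gradient G a y $ j) x * partial_deriv j b x
      + ?V j * partial_deriv k (partial_deriv j b) x)"
      using d by (simp add: partial_deriv_mult)
  qed
  also have "\<dots> = (\<Sum>j\<in>UNIV. (cov_grad a k x $ j - (\<Sum>m\<in>UNIV. conn k x $ j $ m * ?V m)) * partial_deriv j b x
      + ?V j * (hessian G b x $ k $ j + (\<Sum>m\<in>UNIV. conn k x $ m $ j * partial_deriv m b x)))"
    by (simp add: cov_grad_def vderiv_def matrix_vector_mult_def hessian_def conn_def)
  also have "\<dots> = (\<Sum>j\<in>UNIV. cov_grad a k x $ j * partial_deriv j b x) + (\<Sum>j\<in>UNIV. ?V j * hessian G b x $ k $ j)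
      - (\<Sum>j\<in>UNIV. \<Sum>m\<in>UNIV. conn k x $ j $ m * ?V m * partial_deriv j b x)
      + (\<Sum>j\<in>UNIV. \<Sum>m\<in>UNIV. ?V j * (conn k x $ m $ j * partial_deriv m b x))"
    by (simp add: algebra_simps sum.distrib sum_subtractf sum_distrib_left sum_distrib_right)
  also have "(\<Sum>j\<in>UNIV. \<Sum>m\<in>UNIV. ?V j * (conn k x $ m $ j * partial_deriv m b x))
      = (\<Sum>j\<in>UNIV. \<Sum>m\<in>UNIV. conn k x $ j $ m * ?V m * partial_deriv j b x)"
    by (subst sum.swap) (simp add: mult_ac)
  also have "(\<Sum>j\<in>UNIV. cov_grad a k x $ j * partial_deriv j b x) = (hessian G a x *v gradient G b x) $ k"
  proof -
    have "(\<Sum>j\<in>UNIV. cov_grad a k x $ j * partial_deriv j b x) = (raised_hess a x *v (\<chi> j. partial_deriv j b x)) $ k"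
      by (simp add: cov_grad_eq[OF x a] matrix_vector_mult_def)
    then show ?thesis by (simp add: raised_hess_def gradient_def matrix_vector_mul_assoc)
  qed
  also have "(\<Sum>j\<in>UNIV. ?V j * hessian G b x $ k $ j) = (hessian G b x *v gradient G a x) $ k"
    by (simp add: matrix_vector_mult_def mult.commute)
  finally show ?thesis by simp
qed

text \<open>The right-hand side involves the metric only through \<open>grad_prod\<close>, whose invariance under changes of
  charts is the chain rule. This yields the tensoriality of the Hessian without the transformation
  law of the Christoffel symbols.\<close>

lemma hessian_via_grad_prod:
  assumes x: "x \<in> S" and f: "smooth_on S f" and a: "smooth_on S a" and b: "smooth_on S b"
  shows "gradient G a x \<bullet> (hessian G f x *v gradient G b x) = (1/2) *
    (grad_prod G a (grad_prod G f b) x + grad_prod G b (grad_prod G f a) x - grad_prod G f (grad_prod G a b) x)"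
proof -
  have gp: "grad_prod G a (grad_prod G b c) x = gradient G a x \<bullet> (hessian G b x *v gradient G c x)
      + gradient G a x \<bullet> (hessian G c x *v gradient G b x)" if "smooth_on S b" "smooth_on S c" for a b c
    by (simp add: grad_prod_eq[OF x] partial_deriv_grad_prod[OF x that] inner_vec_def sum.distrib algebra_simps)
  have sym: "v \<bullet> (hessian G h x *v w) = w \<bullet> (hessian G h x *v v)" if "smooth_on S h" for h v w
    by (metis dot_lmul_matrix inner_commute transpose_hessian[OF x that] transpose_matrix_vector)
  show ?thesis
    unfolding gp[OF f b] gp[OF f a] gp[OF a b]
    using sym[OF a, of "gradient G f x" "gradient G b x"] sym[OF b, of "gradient G f x" "gradient G a x"]
      sym[OF f, of "gradient G a x" "gradient G b x"] by simp
qed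

lemma laplacian_sum: "laplacian G h x = (\<Sum>i\<in>UNIV. \<Sum>j\<in>UNIV. Ginv x $ i $ j * hessian G h x $ j $ i)"
  by (simp add: laplacian_def hessian_endo_def trace_def matrix_matrix_mult_def)

text \<open>The Bochner formula before derivatives are commuted: the third derivatives stay in the
  form of the divergence of the Hessian. For solitons this divergence is known directly, so no Ricci
  term has to be inserted here.\<close>

lemma laplacian_grad_prod_self:
  assumes x: "x \<in> S" and f: "smooth_on S f"
  shows "laplacian G (grad_prod G f f) x
    = 2 * (\<Sum>j\<in>UNIV. gradient G f x $ j * divg (raised_hess f) j x) + 2 * trace (raised_hess f x ** raised_hess f x)"
proof -
  let ?s = "grad_prod G f f" and ?V = "gradient G f"
  define C where "C i k m = conn i x $ k $ m" for i k m
  define H where "H i m = raised_hess f x $ i $ m" for i m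
  define v where "v i = ?V x $ i" for i
  have s: "smooth_on S ?s" using smooth_grad_prod[OF f f] .
  have V: "gradient G ?s y $ m = 2 * (\<Sum>j\<in>UNIV. raised_hess f y $ j $ m * ?V y $ j)" if y: "y \<in> S" for y m
  proof -
    have "(\<chi> i. partial_deriv i ?s y) = 2 *\<^sub>R (hessian G f y *v ?V y)"
      by (simp add: vec_eq_iff partial_deriv_grad_prod[OF y f f])
    then have "gradient G ?s y = 2 *\<^sub>R (Ginv y *v (hessian G f y *v ?V y))"
      by (simp add: gradient_def matrix_vector_mult_scaleR)
    also have "Ginv y *v (hessian G f y *v ?V y) = transpose (raised_hess f y) *v ?V y"
      using hessian_endo_eq[OF y f] by (simp add: matrix_vector_mul_assoc hessian_endo_def del: transpose_matrix_vector)
    finally show ?thesis by (simp add: matrix_vector_mult_def transpose_def del: transpose_matrix_vector)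
  qed
  have CT: "C k j m = C m j k" for k j m unfolding C_def by (rule conn_torsion_free[OF x])
  have dH: "(\<lambda>y. raised_hess f y $ j $ m) differentiable at x" "(\<lambda>y. ?V y $ j) differentiable at x" for j m
    using differentiable_S[OF _ x] smooth_matrix_onD[OF smooth_raised_hess[OF f]] smooth_vector_onD[OF smooth_gradient[OF f]]
    by auto
  have dV: "partial_deriv i (\<lambda>y. ?V y $ j) x = H i j - (\<Sum>m\<in>UNIV. C i j m * v m)" for i j
    using cov_grad_eq[OF x f, of i j] by (simp add: cov_grad_def vderiv_def matrix_vector_mult_def H_def C_def v_def)
  have "laplacian G ?s x = (\<Sum>i\<in>UNIV. raised_hess ?s x $ i $ i)"
    by (simp add: laplacian_eq[OF x s] trace_def)
  also have "\<dots> = (\<Sum>i\<in>UNIV. partial_deriv i (\<lambda>y. gradient G ?s y $ i) x + (\<Sum>m\<in>UNIV. C i i m * gradient G ?s x $ m))"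
    by (simp add: cov_grad_def vderiv_def matrix_vector_mult_def C_def flip: cov_grad_eq[OF x s])
  also have "\<dots> = (\<Sum>i\<in>UNIV. 2 * (\<Sum>j\<in>UNIV. partial_deriv i (\<lambda>y. raised_hess f y $ j $ i) x * v j
      + H j i * (H i j - (\<Sum>m\<in>UNIV. C i j m * v m))) + (\<Sum>m\<in>UNIV. C i i m * (2 * (\<Sum>j\<in>UNIV. H j m * v j))))"
  proof (intro sum.cong refl arg_cong2[where f = "(+)"])
    fix i
    have "partial_deriv i (\<lambda>y. gradient G ?s y $ i) x
        = partial_deriv i (\<lambda>y. 2 * (\<Sum>j\<in>UNIV. raised_hess f y $ j $ i * ?V y $ j)) x"
      by (rule partial_deriv_cong_open[OF open_S x V])
    also have "\<dots> = 2 * (\<Sum>j\<in>UNIV. partial_deriv i (\<lambda>y. raised_hess f y $ j $ i) x * v j + H j i * partial_deriv i (\<lambda>y. ?V y $ j) x)"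
      using dH by (simp add: partial_deriv_cmult partial_deriv_sum partial_deriv_mult differentiable_sum H_def v_def)
    finally show "partial_deriv i (\<lambda>y. gradient G ?s y $ i) x = 2 * (\<Sum>j\<in>UNIV.
        partial_deriv i (\<lambda>y. raised_hess f y $ j $ i) x * v j + H j i * (H i j - (\<Sum>m\<in>UNIV. C i j m * v m)))"
      unfolding dV .
  qed (simp add: V[OF x] H_def v_def)
  also have "\<dots> = 2 * (\<Sum>i\<in>UNIV. \<Sum>j\<in>UNIV. partial_deriv i (\<lambda>y. raised_hess f y $ j $ i) x * v j)
      + 2 * (\<Sum>i\<in>UNIV. \<Sum>j\<in>UNIV. H j i * H i j)
      - 2 * (\<Sum>i\<in>UNIV. \<Sum>j\<in>UNIV. \<Sum>m\<in>UNIV. H j i * (C i j m * v m))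
      + 2 * (\<Sum>i\<in>UNIV. \<Sum>m\<in>UNIV. \<Sum>j\<in>UNIV. C i i m * (H j m * v j))"
    by (simp add: sum.distrib sum_subtractf sum_distrib_left right_diff_distrib algebra_simps)
  also have "(\<Sum>i\<in>UNIV. \<Sum>j\<in>UNIV. partial_deriv i (\<lambda>y. raised_hess f y $ j $ i) x * v j)
      = (\<Sum>j\<in>UNIV. v j * (\<Sum>i\<in>UNIV. partial_deriv i (\<lambda>y. raised_hess f y $ j $ i) x))"
    by (subst sum.swap) (simp add: sum_distrib_left mult.commute)
  also have "(\<Sum>i\<in>UNIV. \<Sum>j\<in>UNIV. H j i * H i j) = trace (raised_hess f x ** raised_hess f x)"
    by (simp add: trace_def matrix_matrix_mult_def H_def mult.commute)
  \<comment> \<open>Torsion-freeness moves the index of \<nabla>f into the direction slot of the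
    connection, where the third sum of \<open>divg\<close> has it.\<close>
  also have "(\<Sum>i\<in>UNIV. \<Sum>j\<in>UNIV. \<Sum>m\<in>UNIV. H j i * (C i j m * v m))
      = (\<Sum>m\<in>UNIV. v m * (\<Sum>j\<in>UNIV. \<Sum>i\<in>UNIV. C m j i * H j i))"
  proof -
    have "(\<Sum>i\<in>UNIV. \<Sum>j\<in>UNIV. \<Sum>m\<in>UNIV. H j i * (C i j m * v m))
        = (\<Sum>j\<in>UNIV. \<Sum>i\<in>UNIV. \<Sum>m\<in>UNIV. H j i * (C i j m * v m))" by (rule sum.swap)
    also have "\<dots> = (\<Sum>j\<in>UNIV. \<Sum>m\<in>UNIV. \<Sum>i\<in>UNIV. H j i * (C i j m * v m))"
      by (intro sum.cong refl sum.swap)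
    also have "\<dots> = (\<Sum>m\<in>UNIV. \<Sum>j\<in>UNIV. \<Sum>i\<in>UNIV. H j i * (C i j m * v m))" by (rule sum.swap)
    also have "\<dots> = (\<Sum>m\<in>UNIV. v m * (\<Sum>j\<in>UNIV. \<Sum>i\<in>UNIV. C m j i * H j i))"
      unfolding sum_distrib_left by (intro sum.cong refl) (subst CT, simp)
    finally show ?thesis .
  qed
  also have "(\<Sum>i\<in>UNIV. \<Sum>m\<in>UNIV. \<Sum>j\<in>UNIV. C i i m * (H j m * v j))
      = (\<Sum>j\<in>UNIV. v j * (\<Sum>i\<in>UNIV. \<Sum>m\<in>UNIV. C i i m * H j m))"
  proof -
    have "(\<Sum>i\<in>UNIV. \<Sum>m\<in>UNIV. \<Sum>j\<in>UNIV. C i i m * (H j m * v j))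
      = (\<Sum>i\<in>UNIV. \<Sum>j\<in>UNIV. \<Sum>m\<in>UNIV. C i i m * (H j m * v j))" by (intro sum.cong refl sum.swap)
    also have "\<dots> = (\<Sum>j\<in>UNIV. \<Sum>i\<in>UNIV. \<Sum>m\<in>UNIV. C i i m * (H j m * v j))" by (rule sum.swap)
    finally show ?thesis by (simp add: sum_distrib_left mult_ac)
  qed
  finally have "laplacian G ?s x = 2 * (\<Sum>j\<in>UNIV. v j * ((\<Sum>i\<in>UNIV. partial_deriv i (\<lambda>y. raised_hess f y $ j $ i) x)
      + (\<Sum>i\<in>UNIV. \<Sum>m\<in>UNIV. C i i m * H j m) - (\<Sum>k\<in>UNIV. \<Sum>i\<in>UNIV. C j k i * H k i)))
      + 2 * trace (raised_hess f x ** raised_hess f x)"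
    by (simp add: algebra_simps sum.distrib sum_subtractf)
  then show ?thesis by (simp add: divg_def C_def H_def v_def)
qed

end

section \<open>The second invariant of an endomorphism\<close>

lemma scaleR_matrix_mult:
  fixes M :: "real^'n^'m" and N :: "real^'k^'n"
  shows "(c *\<^sub>R M) ** N = c *\<^sub>R (M ** N)" "M ** (c *\<^sub>R N) = c *\<^sub>R (M ** N)"
  by (simp_all add: vec_eq_iff matrix_matrix_mult_def sum_distrib_left mult_ac)

lemma coeff_prod_linear:
  assumes "finite I"
  shows "coeff (\<Prod>i\<in>I. [:1, h i:]) 0 = (1::real)" "coeff (\<Prod>i\<in>I. [:1, h i:]) 1 = sum h I"
proof -
  have "coeff (\<Prod>i\<in>I. [:1, h i:]) 0 = 1 \<and> coeff (\<Prod>i\<in>I. [:1, h i:]) 1 = sum h I"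
    using assms by (induction I) (auto simp: coeff_pCons)
  then show "coeff (\<Prod>i\<in>I. [:1, h i:]) 0 = (1::real)" "coeff (\<Prod>i\<in>I. [:1, h i:]) 1 = sum h I" by auto
qed

definition det_poly :: "real^'n^'n::finite \<Rightarrow> real poly" where
  "det_poly H = det (\<chi> i j. [:mat 1 $ i $ j, H $ i $ j:])"

lemma poly_det_poly: "poly (det_poly H) \<alpha> = det (mat 1 + \<alpha> *\<^sub>R H)"
  unfolding det_poly_def det_def by (simp add: poly_sum poly_prod)

text \<open>A permutation other than the identity moves at least two points, a and p a. The two
  off-diagonal factors are divisible by \<alpha>, so it contributes only from degree 2 on; the
  degrees 0 and 1 come from the diagonal product.\<close>

lemma coeff_det_poly_low:
  fixes H :: "real^'n^'n::finite"
  shows "coeff (det_poly H) 0 = 1" "coeff (det_poly H) 1 = trace H"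
proof -
  define T where "T p = of_int (sign p) * (\<Prod>i\<in>UNIV. [:mat 1 $ i $ p i, H $ i $ p i:])" for p :: "'n \<Rightarrow> 'n"
  have off: "coeff (T p) m = 0" if p: "p permutes UNIV" "p \<noteq> id" and m: "m < 2" for p m
  proof -
    obtain a where a: "p a \<noteq> a" using p(2) by (auto simp: fun_eq_iff)
    have b: "p (p a) \<noteq> p a" using p(1) a by (metis permutes_inj injD)
    have mv: "[:mat 1 $ i $ p i, H $ i $ p i:] = [:0, 1:] * [:H $ i $ p i:]" if "p i \<noteq> i" for i
      using that by (simp add: mat_def)
    have "(\<Prod>i\<in>UNIV. [:mat 1 $ i $ p i, H $ i $ p i:])
        = (\<Prod>i\<in>{a, p a}. [:mat 1 $ i $ p i, H $ i $ p i:]) * (\<Prod>i\<in>UNIV - {a, p a}. [:mat 1 $ i $ p i, H $ i $ p i:])"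
      by (subst prod.subset_diff[of "{a, p a}"]) (auto simp: mult.commute)
    also have "(\<Prod>i\<in>{a, p a}. [:mat 1 $ i $ p i, H $ i $ p i:])
        = [:0, 1:] ^ 2 * ([:H $ a $ p a:] * [:H $ p a $ p (p a):])"
      using a b by (simp add: mv power2_eq_square mult_ac)
    finally have "T p = monom 1 2 * (of_int (sign p) * (([:H $ a $ p a:] * [:H $ p a $ p (p a):])
        * (\<Prod>i\<in>UNIV - {a, p a}. [:mat 1 $ i $ p i, H $ i $ p i:])))"
      unfolding T_def monom_altdef by (simp add: mult_ac)
    then show ?thesis using m by (simp only: coeff_monom_mult) simp
  qed
  have "det_poly H = (\<Sum>p | p permutes UNIV. T p)"
    by (simp add: det_poly_def det_def T_def)
  then have "coeff (det_poly H) m = coeff (T id) m" if "m < 2" for m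
    using off that by (subst \<open>det_poly H = _\<close>) (simp add: coeff_sum permutes_id sum.remove[of "{p. p permutes UNIV}" id])
  moreover have "T id = (\<Prod>i\<in>UNIV. [:1, H $ i $ i:])"
    by (simp add: T_def mat_def sign_id)
  ultimately show "coeff (det_poly H) 0 = 1" "coeff (det_poly H) 1 = trace H"
    using coeff_prod_linear[of "UNIV :: 'n set" "\<lambda>i. H $ i $ i"] by (simp_all add: trace_def)
qed

text \<open>Compare coefficients of \<open>\<alpha>\<^sup>2\<close> in
  \<open>det (I + \<alpha> H) det (I - \<alpha> H) = det (I - \<alpha>\<^sup>2 H\<^sup>2)\<close>.\<close>

lemma endo_invariant_2:
  fixes H :: "real^'n^'n::finite"
  shows "2 * endo_invariant 2 H = (trace H)\<^sup>2 - trace (H ** H)"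
proof -
  have neg: "det_poly (- H) = pcompose (det_poly H) [:0, -1:]"
  proof (rule poly_eq_poly_eq_iff[THEN iffD1], rule ext)
    show "poly (det_poly (- H)) \<alpha> = poly (pcompose (det_poly H) [:0, -1:]) \<alpha>" for \<alpha>
      by (simp add: poly_det_poly poly_pcompose)
  qed
  have "det_poly H * det_poly (- H) = pcompose (det_poly (- (H ** H))) [:0, 0, 1:]"
  proof (rule poly_eq_poly_eq_iff[THEN iffD1], rule ext)
    fix \<alpha> :: real
    have "(mat 1 + \<alpha> *\<^sub>R H) ** (mat 1 + \<alpha> *\<^sub>R (- H)) = mat 1 + (\<alpha> * \<alpha>) *\<^sub>R (- (H ** H))"
      by (simp add: matrix_ring_simps scaleR_matrix_mult scaleR_add_right)
    then show "poly (det_poly H * det_poly (- H)) \<alpha> = poly (pcompose (det_poly (- (H ** H))) [:0, 0, 1:]) \<alpha>"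
      by (simp add: poly_det_poly poly_pcompose flip: det_mul)
  qed
  then have "coeff (det_poly H * det_poly (- H)) 2 = coeff (pcompose (det_poly (- (H ** H))) [:0, 0, 1:]) 2"
    by simp
  moreover have "coeff (pcompose p [:0, 0, 1:]) 2 = coeff p 1" for p :: "real poly"
    by (cases p, rename_tac a q, case_tac q) (simp add: pcompose_pCons coeff_pCons numeral_2_eq_2)
  moreover have "coeff (pcompose p [:0, -1:]) 2 = coeff p 2" for p :: "real poly"
    by (cases p, rename_tac a q, case_tac q, rename_tac b r, case_tac r)
      (simp add: pcompose_pCons coeff_pCons numeral_2_eq_2)
  \<comment> \<open>Replacing H by - H keeps the even coefficients and changes the sign of the
    linear one, so the degree 2 coefficient of the product is 2 c_2 - (tr H)^2.\<close>
  ultimately have "coeff (det_poly H) 2 + trace H * - trace H + coeff (det_poly H) 2 = - trace (H ** H)"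
    using coeff_det_poly_low[of H] coeff_det_poly_low[of "- H"] coeff_det_poly_low[of "- (H ** H)"] neg
    by (simp add: coeff_mult numeral_2_eq_2 trace_def sum_negf)
  then show ?thesis by (simp add: endo_invariant_def power2_eq_square flip: det_poly_def)
qed

section \<open>Second order conditions at a maximum\<close>

text \<open>Moving the argument of the quadratic form along the k-th unit vector by a free parameter
  s makes it a quadratic polynomial in s, whose nonnegativity is exploited in the elimination of k
  below.\<close>

lemma sum_sum_delta:
  fixes p :: "'n::finite \<Rightarrow> 'n \<Rightarrow> real"
  shows "(\<Sum>i\<in>UNIV. \<Sum>j\<in>UNIV. (v i + s * of_bool (i = k)) * (v j + s * of_bool (j = k)) * p i j)
    = (\<Sum>i\<in>UNIV. \<Sum>j\<in>UNIV. v i * v j * p i j) + s * (\<Sum>j\<in>UNIV. v j * p k j) + s * (\<Sum>i\<in>UNIV. v i * p i k) + s * s * p k k"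
proof -
  have "(\<Sum>i\<in>UNIV. \<Sum>j\<in>UNIV. (v i + s * of_bool (i = k)) * (v j + s * of_bool (j = k)) * p i j)
    = (\<Sum>i\<in>UNIV. \<Sum>j\<in>UNIV. v i * v j * p i j + (if i = k then s * (v j * p i j) else 0)
        + (if j = k then s * (v i * p i j) else 0) + (if j = k then if i = k then s * s * p i j else 0 else 0))"
    by (intro sum.cong refl) (auto simp: ring_distribs)
  also have "\<dots> = (\<Sum>i\<in>UNIV. \<Sum>j\<in>UNIV. v i * v j * p i j) + s * (\<Sum>j\<in>UNIV. v j * p k j)
      + s * (\<Sum>i\<in>UNIV. v i * p i k) + s * s * p k k"
  proof -
    have "(\<Sum>i\<in>UNIV. \<Sum>j\<in>UNIV. if i = k then s * (v j * p i j) else 0) = s * (\<Sum>j\<in>UNIV. v j * p k j)"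
      by (subst sum.swap) (simp add: sum_distrib_left)
    then show ?thesis by (simp add: sum.distrib sum_distrib_left)
  qed
  finally show ?thesis .
qed

text \<open>Schur complements: the index \<open>k\<close> is eliminated by splitting off the rank one form
  \<open>p\<^sub>i\<^sub>k p\<^sub>j\<^sub>k / p\<^sub>k\<^sub>k\<close>.\<close>

lemma psd_inner_nonneg_support:
  fixes p a :: "'n::finite \<Rightarrow> 'n \<Rightarrow> real"
  assumes "finite I" "\<And>i j. i \<notin> I \<Longrightarrow> p i j = 0" "\<And>i j. p i j = p j i"
    and "\<And>v. 0 \<le> (\<Sum>i\<in>UNIV. \<Sum>j\<in>UNIV. v i * v j * p i j)"
    and a: "\<And>v. 0 \<le> (\<Sum>i\<in>UNIV. \<Sum>j\<in>UNIV. v i * v j * a i j)"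
  shows "0 \<le> (\<Sum>i\<in>UNIV. \<Sum>j\<in>UNIV. p i j * a i j)"
  using assms(1-4)
proof (induction I arbitrary: p)
  case empty
  then show ?case by simp
next
  case (insert k I)
  note sym = insert.prems(2) and psd = insert.prems(3)
  have Q: "0 \<le> (\<Sum>i\<in>UNIV. \<Sum>j\<in>UNIV. v i * v j * p i j) + 2 * s * (\<Sum>j\<in>UNIV. v j * p k j) + s * s * p k k" for v s
  proof -
    have "(\<Sum>i\<in>UNIV. v i * p i k) = (\<Sum>j\<in>UNIV. v j * p k j)"
      by (intro sum.cong refl arg_cong2[where f = "(*)"] sym)
    then show ?thesis
      using psd[of "\<lambda>i. v i + s * of_bool (i = k)"] unfolding sum_sum_delta by simp
  qed
  have kk: "0 \<le> p k k" using Q[of "\<lambda>i. 0" 1] by simp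
  show ?case
  proof (cases "p k k = 0")
    case True
    \<comment> \<open>A zero diagonal entry forces a zero row: at e_j + s e_k the form equals p_jj +
      2 s p_kj, which is affine in s and would be unbounded below. The value of s inserted below
      makes it - 1. With the row gone, k leaves the support.\<close>
    have row: "p k j = 0" for j
    proof (rule ccontr)
      assume ne: "p k j \<noteq> 0"
      have "0 \<le> p j j + 2 * s * p k j" for s
      proof -
        have "(\<Sum>i\<in>UNIV. \<Sum>l\<in>UNIV. of_bool (i = j) * of_bool (l = j) * p i l) = (\<Sum>i\<in>UNIV. if i = j then (\<Sum>l\<in>UNIV. if l = j then p i l else 0) else 0)"
          by (intro sum.cong refl) auto
        moreover have "(\<Sum>l\<in>UNIV. of_bool (l = j) * p k l) = (\<Sum>l\<in>UNIV. if l = j then p k l else 0)"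
          by (intro sum.cong refl) auto
        ultimately show ?thesis using Q[of "\<lambda>i. of_bool (i = j)" s] True by simp
      qed
      from this[of "- (p j j + 1) / (2 * p k j)"] ne show False by (simp add: field_simps)
    qed
    have "p i j = 0" if "i \<notin> I" for i j
      using insert.prems(1)[of i j] row that by (cases "i = k") auto
    from insert.IH[OF this sym psd] show ?thesis .
  next
    case False
    with kk have pos: "p k k > 0" by simp
    define r where "r i j = p i j - p i k * p j k / p k k" for i j
    have "0 \<le> (\<Sum>i\<in>UNIV. \<Sum>j\<in>UNIV. r i j * a i j)"
    proof (rule insert.IH)
      show "r i j = 0" if "i \<notin> I" for i j
      proof (cases "i = k")
        case True
        then show ?thesis using pos sym[of k j] by (simp add: r_def)
      next
        case False
        then show ?thesis using insert.prems(1)[of i] that by (simp add: r_def)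
      qed
      show "r i j = r j i" for i j using sym[of i j] by (simp add: r_def mult.commute)
      fix v :: "'n \<Rightarrow> real"
      define w where "w = (\<Sum>j\<in>UNIV. v j * p k j)"
      have "(\<Sum>i\<in>UNIV. \<Sum>j\<in>UNIV. v i * v j * r i j)
          = (\<Sum>i\<in>UNIV. \<Sum>j\<in>UNIV. v i * v j * p i j) - (\<Sum>i\<in>UNIV. \<Sum>j\<in>UNIV. (v i * p k i) * (v j * p k j)) / p k k"
      proof -
        have "v i * v j * r i j = v i * v j * p i j - (v i * p k i) * (v j * p k j) / p k k" for i j
          unfolding r_def sym[of i k] sym[of j k] by (simp add: right_diff_distrib mult_ac)
        then show ?thesis by (simp add: sum_subtractf sum_divide_distrib)
      qed
      also have "(\<Sum>i\<in>UNIV. \<Sum>j\<in>UNIV. (v i * p k i) * (v j * p k j)) = w * w"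
        by (simp add: w_def sum_product)
      \<comment> \<open>The parameter - w / p_kk minimises the quadratic polynomial in s; its
        minimum is the Schur complement evaluated at v.\<close>
      also have "(\<Sum>i\<in>UNIV. \<Sum>j\<in>UNIV. v i * v j * p i j) - w * w / p k k \<ge> 0"
        using Q[of v "- w / p k k"] pos by (simp flip: w_def)
      finally show "0 \<le> (\<Sum>i\<in>UNIV. \<Sum>j\<in>UNIV. v i * v j * r i j)" .
    qed
    moreover have "(\<Sum>i\<in>UNIV. \<Sum>j\<in>UNIV. p i j * a i j)
        = (\<Sum>i\<in>UNIV. \<Sum>j\<in>UNIV. r i j * a i j) + (\<Sum>i\<in>UNIV. \<Sum>j\<in>UNIV. p i k * p j k * a i j) / p k k"
      by (simp add: r_def left_diff_distrib sum_subtractf sum_divide_distrib)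
    \<comment> \<open>The rank one part pairs with \<open>a\<close> to the value of the form
      \<open>a\<close> at the k-th column of \<open>p\<close>, divided by p_kk.\<close>
    ultimately show ?thesis using a[of "\<lambda>i. p i k"] pos by simp
  qed
qed

text \<open>This takes the place of simultaneous diagonalisation. P will be the inverse metric, and
  A either the negative Hessian at a maximum or H Ginv H.\<close>

lemma psd_inner_nonneg:
  fixes P A :: "real^'n^'n::finite"
  assumes "transpose P = P" "\<And>v. 0 \<le> v \<bullet> (P *v v)" "\<And>v. 0 \<le> v \<bullet> (A *v v)"
  shows "0 \<le> (\<Sum>i\<in>UNIV. \<Sum>j\<in>UNIV. P $ i $ j * A $ i $ j)"
proof (rule psd_inner_nonneg_support[of UNIV])
  have Q: "(\<Sum>i\<in>UNIV. \<Sum>j\<in>UNIV. v i * v j * M $ i $ j) = (\<chi> i. v i) \<bullet> (M *v (\<chi> i. v i))"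
    for v and M :: "real^'n^'n"
    by (simp add: inner_vec_def matrix_vector_mult_def sum_distrib_left mult_ac)
  show "0 \<le> (\<Sum>i\<in>UNIV. \<Sum>j\<in>UNIV. v i * v j * P $ i $ j)"
    "0 \<le> (\<Sum>i\<in>UNIV. \<Sum>j\<in>UNIV. v i * v j * A $ i $ j)" for v
    unfolding Q using assms by auto
  show "P $ i $ j = P $ j $ i" for i j
    using arg_cong[OF assms(1), of "\<lambda>M. M $ j $ i"] by (simp add: transpose_def)
qed auto

text \<open>Restrict to lines through x. If the second derivative along v were positive, the first
  derivative, zero at x, would be positive just beyond it, and the mean value theorem would give a
  larger value of \<open>h\<close> there.\<close>

lemma local_max_derivs:
  fixes h :: "real^'n::finite \<Rightarrow> real"
  assumes S: "open S" "x \<in> S" and h: "smooth_on S h" and max: "\<And>y. y \<in> S \<Longrightarrow> h y \<le> h x"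
  shows "partial_deriv i h x = 0"
    and "(\<Sum>i\<in>UNIV. \<Sum>j\<in>UNIV. v $ i * v $ j * partial_deriv j (partial_deriv i h) x) \<le> 0"
proof -
  define D where "D v t = (\<Sum>i\<in>UNIV. v $ i * partial_deriv i h (x + t *\<^sub>R v))" for v t
  obtain e where e: "e > 0" "ball x e \<subseteq> S" using S open_contains_ball by blast
  have near: "\<exists>d>0. \<forall>t. \<bar>t\<bar> < d \<longrightarrow> x + t *\<^sub>R v \<in> S" for v
  proof (intro exI[of _ "e / (norm v + 1)"] conjI allI impI)
    have n: "norm v + 1 > 0" using norm_ge_zero[of v] by linarith
    then show "0 < e / (norm v + 1)" using e by simp
    fix t assume "\<bar>t\<bar> < e / (norm v + 1)"
    then have "\<bar>t\<bar> * (norm v + 1) < e" using n by (simp add: pos_less_divide_eq)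
    moreover have "\<bar>t\<bar> * norm v \<le> \<bar>t\<bar> * (norm v + 1)" by (simp add: mult_left_mono)
    ultimately show "x + t *\<^sub>R v \<in> S" using e(2) by (auto simp: dist_norm)
  qed
  have d1: "((\<lambda>t. h (x + t *\<^sub>R v)) has_real_derivative D v t) (at t)" if "x + t *\<^sub>R v \<in> S" for v t
    unfolding D_def by (rule DERIV_along_line[OF smooth_on_imp_differentiable[OF h S(1) that]])
  have zero: "D v 0 = 0" for v
  proof -
    obtain d where d: "d > 0" "\<And>t. \<bar>t\<bar> < d \<Longrightarrow> x + t *\<^sub>R v \<in> S" using near by blast
    have "((\<lambda>t. h (x + t *\<^sub>R v)) has_real_derivative D v 0) (at 0)" using d1[of 0 v] S by simp
    from DERIV_local_max[OF this d(1)] max d(2) show ?thesis by simp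
  qed
  show "partial_deriv i h x = 0"
    using zero[of "axis i 1"] by (simp add: D_def axis_def if_distrib[of "\<lambda>c. c * _"] cong: if_cong)
  show "(\<Sum>i\<in>UNIV. \<Sum>j\<in>UNIV. v $ i * v $ j * partial_deriv j (partial_deriv i h) x) \<le> 0" (is "?Q \<le> 0")
  proof (rule ccontr)
    assume "\<not> ?Q \<le> 0"
    have "((\<lambda>t. \<Sum>i\<in>UNIV. v $ i * partial_deriv i h (x + t *\<^sub>R v)) has_real_derivative
        (\<Sum>i\<in>UNIV. v $ i * (\<Sum>j\<in>UNIV. v $ j * partial_deriv j (partial_deriv i h) (x + 0 *\<^sub>R v)))) (at 0)"
      by (intro DERIV_sum DERIV_cmult DERIV_along_line smooth_on_imp_differentiable[OF smooth_on_partial_deriv[OF h] S(1)])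
        (use S in simp)
    then have "(D v has_real_derivative ?Q) (at 0)"
      unfolding D_def by (simp add: sum_distrib_left mult.assoc)
    from DERIV_pos_inc_right[OF this] \<open>\<not> ?Q \<le> 0\<close> obtain d0 where
      d0: "d0 > 0" "\<And>t. 0 < t \<Longrightarrow> t < d0 \<Longrightarrow> 0 < D v t" using zero by auto
    obtain d where d: "d > 0" "\<And>t. \<bar>t\<bar> < d \<Longrightarrow> x + t *\<^sub>R v \<in> S" using near by blast
    define t where "t = min d d0 / 2"
    have t: "0 < t" "t < d" "t < d0" using d(1) d0(1) by (auto simp: t_def)
    have "\<exists>s>0. s < t \<and> h (x + t *\<^sub>R v) - h (x + 0 *\<^sub>R v) = (t - 0) * D v s"
      by (rule MVT2) (use t d in \<open>auto intro!: d1\<close>)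
    then obtain s where s: "0 < s" "s < t" "h (x + t *\<^sub>R v) - h x = t * D v s" by auto
    have "t * D v s > 0" using d0(2)[of s] s t by simp
    moreover have "h (x + t *\<^sub>R v) \<le> h x" using max d(2)[of t] t by simp
    ultimately show False using s(3) by simp
  qed
qed

context riemannian_coords
begin

text \<open>At a maximum the first derivatives vanish, so the Christoffel terms disappear from the
  Hessian and its negative is positive semidefinite; pairing with the inverse metric gives the
  sign.\<close>

lemma laplacian_nonpos_at_max:
  assumes x: "x \<in> S" and h: "smooth_on S h" and max: "\<And>y. y \<in> S \<Longrightarrow> h y \<le> h x"
  shows "laplacian G h x \<le> 0"
proof -
  note m = local_max_derivs[OF open_S x h max]
  have "0 \<le> (\<Sum>i\<in>UNIV. \<Sum>j\<in>UNIV. Ginv x $ i $ j * (- hessian G h x) $ i $ j)"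
  proof (rule psd_inner_nonneg[OF sym_Ginv[OF x] psd_Ginv[OF x]])
    fix v :: "real^'n"
    have "v \<bullet> (hessian G h x *v v) = (\<Sum>i\<in>UNIV. \<Sum>j\<in>UNIV. v $ i * v $ j * partial_deriv i (partial_deriv j h) x)"
      by (simp add: inner_vec_def matrix_vector_mult_def sum_distrib_left mult_ac hessian_def m(1))
    also have "\<dots> \<le> 0" using m(2)[of v] partial_deriv_commute[OF open_S x h] by simp
    finally have "v \<bullet> (hessian G h x *v v) \<le> 0" .
    moreover have "(- hessian G h x) *v v = - (hessian G h x *v v)"
      by (simp add: vec_eq_iff matrix_vector_mult_def sum_negf)
    ultimately show "0 \<le> v \<bullet> (- hessian G h x *v v)" by (simp add: inner_minus_right)
  qed
  also have "\<dots> = - laplacian G h x"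
    unfolding laplacian_sum sum_negf[symmetric]
    by (intro sum.cong refl) (subst hessian_sym[OF x h], simp)
  finally show ?thesis by simp
qed

text \<open>The Hessian endomorphism is self-adjoint for the metric, but its matrix need not be
  symmetric. Its squared trace is the pairing of the inverse metric with H Ginv H, which is positive
  semidefinite.\<close>

lemma trace_hessian_endo_sq_nonneg:
  assumes x: "x \<in> S" and h: "smooth_on S h"
  shows "0 \<le> trace (hessian_endo G h x ** hessian_endo G h x)"
proof -
  let ?H = "hessian G h x"
  have sym: "transpose ?H = ?H" by (rule transpose_hessian[OF x h])
  have "0 \<le> (\<Sum>i\<in>UNIV. \<Sum>j\<in>UNIV. Ginv x $ i $ j * (?H ** Ginv x ** ?H) $ i $ j)"
  proof (rule psd_inner_nonneg[OF sym_Ginv[OF x] psd_Ginv[OF x]])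
    fix v
    have "v \<bullet> (?H ** Ginv x ** ?H *v v) = (?H *v v) \<bullet> (Ginv x *v (?H *v v))"
      using sym by (metis dot_lmul_matrix matrix_vector_mul_assoc transpose_matrix_vector)
    then show "0 \<le> v \<bullet> (?H ** Ginv x ** ?H *v v)" using psd_Ginv[OF x] by simp
  qed
  also have "\<dots> = trace (Ginv x ** transpose (?H ** Ginv x ** ?H))"
    by (simp add: trace_def matrix_matrix_mult_def[of "Ginv x"] transpose_def)
  also have "transpose (?H ** Ginv x ** ?H) = ?H ** Ginv x ** ?H"
    by (simp add: matrix_transpose_mul sym sym_Ginv[OF x] matrix_mul_assoc)
  finally show ?thesis by (simp add: hessian_endo_def matrix_mul_assoc)
qed

section \<open>Calculus rules for the Laplacian and the pairing of gradients\<close>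

lemma grad_prod_nonneg: "x \<in> S \<Longrightarrow> 0 \<le> grad_prod G a a x"
  using psd_Ginv[of x "\<chi> i. partial_deriv i a x"]
  by (simp add: grad_prod_def inner_vec_def matrix_vector_mult_def sum_distrib_left mult_ac)

lemma grad_prod_cong:
  assumes "x \<in> S" "\<And>y. y \<in> S \<Longrightarrow> a y = a' y" "\<And>y. y \<in> S \<Longrightarrow> b y = b' y"
  shows "grad_prod G a b x = grad_prod G a' b' x"
  unfolding grad_prod_def
  by (intro sum.cong refl arg_cong2[where f = "(*)"] partial_deriv_cong_open[OF open_S assms(1)] assms)

text \<open>Agreement of first derivatives suffices, which allows a replacement of the Laplacian of
  f by an expression known only up to an additive constant.\<close>

lemma hessian_cong_partial:
  assumes x: "x \<in> S" and e: "\<And>j y. y \<in> S \<Longrightarrow> partial_deriv j a y = partial_deriv j b y"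
  shows "hessian G a x = hessian G b x"
proof -
  have "partial_deriv i (partial_deriv j a) x = partial_deriv i (partial_deriv j b) x" for i j
    by (rule partial_deriv_cong_open[OF open_S x e])
  then show ?thesis by (simp add: hessian_def e[OF x])
qed

lemma hessian_cong:
  assumes "x \<in> S" "\<And>y. y \<in> S \<Longrightarrow> a y = b y"
  shows "hessian G a x = hessian G b x"
  using assms by (intro hessian_cong_partial partial_deriv_cong_open[OF open_S])

lemma laplacian_cong:
  assumes "x \<in> S" "\<And>y. y \<in> S \<Longrightarrow> a y = b y"
  shows "laplacian G a x = laplacian G b x"
  using hessian_cong[OF assms] by (simp add: laplacian_sum)

lemma hessian_add:
  assumes x: "x \<in> S" and a: "smooth_on S a" and b: "smooth_on S b"
  shows "hessian G (\<lambda>y. a y + b y) x = hessian G a x + hessian G b x"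
proof -
  have 1: "partial_deriv j (\<lambda>y. a y + b y) y = partial_deriv j a y + partial_deriv j b y" if "y \<in> S" for j y
    by (rule partial_deriv_add) (auto intro: differentiable_S a b that)
  have "partial_deriv i (partial_deriv j (\<lambda>y. a y + b y)) x
      = partial_deriv i (partial_deriv j a) x + partial_deriv i (partial_deriv j b) x" for i j
  proof -
    have "partial_deriv i (partial_deriv j (\<lambda>y. a y + b y)) x = partial_deriv i (\<lambda>y. partial_deriv j a y + partial_deriv j b y) x"
      by (rule partial_deriv_cong_open[OF open_S x 1])
    also have "\<dots> = partial_deriv i (partial_deriv j a) x + partial_deriv i (partial_deriv j b) x"
      by (rule partial_deriv_add) (auto intro: differentiable_S smooth_on_partial_deriv a b x)
    finally show ?thesis .
  qed
  then show ?thesis by (simp add: vec_eq_iff hessian_def 1[OF x] algebra_simps sum.distrib)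
qed

lemma hessian_mult:
  assumes x: "x \<in> S" and a: "smooth_on S a" and b: "smooth_on S b"
  shows "hessian G (\<lambda>y. a y * b y) x $ i $ j = a x * hessian G b x $ i $ j + b x * hessian G a x $ i $ j
    + partial_deriv i a x * partial_deriv j b x + partial_deriv j a x * partial_deriv i b x"
proof -
  have 1: "partial_deriv j (\<lambda>y. a y * b y) y = partial_deriv j a y * b y + a y * partial_deriv j b y" if "y \<in> S" for j y
    by (rule partial_deriv_mult) (auto intro: differentiable_S a b that)
  have "partial_deriv i (partial_deriv j (\<lambda>y. a y * b y)) x
      = partial_deriv i (\<lambda>y. partial_deriv j a y * b y + a y * partial_deriv j b y) x"
    by (rule partial_deriv_cong_open[OF open_S x 1])
  also have "\<dots> = partial_deriv i (partial_deriv j a) x * b x + partial_deriv j a x * partial_deriv i b x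
      + (partial_deriv i a x * partial_deriv j b x + a x * partial_deriv i (partial_deriv j b) x)"
    using differentiable_S[OF a x] differentiable_S[OF b x] differentiable_S[OF smooth_on_partial_deriv[OF a] x]
      differentiable_S[OF smooth_on_partial_deriv[OF b] x]
    by (simp add: partial_deriv_add partial_deriv_mult)
  finally have 2: "partial_deriv i (partial_deriv j (\<lambda>y. a y * b y)) x = \<dots>" .
  show ?thesis
    by (simp add: hessian_def 2 1[OF x] algebra_simps sum.distrib sum_distrib_left)
qed

lemma laplacian_add:
  "x \<in> S \<Longrightarrow> smooth_on S a \<Longrightarrow> smooth_on S b \<Longrightarrow>
    laplacian G (\<lambda>y. a y + b y) x = laplacian G a x + laplacian G b x"
  by (simp add: laplacian_sum hessian_add algebra_simps sum.distrib)

lemma laplacian_mult: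
  assumes x: "x \<in> S" and a: "smooth_on S a" and b: "smooth_on S b"
  shows "laplacian G (\<lambda>y. a y * b y) x = a x * laplacian G b x + b x * laplacian G a x + 2 * grad_prod G a b x"
proof -
  have "(\<Sum>i\<in>UNIV. \<Sum>j\<in>UNIV. Ginv x $ i $ j * (partial_deriv j a x * partial_deriv i b x)) = grad_prod G a b x"
    unfolding grad_prod_def
    by (subst sum.swap) (intro sum.cong refl, subst sym_comp(2)[OF x], simp)
  then show ?thesis
    by (simp add: laplacian_sum hessian_mult[OF assms] ring_distribs sum.distrib sum_distrib_left mult_ac)
       (simp add: grad_prod_def mult_ac)
qed

lemma laplacian_const: "laplacian G (\<lambda>y. c) x = 0"
proof -
  have "partial_deriv i (\<lambda>y::real^'n. c) = (\<lambda>y. 0)" for i by (rule ext) simp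
  then show ?thesis by (simp add: laplacian_sum hessian_def)
qed

lemma laplacian_cmult:
  "x \<in> S \<Longrightarrow> smooth_on S a \<Longrightarrow> laplacian G (\<lambda>y. c * a y) x = c * laplacian G a x"
  using laplacian_mult[of x "\<lambda>y. c" a] by (simp add: smooth_on_const laplacian_const grad_prod_def)

lemma laplacian_exp:
  assumes x: "x \<in> S" and a: "smooth_on S a"
  shows "laplacian G (\<lambda>y. exp (a y)) x = exp (a x) * (laplacian G a x + grad_prod G a a x)"
proof -
  have 1: "partial_deriv j (\<lambda>y. exp (a y)) y = exp (a y) * partial_deriv j a y" if "y \<in> S" for j y
    by (rule partial_deriv_exp) (rule differentiable_S[OF a that])
  have "partial_deriv i (partial_deriv j (\<lambda>y. exp (a y))) x
      = exp (a x) * (partial_deriv i (partial_deriv j a) x + partial_deriv i a x * partial_deriv j a x)" for i j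
  proof -
    have d: "a differentiable at x" "(\<lambda>y. exp (a y)) differentiable at x" "partial_deriv j a differentiable at x"
      using differentiable_S[OF _ x] a smooth_on_exp[OF open_S a] smooth_on_partial_deriv by blast+
    have "partial_deriv i (partial_deriv j (\<lambda>y. exp (a y))) x = partial_deriv i (\<lambda>y. exp (a y) * partial_deriv j a y) x"
      by (rule partial_deriv_cong_open[OF open_S x 1])
    then show ?thesis using d by (simp add: partial_deriv_mult partial_deriv_exp algebra_simps)
  qed
  then have "hessian G (\<lambda>y. exp (a y)) x $ i $ j
      = exp (a x) * (hessian G a x $ i $ j + partial_deriv i a x * partial_deriv j a x)" for i j
    by (simp add: hessian_def 1[OF x] algebra_simps sum_distrib_left)
  then show ?thesis
    by (simp add: laplacian_sum grad_prod_def algebra_simps sum.distrib sum_distrib_left)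
qed

lemma grad_prod_add_right:
  "x \<in> S \<Longrightarrow> smooth_on S a \<Longrightarrow> smooth_on S b \<Longrightarrow>
    grad_prod G f (\<lambda>y. a y + b y) x = grad_prod G f a x + grad_prod G f b x"
  by (simp add: grad_prod_def partial_deriv_add differentiable_S algebra_simps sum.distrib)

lemma grad_prod_mult_right:
  "x \<in> S \<Longrightarrow> smooth_on S a \<Longrightarrow> smooth_on S b \<Longrightarrow>
    grad_prod G f (\<lambda>y. a y * b y) x = a x * grad_prod G f b x + b x * grad_prod G f a x"
  by (simp add: grad_prod_def partial_deriv_mult differentiable_S algebra_simps sum.distrib sum_distrib_left)

lemma grad_prod_exp_right:
  "x \<in> S \<Longrightarrow> smooth_on S a \<Longrightarrow> grad_prod G f (\<lambda>y. exp (a y)) x = exp (a x) * grad_prod G f a x"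
  by (simp add: grad_prod_def partial_deriv_exp differentiable_S algebra_simps sum_distrib_left)

lemma grad_prod_const_right: "grad_prod G f (\<lambda>y. c) x = 0"
  by (simp add: grad_prod_def)

section \<open>Gradient Ricci solitons in coordinates\<close>

text \<open>The soliton equation makes the Ricci tensor a parallel tensor minus the Hessian. Taking
  divergence and differentiating the trace both reverse sign, so the contracted Bianchi identity
  passes to the Hessian unchanged.\<close>

lemma soliton_divg:
  assumes x: "x \<in> S" and f: "smooth_on S f"
    and sol: "\<And>y. y \<in> S \<Longrightarrow> hessian G f y + ricci G y = lam *\<^sub>R G y"
  shows "divg (raised_hess f) i x = (1/2) * partial_deriv i (laplacian G f) x"
proof -
  have E: "raised_ricci y = lam *\<^sub>R mat 1 - raised_hess f y" if "y \<in> S" for y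
  proof -
    have "raised_hess f y + raised_ricci y = lam *\<^sub>R G y ** Ginv y"
      by (simp add: raised_hess_def raised_ricci_def sol[OF that] flip: matrix_add_rdist)
    then show ?thesis
      using Ginv(1)[OF that] by (simp add: algebra_simps flip: scalar_matrix_assoc scalar_mult_eq_scaleR)
  qed
  have dh: "(\<lambda>y. raised_hess f y $ i $ k) differentiable at x" for i k
    by (rule differentiable_S[OF smooth_matrix_onD[OF smooth_raised_hess[OF f]] x])
  have dE: "partial_deriv k (\<lambda>y. raised_ricci y $ i $ m) x = - partial_deriv k (\<lambda>y. raised_hess f y $ i $ m) x" for k i m
  proof -
    have "partial_deriv k (\<lambda>y. raised_ricci y $ i $ m) x
        = partial_deriv k (\<lambda>y. (lam *\<^sub>R mat 1 :: real^'n^'n) $ i $ m - raised_hess f y $ i $ m) x"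
      by (rule partial_deriv_cong_open[OF open_S x]) (simp add: E)
    then show ?thesis using dh by (simp add: partial_deriv_diff)
  qed
  have dT: "partial_deriv i (\<lambda>y. trace (raised_ricci y)) x = - partial_deriv i (laplacian G f) x"
  proof -
    have "partial_deriv i (\<lambda>y. trace (raised_ricci y)) x
        = partial_deriv i (\<lambda>y. trace (lam *\<^sub>R mat 1 :: real^'n^'n) - laplacian G f y) x"
      by (rule partial_deriv_cong_open[OF open_S x]) (simp add: E trace_sub laplacian_eq f)
    then show ?thesis using differentiable_S[OF smooth_laplacian[OF f] x] by (simp add: partial_deriv_diff)
  qed
  \<comment> \<open>The identity endomorphism is divergence free, which in this notation is
    torsion-freeness after contraction.\<close>
  have "(\<Sum>k\<in>UNIV. \<Sum>m\<in>UNIV. conn k x $ k $ m * (mat 1 :: real^'n^'n) $ i $ m)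
      = (\<Sum>k\<in>UNIV. \<Sum>m\<in>UNIV. conn i x $ k $ m * (mat 1 :: real^'n^'n) $ k $ m)"
    by (simp add: mat_def if_distrib conn_torsion_free[OF x] cong: if_cong)
  then have "divg raised_ricci i x = - divg (raised_hess f) i x"
    by (simp add: divg_def dE E[OF x] right_diff_distrib sum_subtractf sum_negf mult.left_commute[of _ lam]
        flip: sum_distrib_left)
  then show ?thesis using contracted_bianchi[OF x, of i] dT by simp
qed

text \<open>Two expressions for the divergence of the Hessian are compared: (1/2) d\<Delta>f =
  d\<Delta>f + Ric(\<nabla>f). The soliton equation eliminates Ric, and the remaining Hessian term
  is half the differential of |\<nabla>f|^2.\<close>

lemma soliton_partial_laplacian:
  assumes x: "x \<in> S" and f: "smooth_on S f"
    and sol: "\<And>y. y \<in> S \<Longrightarrow> hessian G f y + ricci G y = lam *\<^sub>R G y"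
  shows "partial_deriv i (laplacian G f) x = partial_deriv i (grad_prod G f f) x - 2 * lam * partial_deriv i f x"
proof -
  have "(ricci G x *v gradient G f x) $ i = lam * partial_deriv i f x - (hessian G f x *v gradient G f x) $ i"
  proof -
    have "(hessian G f x + ricci G x) *v gradient G f x = lam *\<^sub>R (G x *v gradient G f x)"
      by (simp add: sol[OF x] scaleR_matrix_vector_assoc)
    then have "((hessian G f x + ricci G x) *v gradient G f x) $ i = (lam *\<^sub>R (G x *v gradient G f x)) $ i"
      by simp
    then show ?thesis by (simp add: G_gradient[OF x] matrix_vector_mult_add_rdistrib)
  qed
  then show ?thesis
    using soliton_divg[OF assms, of i] divg_raised_hess[OF x f, of i] partial_deriv_grad_prod[OF x f f, of i] by simp
qed

text \<open>Take the Laplacian of |\<nabla>f|^2 - 2\<lambda>f, which has the same first derivatives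
  as \<Delta>f. In the Bochner formula the divergence of the Hessian is half of d\<Delta>f and
  produces the drift term.\<close>

lemma soliton_laplacian_laplacian:
  assumes x: "x \<in> S" and f: "smooth_on S f"
    and sol: "\<And>y. y \<in> S \<Longrightarrow> hessian G f y + ricci G y = lam *\<^sub>R G y"
  shows "laplacian G (laplacian G f) x = grad_prod G f (laplacian G f) x
    + 2 * trace (hessian_endo G f x ** hessian_endo G f x) - 2 * lam * laplacian G f x"
proof -
  let ?s = "grad_prod G f f"
  have s: "smooth_on S ?s" by (rule smooth_grad_prod[OF f f])
  have w: "smooth_on S (\<lambda>y. ?s y + (- 2 * lam) * f y)"
    by (intro smooth_on_add smooth_on_mult smooth_on_const open_S s f)
  have pd: "partial_deriv i (laplacian G f) y = partial_deriv i (\<lambda>y. ?s y + (- 2 * lam) * f y) y" if "y \<in> S" for i y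
  proof -
    have "partial_deriv i (\<lambda>y. ?s y + (- 2 * lam) * f y) y = partial_deriv i ?s y + (- 2 * lam) * partial_deriv i f y"
      by (subst partial_deriv_add) (use differentiable_S[OF s that] differentiable_S[OF f that] in \<open>auto simp: partial_deriv_minus partial_deriv_cmult\<close>)
    then show ?thesis using soliton_partial_laplacian[OF that f sol] by simp
  qed
  have "hessian G (laplacian G f) x = hessian G (\<lambda>y. ?s y + (- 2 * lam) * f y) x"
    by (rule hessian_cong_partial[OF x pd])
  then have "laplacian G (laplacian G f) x = laplacian G (\<lambda>y. ?s y + (- 2 * lam) * f y) x"
    by (simp add: laplacian_sum)
  also have "\<dots> = laplacian G ?s x + (- 2 * lam) * laplacian G f x"
    by (subst laplacian_add[OF x s smooth_on_mult[OF open_S smooth_on_const f]]) (simp only: laplacian_cmult[OF x f])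
  also have "laplacian G ?s x = (\<Sum>j\<in>UNIV. gradient G f x $ j * partial_deriv j (laplacian G f) x)
      + 2 * trace (raised_hess f x ** raised_hess f x)"
    by (simp add: laplacian_grad_prod_self[OF x f] soliton_divg[OF assms] flip: sum_divide_distrib)
  finally show ?thesis by (simp add: grad_prod_eq[OF x] trace_hessian_endo_sq[OF x f])
qed

text \<open>The equation for \<open>u\<close> reads \<open>div (\<nabla>u - (u - 2\<lambda>) \<nabla>f) = 2 |\<nabla>\<^sup>2f|\<^sup>2 - u\<^sup>2\<close>, and the vector field is
  \<open>exp f \<nabla>((u - 2\<lambda>) exp (- f))\<close>.\<close>

lemma soliton_drift_laplacian:
  fixes k \<epsilon> :: real
  assumes x: "x \<in> S" and f: "smooth_on S f"
    and sol: "\<And>y. y \<in> S \<Longrightarrow> hessian G f y + ricci G y = lam *\<^sub>R G y"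
  defines "u \<equiv> laplacian G f"
  defines "\<phi> \<equiv> \<lambda>y. (u y + - (2 * lam)) * exp (- 1 * f y + k) + \<epsilon> * f y"
  shows "smooth_on S \<phi>"
    and "laplacian G \<phi> x + grad_prod G f \<phi> x = exp (k - f x) *
      (2 * trace (hessian_endo G f x ** hessian_endo G f x) - (u x)\<^sup>2) + \<epsilon> * (u x + grad_prod G f f x)"
proof -
  have u: "smooth_on S u" unfolding u_def by (rule smooth_laplacian[OF f])
  have s1: "smooth_on S (\<lambda>y. u y + - (2 * lam))" by (intro smooth_on_add smooth_on_const open_S u)
  have s2: "smooth_on S (\<lambda>y. - 1 * f y)" by (intro smooth_on_mult smooth_on_const open_S f)
  have s3: "smooth_on S (\<lambda>y. - 1 * f y + k)" by (intro smooth_on_add smooth_on_const open_S s2)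
  have s4: "smooth_on S (\<lambda>y. exp (- 1 * f y + k))" by (rule smooth_on_exp[OF open_S s3])
  have s5: "smooth_on S (\<lambda>y. (u y + - (2 * lam)) * exp (- 1 * f y + k))" by (rule smooth_on_mult[OF open_S s1 s4])
  have s6: "smooth_on S (\<lambda>y. \<epsilon> * f y)" by (intro smooth_on_mult smooth_on_const open_S f)
  show "smooth_on S \<phi>" unfolding \<phi>_def by (rule smooth_on_add[OF open_S s5 s6])
  let ?s = "grad_prod G f f x" and ?e = "exp (k - f x)" and ?q = "grad_prod G f u x"
  have e: "exp (- 1 * f x + k) = ?e" by (simp add: algebra_simps)
  have l3: "laplacian G (\<lambda>y. - 1 * f y + k) x = - u x"
    by (subst laplacian_add[OF x s2 smooth_on_const]) (simp only: laplacian_cmult[OF x f] laplacian_const u_def)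
  have g3: "grad_prod G a (\<lambda>y. - 1 * f y + k) x = - grad_prod G a f x" for a
    by (subst grad_prod_add_right[OF x s2 smooth_on_const])
      (simp only: grad_prod_mult_right[OF x smooth_on_const f] grad_prod_const_right)
  have g33: "grad_prod G (\<lambda>y. - 1 * f y + k) (\<lambda>y. - 1 * f y + k) x = ?s"
    unfolding g3 by (subst grad_prod_sym[OF x]) (unfold g3, simp)
  have l4: "laplacian G (\<lambda>y. exp (- 1 * f y + k)) x = ?e * (?s - u x)"
    unfolding laplacian_exp[OF x s3] l3 g33 e by simp
  have g4: "grad_prod G a (\<lambda>y. exp (- 1 * f y + k)) x = - ?e * grad_prod G a f x" for a
    unfolding grad_prod_exp_right[OF x s3] g3 e by simp
  have l1: "laplacian G (\<lambda>y. u y + - (2 * lam)) x = laplacian G u x"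
    by (subst laplacian_add[OF x u smooth_on_const]) (simp add: laplacian_const)
  have g1: "grad_prod G a (\<lambda>y. u y + - (2 * lam)) x = grad_prod G a u x" for a
    by (subst grad_prod_add_right[OF x u smooth_on_const]) (simp add: grad_prod_const_right)
  have g1f: "grad_prod G (\<lambda>y. u y + - (2 * lam)) f x = ?q"
    by (subst grad_prod_sym[OF x]) (rule g1)
  have l5: "laplacian G (\<lambda>y. (u y + - (2 * lam)) * exp (- 1 * f y + k)) x
      = (u x - 2 * lam) * (?e * (?s - u x)) + ?e * laplacian G u x - 2 * ?e * ?q"
    unfolding laplacian_mult[OF x s1 s4] l4 l1 g4 g1f e by simp
  have g5: "grad_prod G f (\<lambda>y. (u y + - (2 * lam)) * exp (- 1 * f y + k)) x
      = - ((u x - 2 * lam) * (?e * ?s)) + ?e * ?q"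
    unfolding grad_prod_mult_right[OF x s1 s4] g4 g1 e by (simp add: algebra_simps)
  have "laplacian G \<phi> x = (u x - 2 * lam) * (?e * (?s - u x)) + ?e * laplacian G u x - 2 * ?e * ?q + \<epsilon> * u x"
    unfolding \<phi>_def laplacian_add[OF x s5 s6] l5 laplacian_cmult[OF x f] by (simp add: u_def)
  moreover have "grad_prod G f \<phi> x = - ((u x - 2 * lam) * (?e * ?s)) + ?e * ?q + \<epsilon> * ?s"
    unfolding \<phi>_def grad_prod_add_right[OF x s5 s6] g5 grad_prod_mult_right[OF x smooth_on_const f]
      grad_prod_const_right by simp
  moreover have "laplacian G u x = ?q + 2 * trace (hessian_endo G f x ** hessian_endo G f x) - 2 * lam * u x"
    unfolding u_def by (rule soliton_laplacian_laplacian[OF x f sol])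
  \<comment> \<open>The drift term removes everything containing \<open>?s\<close> and
    \<open>?q\<close>, and the 2\<lambda>u in - (u - 2\<lambda>) u cancels the - 2\<lambda>u of the
    equation for \<Delta>u.\<close>
  ultimately show "laplacian G \<phi> x + grad_prod G f \<phi> x = ?e *
      (2 * trace (hessian_endo G f x ** hessian_endo G f x) - (u x)\<^sup>2) + \<epsilon> * (u x + ?s)"
    by (simp add: algebra_simps power2_eq_square)
qed

end

section \<open>Changes of coordinates\<close>

definition jac :: "(real^'n::finite \<Rightarrow> real^'n) \<Rightarrow> real^'n \<Rightarrow> real^'n^'n" where
  "jac T x = (\<chi> m i. partial_deriv i (\<lambda>y. T y $ m) x)"

lemma jacobian_eq_jac:
  assumes "\<And>m. (\<lambda>y. T y $ m) differentiable at x"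
  shows "jacobian T (at x) = jac T x"
  using frechet_derivative_at[OF has_derivative_components[OF assms], symmetric]
  by (simp add: jacobian_def matrix_def jac_def partial_deriv_def)

lemma riemannian_coords_subset:
  "riemannian_coords S G \<Longrightarrow> open R \<Longrightarrow> R \<subseteq> S \<Longrightarrow> riemannian_coords R G"
  unfolding riemannian_coords_def smooth_matrix_on_def using smooth_on_subset by (meson subsetD)

locale coord_change =
  src: riemannian_coords S G + tgt: riemannian_coords R G'
  for S :: "(real^'n::finite) set" and G and R :: "(real^'n) set" and G' +
  fixes T :: "real^'n \<Rightarrow> real^'n"
  assumes T_in: "x \<in> S \<Longrightarrow> T x \<in> R"
    and smooth_T: "smooth_on S (\<lambda>x. T x $ m)"
    and pullback: "x \<in> S \<Longrightarrow> G x = transpose (jac T x) ** G' (T x) ** jac T x"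
begin

text \<open>The pullback equation, multiplied by the inverse of the source metric, exhibits a left
  inverse of the Jacobian.\<close>

lemma jac_inverse:
  assumes x: "x \<in> S"
  shows "(src.Ginv x ** transpose (jac T x) ** G' (T x)) ** jac T x = mat 1"
    and "jac T x ** (src.Ginv x ** transpose (jac T x) ** G' (T x)) = mat 1"
proof -
  have "src.Ginv x ** (transpose (jac T x) ** G' (T x) ** jac T x) = mat 1"
    using src.Ginv(2)[OF x] pullback[OF x] by simp
  then show "(src.Ginv x ** transpose (jac T x) ** G' (T x)) ** jac T x = mat 1"
    by (simp only: matrix_mul_assoc)
  then show "jac T x ** (src.Ginv x ** transpose (jac T x) ** G' (T x)) = mat 1"
    using matrix_left_right_inverse by blast
qed

lemma Ginv_push:
  assumes x: "x \<in> S"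
  shows "jac T x ** src.Ginv x ** transpose (jac T x) = tgt.Ginv (T x)"
proof -
  have "jac T x ** src.Ginv x ** transpose (jac T x) ** G' (T x) ** tgt.Ginv (T x) = tgt.Ginv (T x)"
    using jac_inverse(2)[OF x] by (simp add: matrix_mul_assoc)
  then show ?thesis
    using tgt.Ginv(1)[OF T_in[OF x]] by (simp flip: matrix_mul_assoc)
qed

lemma partial_deriv_pullback:
  assumes x: "x \<in> S" and a: "smooth_on R a"
  shows "(\<chi> i. partial_deriv i (\<lambda>y. a (T y)) x) = transpose (jac T x) *v (\<chi> m. partial_deriv m a (T x))"
proof -
  have "partial_deriv i (\<lambda>y. a (T y)) x
      = (\<Sum>m\<in>UNIV. partial_deriv m a (T x) * partial_deriv i (\<lambda>y. T y $ m) x)" for i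
    by (rule partial_deriv_compose) (auto intro: tgt.differentiable_S[OF a T_in[OF x]] src.differentiable_S[OF smooth_T x])
  then show ?thesis
    by (simp add: vec_eq_iff matrix_vector_mult_def transpose_def jac_def mult.commute del: transpose_matrix_vector)
qed

lemma gradient_pullback:
  "x \<in> S \<Longrightarrow> smooth_on R a \<Longrightarrow>
    gradient G (\<lambda>y. a (T y)) x = (src.Ginv x ** transpose (jac T x)) *v (\<chi> m. partial_deriv m a (T x))"
  unfolding gradient_def partial_deriv_pullback by (rule matrix_vector_mul_assoc)

lemma smooth_pullback: "smooth_on R a \<Longrightarrow> smooth_on S (\<lambda>y. a (T y))"
  using smooth_on_compose[OF src.open_S tgt.open_S] T_in smooth_T by blast

lemma grad_prod_pullback:
  assumes x: "x \<in> S" and a: "smooth_on R a" and b: "smooth_on R b"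
  shows "grad_prod G (\<lambda>y. a (T y)) (\<lambda>y. b (T y)) x = grad_prod G' a b (T x)"
proof -
  let ?a = "\<chi> m. partial_deriv m a (T x)" and ?b = "\<chi> m. partial_deriv m b (T x)"
  have "grad_prod G (\<lambda>y. a (T y)) (\<lambda>y. b (T y)) x
      = (transpose (jac T x) *v ?a) \<bullet> (src.Ginv x *v (transpose (jac T x) *v ?b))"
    unfolding grad_prod_inner partial_deriv_pullback[OF x a] partial_deriv_pullback[OF x b] ..
  also have "\<dots> = ?a \<bullet> ((jac T x ** src.Ginv x ** transpose (jac T x)) *v ?b)"
    by (simp add: dot_lmul_matrix matrix_vector_mul_assoc[symmetric])
  also have "\<dots> = grad_prod G' a b (T x)"
    unfolding Ginv_push[OF x] grad_prod_inner ..
  finally show ?thesis .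
qed

text \<open>The formula through gradient pairings is tested on the target coordinate functions,
  whose differentials are the unit vectors. This compares the Hessians with both indices raised,
  entry by entry; lowering one index gives the conjugation.\<close>

lemma hessian_endo_pullback:
  assumes x: "x \<in> S" and f: "smooth_on R f"
  shows "hessian_endo G' f (T x) ** jac T x = jac T x ** hessian_endo G (\<lambda>y. f (T y)) x"
proof -
  let ?J = "jac T x" and ?P = "src.Ginv x" and ?Q = "tgt.Ginv (T x)"
  let ?H = "hessian G (\<lambda>y. f (T y)) x" and ?K = "hessian G' f (T x)"
  have e: "(\<chi> m. partial_deriv m (\<lambda>z::real^'n. z $ p) y) = axis p 1" for p y
    by (simp add: vec_eq_iff axis_def)
  have "(?J ** ?P ** ?H ** ?P ** transpose ?J) $ p $ q = (?Q ** ?K ** ?Q) $ p $ q" for p q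
  proof -
    let ?a = "\<lambda>z::real^'n. z $ p" and ?b = "\<lambda>z::real^'n. z $ q"
    note s = smooth_on_component[of R]
    have gp: "grad_prod G (\<lambda>y. a (T y)) (grad_prod G (\<lambda>y. b (T y)) (\<lambda>y. c (T y))) x
        = grad_prod G' a (grad_prod G' b c) (T x)" if "smooth_on R a" "smooth_on R b" "smooth_on R c" for a b c
    proof -
      have "grad_prod G (\<lambda>y. a (T y)) (grad_prod G (\<lambda>y. b (T y)) (\<lambda>y. c (T y))) x
          = grad_prod G (\<lambda>y. a (T y)) (\<lambda>y. grad_prod G' b c (T y)) x"
        by (rule src.grad_prod_cong[OF x refl grad_prod_pullback[OF _ that(2,3)]])
      then show ?thesis using grad_prod_pullback[OF x that(1) tgt.smooth_grad_prod[OF that(2,3)]] by simp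
    qed
    have "gradient G (\<lambda>y. ?a (T y)) x \<bullet> (?H *v gradient G (\<lambda>y. ?b (T y)) x)
        = gradient G' ?a (T x) \<bullet> (?K *v gradient G' ?b (T x))"
      unfolding src.hessian_via_grad_prod[OF x smooth_pullback[OF f] smooth_pullback[OF s] smooth_pullback[OF s]]
        tgt.hessian_via_grad_prod[OF T_in[OF x] f s s]
      unfolding gp[OF s[of p] f s[of q]] gp[OF s[of q] f s[of p]] gp[OF f s[of p] s[of q]] ..
    moreover have "gradient G (\<lambda>y. ?a (T y)) x \<bullet> (?H *v gradient G (\<lambda>y. ?b (T y)) x)
        = axis p 1 \<bullet> ((?J ** ?P ** ?H ** ?P ** transpose ?J) *v axis q 1)"
    proof -
      have "gradient G (\<lambda>y. ?a (T y)) x = transpose (?J ** ?P) *v axis p 1"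
        using gradient_pullback[OF x s, of p] src.sym_Ginv[OF x] by (simp only: e matrix_transpose_mul)
      moreover have "gradient G (\<lambda>y. ?b (T y)) x = (?P ** transpose ?J) *v axis q 1"
        using gradient_pullback[OF x s, of q] by (simp only: e)
      ultimately show ?thesis
        by (simp add: dot_lmul_matrix matrix_vector_mul_assoc matrix_mul_assoc)
    qed
    moreover have "gradient G' ?a (T x) \<bullet> (?K *v gradient G' ?b (T x)) = axis p 1 \<bullet> ((?Q ** ?K ** ?Q) *v axis q 1)"
    proof -
      have "gradient G' ?a (T x) = transpose ?Q *v axis p 1"
        using tgt.sym_Ginv[OF T_in[OF x]] by (simp only: gradient_def e)
      moreover have "gradient G' ?b (T x) = ?Q *v axis q 1" by (simp only: gradient_def e)
      ultimately show ?thesis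
        by (simp add: dot_lmul_matrix matrix_vector_mul_assoc matrix_mul_assoc)
    qed
    ultimately show ?thesis by (simp add: inner_axis' matrix_vector_mult_basis column_def)
  qed
  then have E: "?J ** ?P ** ?H ** ?P ** transpose ?J = ?Q ** ?K ** ?Q" by (simp add: vec_eq_iff)
  have "?Q ** ?K ** (?Q ** G' (T x)) ** ?J = ?J ** ?P ** ?H ** (?P ** transpose ?J ** G' (T x) ** ?J)"
    using arg_cong[OF E, of "\<lambda>M. M ** G' (T x) ** ?J"] by (simp only: matrix_mul_assoc)
  then show ?thesis
    using jac_inverse(1)[OF x] tgt.Ginv(2)[OF T_in[OF x]] by (simp add: hessian_endo_def matrix_mul_assoc)
qed

lemma trace_hessian_endo_pullback:
  assumes x: "x \<in> S" and f: "smooth_on R f"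
  shows "trace (hessian_endo G' f (T x)) = trace (hessian_endo G (\<lambda>y. f (T y)) x)"
    and "trace (hessian_endo G' f (T x) ** hessian_endo G' f (T x))
      = trace (hessian_endo G (\<lambda>y. f (T y)) x ** hessian_endo G (\<lambda>y. f (T y)) x)"
proof -
  define J where "J = jac T x"
  define E where "E = hessian_endo G (\<lambda>y. f (T y)) x"
  define E' where "E' = hessian_endo G' f (T x)"
  obtain K where K: "K ** J = mat 1" "J ** K = mat 1"
    unfolding J_def using jac_inverse[OF x] by blast
  have "E' ** J ** K = J ** E ** K" using hessian_endo_pullback[OF x f] by (simp add: J_def E_def E'_def)
  then have E': "E' = J ** (E ** K)" using K(2) by (simp flip: matrix_mul_assoc)
  have "trace E' = trace (E ** K ** J)" unfolding E' by (rule trace_mul_sym)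
  then show "trace (hessian_endo G' f (T x)) = trace (hessian_endo G (\<lambda>y. f (T y)) x)"
    using K(1) by (simp add: E_def E'_def flip: matrix_mul_assoc)
  have "E' ** E' = J ** (E ** (K ** J) ** E ** K)" by (simp add: E' matrix_mul_assoc)
  then have "trace (E' ** E') = trace (J ** (E ** E ** K))" using K(1) by simp
  also have "\<dots> = trace (E ** E ** K ** J)" by (rule trace_mul_sym)
  finally show "trace (hessian_endo G' f (T x) ** hessian_endo G' f (T x))
      = trace (hessian_endo G (\<lambda>y. f (T y)) x ** hessian_endo G (\<lambda>y. f (T y)) x)"
    using K(1) by (simp add: E_def E'_def flip: matrix_mul_assoc)
qed

end

section \<open>The limiting argument\<close>

text \<open>Strictness comes from squaring exp (F/2) \<ge> 1 + F/2, which gains the term F^2/4. The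
  base is nonnegative because the assumption already gives 1 + F > 0.\<close>

lemma exp_le_one_plus_imp_zero:
  assumes "exp F \<le> 1 + (F::real)"
  shows "F = 0"
proof (rule ccontr)
  assume "F \<noteq> 0"
  have "1 + F / 2 \<ge> 0"
    using assms exp_gt_zero[of F] by linarith
  then have "(1 + F / 2)\<^sup>2 \<le> (exp (F / 2))\<^sup>2"
    using exp_ge_add_one_self[of "F / 2"] by (intro power_mono)
  also have "\<dots> = exp F" by (simp flip: exp_double)
  finally have "1 + F\<^sup>2 / 4 + F \<le> exp F" by (simp add: power2_sum power_divide)
  then have "F\<^sup>2 / 4 \<le> 0" using assms by linarith
  with \<open>F \<noteq> 0\<close> show False by simp
qed

text \<open>The maxima of the perturbed functions satisfy \<open>F \<le> O(\<epsilon>)\<close> and \<open>u\<^sup>2 \<le> O(\<epsilon>)\<close>, so that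
  the limit \<open>\<epsilon> \<rightarrow> 0\<close> bounds \<open>(u - 2\<lambda>) exp (- F)\<close> by \<open>- 2\<lambda>\<close>; together with \<open>u \<ge> - 2\<lambda> F\<close> this
  gives \<open>exp F \<le> 1 + F\<close>.\<close>

lemma perturbed_max_imp_zero:
  fixes F u s :: "'a \<Rightarrow> real"
  assumes lam: "0 < lam"
    and bdF: "\<And>p. p \<in> M \<Longrightarrow> \<bar>F p\<bar> \<le> B" and bdu: "\<And>p. p \<in> M \<Longrightarrow> \<bar>u p\<bar> \<le> B"
    and u: "\<And>p. p \<in> M \<Longrightarrow> u p = s p - 2 * lam * F p" and s: "\<And>p. p \<in> M \<Longrightarrow> 0 \<le> s p"
    and max: "\<And>\<epsilon>. 0 < \<epsilon> \<Longrightarrow> \<exists>q\<in>M. exp (- F q) * (u q)\<^sup>2 + \<epsilon> * (u q + s q) \<le> 0 \<and>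
      (\<forall>p\<in>M. (u p - 2 * lam) * exp (- F p) + \<epsilon> * F p \<le> (u q - 2 * lam) * exp (- F q) + \<epsilon> * F q)"
    and p: "p \<in> M"
  shows "F p = 0"
proof -
  define E where "E = exp B"
  \<comment> \<open>\<open>K\<close> bounds - 2 exp F (u + \<lambda>F), the amount by which the
    perturbation can let u^2 exceed 0, per unit of \<epsilon>.\<close>
  define K where "K = 2 * E * (B + lam * B)"
  have B: "0 \<le> B" using bdF[OF p] by linarith
  have E: "0 < E" by (simp add: E_def)
  have bound: "(u p - 2 * lam) * exp (- F p) \<le> E * sqrt (\<epsilon> * K) - 2 * lam + \<epsilon> * E + 2 * \<epsilon> * B" if eps: "0 < \<epsilon>" for \<epsilon>
  proof -
    obtain q where q: "q \<in> M" and le: "exp (- F q) * (u q)\<^sup>2 + \<epsilon> * (u q + s q) \<le> 0"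
      and mx: "(u p - 2 * lam) * exp (- F p) + \<epsilon> * F p \<le> (u q - 2 * lam) * exp (- F q) + \<epsilon> * F q"
      using max[OF eps] p by blast
    define e where "e = exp (F q)"
    have e: "0 < e" "e \<le> E" "exp (- F q) \<le> E" and ee: "e * exp (- F q) = 1"
      using bdF[OF q] by (auto simp: e_def E_def simp flip: exp_add)
    have "e * (exp (- F q) * (u q)\<^sup>2 + \<epsilon> * (u q + s q)) \<le> 0"
      using le e(1) by (simp add: mult_nonneg_nonpos)
    moreover have "e * (exp (- F q) * (u q)\<^sup>2 + \<epsilon> * (u q + s q)) = (u q)\<^sup>2 + 2 * \<epsilon> * e * (u q + lam * F q)"
    proof -
      have "u q + s q = 2 * (u q + lam * F q)" using u[OF q] by simp
      then have "e * (exp (- F q) * (u q)\<^sup>2 + \<epsilon> * (u q + s q))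
          = (e * exp (- F q)) * (u q)\<^sup>2 + 2 * \<epsilon> * e * (u q + lam * F q)"
        by (simp only: distrib_left mult_ac)
      then show ?thesis by (simp only: ee mult_1_left)
    qed
    ultimately have main: "(u q)\<^sup>2 + 2 * \<epsilon> * e * (u q + lam * F q) \<le> 0" by simp
    \<comment> \<open>Completing the square in \<open>main\<close>: u^2 + 2\<epsilon>eu \<ge> -
      (\<epsilon>e)^2, and a factor \<epsilon>e > 0 is divided out.\<close>
    have Fq: "2 * lam * F q \<le> \<epsilon> * E"
    proof -
      have "0 \<le> (u q + \<epsilon> * e)\<^sup>2" by simp
      then have "(\<epsilon> * e) * (2 * lam * F q) \<le> (\<epsilon> * e) * (\<epsilon> * e)"
        using main by (simp add: power2_eq_square algebra_simps)
      then have "2 * lam * F q \<le> \<epsilon> * e" using eps e(1) by simp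
      also have "\<dots> \<le> \<epsilon> * E" using eps e(2) by simp
      finally show ?thesis .
    qed
    have "(u q)\<^sup>2 \<le> \<epsilon> * K"
    proof -
      have "lam * F q \<ge> - (lam * B)" using mult_left_mono[of "- B" "F q" lam] bdF[OF q] lam by simp
      then have "- (u q + lam * F q) \<le> B + lam * B" using bdu[OF q] by linarith
      then have "2 * \<epsilon> * e * (- (u q + lam * F q)) \<le> 2 * \<epsilon> * e * (B + lam * B)"
        using eps e(1) by (intro mult_left_mono) auto
      also have "\<dots> \<le> 2 * \<epsilon> * E * (B + lam * B)"
        using eps e B lam by (intro mult_right_mono mult_left_mono) auto
      finally have "- (2 * \<epsilon> * e * (u q + lam * F q)) \<le> \<epsilon> * K" by (simp add: K_def algebra_simps)
      with main show ?thesis by linarith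
    qed
    then have uq: "u q \<le> sqrt (\<epsilon> * K)" by (rule real_le_rsqrt)
    have "u q * exp (- F q) \<le> sqrt (\<epsilon> * K) * exp (- F q)" using uq by (intro mult_right_mono) auto
    also have "\<dots> \<le> sqrt (\<epsilon> * K) * E"
    proof (intro mult_left_mono e(3))
      have "0 \<le> K" using B lam E by (simp add: K_def)
      then show "0 \<le> sqrt (\<epsilon> * K)" using eps by simp
    qed
    finally have 1: "u q * exp (- F q) \<le> E * sqrt (\<epsilon> * K)" by (simp add: mult.commute)
    \<comment> \<open>The tangent line of exp turns the upper bound on F at q into a lower bound on
      exp (- F).\<close>
    have "2 * lam * (1 - F q) \<le> 2 * lam * exp (- F q)"
      using exp_ge_add_one_self[of "- F q"] lam by (intro mult_left_mono) auto
    then have 2: "- (2 * lam * exp (- F q)) \<le> - 2 * lam + \<epsilon> * E" using Fq by (simp add: algebra_simps)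
    have "\<epsilon> * F q - \<epsilon> * F p \<le> \<epsilon> * (2 * B)"
      using bdF[OF q] bdF[OF p] eps by (simp flip: right_diff_distrib)
    then show ?thesis using mx 1 2 by (simp add: algebra_simps)
  qed
  have "((\<lambda>\<epsilon>. E * sqrt (\<epsilon> * K) - 2 * lam + \<epsilon> * E + 2 * \<epsilon> * B) \<longlongrightarrow> E * sqrt (0 * K) - 2 * lam + 0 * E + 2 * 0 * B) (at_right 0)"
    by (intro tendsto_intros)
  then have "(u p - 2 * lam) * exp (- F p) \<le> E * sqrt (0 * K) - 2 * lam + 0 * E + 2 * 0 * B"
    by (rule tendsto_lowerbound) (auto simp: eventually_at_right_less eventually_at_filter intro!: bound always_eventually)
  then have "(u p - 2 * lam) * exp (- F p) * exp (F p) \<le> - 2 * lam * exp (F p)"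
    by (intro mult_right_mono) auto
  then have "u p - 2 * lam \<le> - 2 * lam * exp (F p)" by (simp add: mult.assoc flip: exp_add)
  moreover have "- 2 * lam * F p \<le> u p" using u[OF p] s[OF p] by simp
  ultimately have "2 * lam * exp (F p) \<le> 2 * lam * (1 + F p)" by (simp add: algebra_simps)
  then have "exp (F p) \<le> 1 + F p" using lam by simp
  then show ?thesis by (rule exp_le_one_plus_imp_zero)
qed

section \<open>Globalisation\<close>

locale metric_manifold =
  fixes X :: "'a topology" and A :: "('a, 'n::finite) chart set" and g :: "('a, 'n) tensor_field"
  assumes atlas: "smooth_atlas X A" and metric: "riemannian_metric A g"
begin

lemma chart: "c \<in> A \<Longrightarrow> is_chart X c"
  using atlas by (simp add: smooth_atlas_def)

lemma chart_cover: "p \<in> topspace X \<Longrightarrow> \<exists>c\<in>A. p \<in> fst c"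
  using atlas unfolding smooth_atlas_def by blast

lemma chart_subset: "c \<in> A \<Longrightarrow> fst c \<subseteq> topspace X"
  using atlas unfolding smooth_atlas_def by blast

lemma open_coord_image: "c \<in> A \<Longrightarrow> open (coord_image c)"
  using chart by (simp add: is_chart_def)

lemma chart_homeo: "c \<in> A \<Longrightarrow> homeomorphic_map (subtopology X (fst c)) (top_of_set (coord_image c)) (snd c)"
  using chart by (simp add: is_chart_def)

lemma chart_inj: "c \<in> A \<Longrightarrow> inj_on (snd c) (fst c)"
  using homeomorphic_imp_injective_map[OF chart_homeo] chart_subset by (metis inf.absorb_iff2 topspace_subtopology)

lemma coord_inv: "c \<in> A \<Longrightarrow> p \<in> fst c \<Longrightarrow> coord_inv c (snd c p) = p"
  unfolding coord_inv_def using chart_inj by (rule inv_into_f_f)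

lemma in_coords_chart: "c \<in> A \<Longrightarrow> p \<in> fst c \<Longrightarrow> in_coords c h (snd c p) = h p"
  by (simp add: in_coords_def coord_inv)

lemma coord_imageI: "p \<in> fst c \<Longrightarrow> snd c p \<in> coord_image c"
  by (simp add: coord_image_def)

lemma coord_imageE:
  assumes "x \<in> coord_image c"
  obtains p where "p \<in> fst c" "x = snd c p"
  using assms by (auto simp: coord_image_def)

lemma transition_chart: "c \<in> A \<Longrightarrow> p \<in> fst c \<Longrightarrow> transition c d (snd c p) = snd d p"
  by (simp add: transition_def coord_inv)

lemma overlapE:
  assumes "x \<in> overlap c d"
  obtains p where "p \<in> fst c" "p \<in> fst d" "x = snd c p"
  using assms by (auto simp: overlap_def)

lemma overlap_subset: "overlap c d \<subseteq> coord_image c"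
  by (auto simp: overlap_def coord_image_def)

lemma open_overlap:
  assumes c: "c \<in> A" and d: "d \<in> A"
  shows "open (overlap c d)"
proof -
  have "openin (subtopology X (fst c)) (fst c \<inter> fst d)"
    using chart[OF d] by (auto simp: is_chart_def openin_subtopology)
  then have "openin (top_of_set (coord_image c)) (snd c ` (fst c \<inter> fst d))"
    using homeomorphic_imp_open_map[OF chart_homeo[OF c]] by (simp add: open_map_def)
  then show ?thesis
    using open_coord_image[OF c] openin_open_eq unfolding overlap_def by blast
qed

lemma openin_chart_preimage:
  assumes c: "c \<in> A" and W: "open W"
  shows "openin X {q \<in> fst c. snd c q \<in> W}"
proof -
  have "continuous_map (subtopology X (fst c)) (top_of_set (coord_image c)) (snd c)"
    using chart_homeo[OF c] by (rule homeomorphic_imp_continuous_map)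
  moreover have "openin (top_of_set (coord_image c)) (coord_image c \<inter> W)"
    using W by (rule openin_open_Int)
  ultimately have "openin (subtopology X (fst c)) {q \<in> topspace (subtopology X (fst c)). snd c q \<in> coord_image c \<inter> W}"
    by (rule openin_continuous_map_preimage)
  moreover have "{q \<in> topspace (subtopology X (fst c)). snd c q \<in> coord_image c \<inter> W} = {q \<in> fst c. snd c q \<in> W}"
    using chart_subset[OF c] by (auto simp: coord_image_def)
  ultimately have "openin (subtopology X (fst c)) {q \<in> fst c. snd c q \<in> W}" by simp
  then show ?thesis
    using chart[OF c] openin_open_subtopology[of X "fst c"] by (simp add: is_chart_def)
qed

lemma riemannian_coords_chart:
  assumes c: "c \<in> A"
  shows "riemannian_coords (coord_image c) (g c)"
  using metric c open_coord_image[OF c]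
  by (auto simp: riemannian_coords_def riemannian_metric_def smooth_matrix_on_def)

lemma coord_change:
  assumes c: "c \<in> A" and d: "d \<in> A"
  shows "coord_change (overlap c d) (g c) (coord_image d) (g d) (transition c d)"
proof -
  have T: "smooth_on (overlap c d) (\<lambda>x. transition c d x $ m)" for m
    using atlas c d by (auto simp: smooth_atlas_def smooth_transition_def)
  have "jacobian (transition c d) (at x) = jac (transition c d) x" if "x \<in> overlap c d" for x
    by (rule jacobian_eq_jac) (rule smooth_on_imp_differentiable[OF T open_overlap[OF c d] that])
  moreover have "g c x = transpose (jacobian (transition c d) (at x)) ** g d (transition c d x) ** jacobian (transition c d) (at x)"
    if "x \<in> overlap c d" for x
    using metric c d that unfolding riemannian_metric_def Let_def by blast
  ultimately have "coord_change_axioms (overlap c d) (g c) (coord_image d) (g d) (transition c d)"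
    using T by unfold_locales (auto elim!: overlapE simp: transition_chart[OF c] coord_imageI)
  then show ?thesis
    using riemannian_coords_subset[OF riemannian_coords_chart[OF c] open_overlap[OF c d] overlap_subset]
      riemannian_coords_chart[OF d]
    by (intro coord_change.intro)
qed

lemma smooth_in_coords: "smooth_function A h \<Longrightarrow> c \<in> A \<Longrightarrow> smooth_on (coord_image c) (in_coords c h)"
  by (simp add: smooth_function_def)

lemma in_coords_transition:
  assumes "c \<in> A" "d \<in> A" "x \<in> overlap c d"
  shows "in_coords c h x = in_coords d h (transition c d x)"
  using assms by (auto elim!: overlapE simp: transition_chart in_coords_chart)

lemma chart_independence:
  assumes h: "smooth_function A h" and c: "c \<in> A" "p \<in> fst c" and d: "d \<in> A" "p \<in> fst d"
  shows "laplacian (g c) (in_coords c h) (snd c p) = laplacian (g d) (in_coords d h) (snd d p)"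
    and "trace (hessian_endo (g c) (in_coords c h) (snd c p) ** hessian_endo (g c) (in_coords c h) (snd c p))
      = trace (hessian_endo (g d) (in_coords d h) (snd d p) ** hessian_endo (g d) (in_coords d h) (snd d p))"
    and "grad_prod (g c) (in_coords c h) (in_coords c h) (snd c p)
      = grad_prod (g d) (in_coords d h) (in_coords d h) (snd d p)"
proof -
  interpret coord_change "overlap c d" "g c" "coord_image d" "g d" "transition c d"
    by (rule coord_change[OF c(1) d(1)])
  have x: "snd c p \<in> overlap c d" using c d by (auto simp: overlap_def)
  have T: "transition c d (snd c p) = snd d p" by (rule transition_chart[OF c])
  note eq = in_coords_transition[OF c(1) d(1)]
  have H: "hessian_endo (g c) (in_coords c h) (snd c p) = hessian_endo (g c) (\<lambda>y. in_coords d h (transition c d y)) (snd c p)"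
    unfolding hessian_endo_def by (rule arg_cong, rule src.hessian_cong[OF x eq])
  note tr = trace_hessian_endo_pullback[OF x smooth_in_coords[OF h d(1)]]
  show "laplacian (g c) (in_coords c h) (snd c p) = laplacian (g d) (in_coords d h) (snd d p)"
    using tr(1) by (simp only: laplacian_def H T)
  show "trace (hessian_endo (g c) (in_coords c h) (snd c p) ** hessian_endo (g c) (in_coords c h) (snd c p))
      = trace (hessian_endo (g d) (in_coords d h) (snd d p) ** hessian_endo (g d) (in_coords d h) (snd d p))"
    using tr(2) by (simp only: H T)
  have "grad_prod (g c) (in_coords c h) (in_coords c h) (snd c p)
      = grad_prod (g c) (\<lambda>y. in_coords d h (transition c d y)) (\<lambda>y. in_coords d h (transition c d y)) (snd c p)"
    by (rule src.grad_prod_cong[OF x eq eq])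
  then show "grad_prod (g c) (in_coords c h) (in_coords c h) (snd c p)
      = grad_prod (g d) (in_coords d h) (in_coords d h) (snd d p)"
    using grad_prod_pullback[OF x smooth_in_coords[OF h d(1)] smooth_in_coords[OF h d(1)]] by (simp only: T)
qed

section \<open>The Laplacian and the squared gradient as functions on the manifold\<close>

definition chart_at :: "'a \<Rightarrow> ('a, 'n) chart" where
  "chart_at p = (SOME c. c \<in> A \<and> p \<in> fst c)"

lemma chart_at: "c \<in> A \<Longrightarrow> p \<in> fst c \<Longrightarrow> chart_at p \<in> A \<and> p \<in> fst (chart_at p)"
  unfolding chart_at_def by (rule someI[of "\<lambda>c. c \<in> A \<and> p \<in> fst c" c]) simp

definition lap :: "('a \<Rightarrow> real) \<Rightarrow> 'a \<Rightarrow> real" where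
  "lap h p = laplacian (g (chart_at p)) (in_coords (chart_at p) h) (snd (chart_at p) p)"

definition grad_sq :: "('a \<Rightarrow> real) \<Rightarrow> 'a \<Rightarrow> real" where
  "grad_sq h p = grad_prod (g (chart_at p)) (in_coords (chart_at p) h) (in_coords (chart_at p) h) (snd (chart_at p) p)"

lemma lap_chart:
  assumes h: "smooth_function A h" and c: "c \<in> A" "x \<in> coord_image c"
  shows "in_coords c (lap h) x = laplacian (g c) (in_coords c h) x"
proof -
  obtain p where p: "p \<in> fst c" "x = snd c p" using coord_imageE[OF c(2)] .
  note d = chart_at[OF c(1) p(1)]
  show ?thesis
    using p chart_independence(1)[OF h c(1) p(1) d[THEN conjunct1] d[THEN conjunct2]] by (simp add: in_coords_chart c lap_def)
qed

lemma grad_sq_chart: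
  assumes h: "smooth_function A h" and c: "c \<in> A" "x \<in> coord_image c"
  shows "in_coords c (grad_sq h) x = grad_prod (g c) (in_coords c h) (in_coords c h) x"
proof -
  obtain p where p: "p \<in> fst c" "x = snd c p" using coord_imageE[OF c(2)] .
  note d = chart_at[OF c(1) p(1)]
  show ?thesis
    using p chart_independence(3)[OF h c(1) p(1) d[THEN conjunct1] d[THEN conjunct2]] by (simp add: in_coords_chart c grad_sq_def)
qed

lemma smooth_lap:
  assumes h: "smooth_function A h"
  shows "smooth_function A (lap h)"
  unfolding smooth_function_def
proof
  fix c assume c: "c \<in> A"
  interpret riemannian_coords "coord_image c" "g c" by (rule riemannian_coords_chart[OF c])
  show "smooth_on (coord_image c) (in_coords c (lap h))"
    using smooth_laplacian[OF smooth_in_coords[OF h c]]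
    by (subst smooth_on_cong[OF open_S lap_chart[OF h c]])
qed

lemma smooth_grad_sq:
  assumes h: "smooth_function A h"
  shows "smooth_function A (grad_sq h)"
  unfolding smooth_function_def
proof
  fix c assume c: "c \<in> A"
  interpret riemannian_coords "coord_image c" "g c" by (rule riemannian_coords_chart[OF c])
  show "smooth_on (coord_image c) (in_coords c (grad_sq h))"
    using smooth_grad_prod[OF smooth_in_coords[OF h c] smooth_in_coords[OF h c]]
    by (subst smooth_on_cong[OF open_S grad_sq_chart[OF h c]])
qed

text \<open>\<open>chart_at\<close> makes the same choice as \<open>hessian_invariant\<close>, so
  both sides unfold to one chart; the trace is then carried over to the given chart.\<close>

lemma hessian_invariant_2:
  assumes h: "smooth_function A h" and c: "c \<in> A" "p \<in> fst c"
  defines "E \<equiv> hessian_endo (g c) (in_coords c h) (snd c p)"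
  shows "2 * hessian_invariant A g 2 h p = (lap h p)\<^sup>2 - trace (E ** E)"
proof -
  note d = chart_at[OF c]
  show ?thesis
    using chart_independence(2)[OF h c d[THEN conjunct1] d[THEN conjunct2]]
    by (simp add: hessian_invariant_def Let_def endo_invariant_2 lap_def laplacian_def E_def flip: chart_at_def)
qed

lemma continuous_map_smooth_function:
  assumes h: "smooth_function A h"
  shows "continuous_map X euclideanreal h"
proof -
  have "openin X {p \<in> topspace X. h p \<in> U}" if U: "open U" for U
  proof (subst openin_subopen, intro ballI)
    fix p assume p: "p \<in> {p \<in> topspace X. h p \<in> U}"
    then obtain c where c: "c \<in> A" "p \<in> fst c" using chart_cover by blast
    define W where "W = coord_image c \<inter> in_coords c h -` U"
    have "continuous_on (coord_image c) (in_coords c h)"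
      using smooth_on_imp_differentiable[OF smooth_in_coords[OF h c(1)] open_coord_image[OF c(1)]]
      by (auto intro!: continuous_at_imp_continuous_on differentiable_imp_continuous_within)
    then have "open W"
      unfolding W_def using continuous_on_open_vimage[OF open_coord_image[OF c(1)]] U by (metis inf_commute)
    from openin_chart_preimage[OF c(1) this]
    show "\<exists>T. openin X T \<and> p \<in> T \<and> T \<subseteq> {p \<in> topspace X. h p \<in> U}"
    proof (intro exI conjI)
      show "p \<in> {q \<in> fst c. snd c q \<in> W}" using p c by (simp add: W_def coord_imageI in_coords_chart)
      show "{q \<in> fst c. snd c q \<in> W} \<subseteq> {p \<in> topspace X. h p \<in> U}"
        using chart_subset[OF c(1)] by (auto simp: W_def in_coords_chart[OF c(1)])
    qed
  qed
  then show ?thesis by (simp add: continuous_map_def)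
qed

text \<open>In coordinates the function is constant on balls, so its level sets are open; their
  complements are open by continuity, and connectedness decides.\<close>

lemma constant_on_if_partials_zero:
  assumes conn: "connected_space X" and h: "smooth_function A h"
    and zero: "\<And>c x i. c \<in> A \<Longrightarrow> x \<in> coord_image c \<Longrightarrow> partial_deriv i (in_coords c h) x = 0"
  shows "h constant_on topspace X"
proof -
  have "openin X {p \<in> topspace X. h p = v}" for v
  proof (subst openin_subopen, intro ballI)
    fix p assume p: "p \<in> {p \<in> topspace X. h p = v}"
    then obtain c where c: "c \<in> A" "p \<in> fst c" using chart_cover by blast
    obtain r where r: "r > 0" "ball (snd c p) r \<subseteq> coord_image c"
      using open_coord_image[OF c(1)] coord_imageI[OF c(2)] open_contains_ball by blast
    have D: "(in_coords c h has_derivative (\<lambda>v. 0)) (at x within ball (snd c p) r)" if "x \<in> ball (snd c p) r" for x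
    proof -
      have x: "x \<in> coord_image c" using that r by blast
      have "in_coords c h differentiable at x"
        by (rule smooth_on_imp_differentiable[OF smooth_in_coords[OF h c(1)] open_coord_image[OF c(1)] x])
      from has_derivative_partial_deriv[OF this] show ?thesis
        by (simp add: zero[OF c(1) x] has_derivative_at_withinI)
    qed
    have "in_coords c h x = in_coords c h (snd c p)" if "x \<in> ball (snd c p) r" for x
      by (rule has_derivative_zero_unique[OF convex_ball D that]) (simp_all add: r(1))
    then have "h q = v" if "q \<in> fst c" "snd c q \<in> ball (snd c p) r" for q
      using that p unfolding in_coords_chart[OF c(1) that(1), symmetric]
      by (simp add: in_coords_chart[OF c])
    then show "\<exists>T. openin X T \<and> p \<in> T \<and> T \<subseteq> {p \<in> topspace X. h p = v}"
      using openin_chart_preimage[OF c(1) open_ball[of "snd c p" r]] r(1) c(2) chart_subset[OF c(1)]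
      by (intro exI[of _ "{q \<in> fst c. snd c q \<in> ball (snd c p) r}"]) auto
  qed
  moreover have "openin X {p \<in> topspace X. h p \<noteq> v}" for v
    using openin_continuous_map_preimage[OF continuous_map_smooth_function[OF h], of "- {v}"]
    by (simp add: open_Compl)
  ultimately have "{p \<in> topspace X. h p = v} = {} \<or> {p \<in> topspace X. h p \<noteq> v} = {}" for v
    using conn[unfolded connected_space_def, simplified, rule_format,
      of "{p \<in> topspace X. h p = v}" "{p \<in> topspace X. h p \<noteq> v}"] by blast
  then show ?thesis unfolding constant_on_def by blast
qed

lemma laplacian_at_max:
  assumes h: "smooth_function A h" and c: "c \<in> A" "p \<in> fst c"
    and max: "\<And>q. q \<in> topspace X \<Longrightarrow> h q \<le> h p"
  shows "laplacian (g c) (in_coords c h) (snd c p) \<le> 0"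
    and "grad_prod (g c) a (in_coords c h) (snd c p) = 0"
proof -
  interpret riemannian_coords "coord_image c" "g c" by (rule riemannian_coords_chart[OF c(1)])
  have x: "snd c p \<in> coord_image c" by (rule coord_imageI[OF c(2)])
  have m: "in_coords c h y \<le> in_coords c h (snd c p)" if "y \<in> coord_image c" for y
    using that max chart_subset[OF c(1)] c by (auto elim!: coord_imageE simp: in_coords_chart)
  show "laplacian (g c) (in_coords c h) (snd c p) \<le> 0"
    by (rule laplacian_nonpos_at_max[OF x smooth_in_coords[OF h c(1)] m])
  show "grad_prod (g c) a (in_coords c h) (snd c p) = 0"
    by (simp add: grad_prod_def local_max_derivs(1)[OF open_S x smooth_in_coords[OF h c(1)] m])
qed

lemma smooth_function_cmult:
  assumes "smooth_function A h"
  shows "smooth_function A (\<lambda>p. k * h p)"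
  using assms smooth_on_mult[OF open_coord_image smooth_on_const]
  by (simp add: smooth_function_def in_coords_def o_def)

lemma lap_at_extrema:
  assumes h: "smooth_function A h" and p: "p \<in> topspace X"
  shows "(\<And>q. q \<in> topspace X \<Longrightarrow> h q \<le> h p) \<Longrightarrow> lap h p \<le> 0"
    and "(\<And>q. q \<in> topspace X \<Longrightarrow> h p \<le> h q) \<Longrightarrow> 0 \<le> lap h p"
proof -
  obtain c where c: "c \<in> A" "p \<in> fst c" using chart_cover p by blast
  interpret riemannian_coords "coord_image c" "g c" by (rule riemannian_coords_chart[OF c(1)])
  note x = coord_imageI[OF c(2)]
  have L: "lap h p = laplacian (g c) (in_coords c h) (snd c p)"
    using lap_chart[OF h c(1) x] in_coords_chart[OF c] by metis
  show "lap h p \<le> 0" if "\<And>q. q \<in> topspace X \<Longrightarrow> h q \<le> h p"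
    unfolding L by (rule laplacian_at_max(1)[OF h c that])
  show "0 \<le> lap h p" if "\<And>q. q \<in> topspace X \<Longrightarrow> h p \<le> h q"
  proof -
    have "laplacian (g c) (in_coords c (\<lambda>p. - 1 * h p)) (snd c p) \<le> 0"
      by (rule laplacian_at_max(1)[OF smooth_function_cmult[OF h] c]) (use that in simp)
    also have "in_coords c (\<lambda>p. - 1 * h p) = (\<lambda>y. - 1 * in_coords c h y)"
      by (simp add: in_coords_def o_def)
    finally show ?thesis
      unfolding L laplacian_cmult[OF x smooth_in_coords[OF h c(1)]] by simp
  qed
qed

end

section \<open>Compact solitons\<close>

lemma continuous_map_attains_max:
  assumes "compact_space X" "continuous_map X euclideanreal h" "topspace X \<noteq> {}"
  shows "\<exists>p\<in>topspace X. \<forall>q\<in>topspace X. h q \<le> h p"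
proof -
  have "compactin euclideanreal (h ` topspace X)"
    using assms image_compactin unfolding compact_space_def by blast
  then show ?thesis using compact_attains_sup[of "h ` topspace X"] assms(3) by auto
qed

lemma continuous_map_bounded:
  assumes "compact_space X" "continuous_map X euclideanreal h"
  shows "\<exists>B. \<forall>p\<in>topspace X. \<bar>h p\<bar> \<le> B"
proof -
  have "compactin euclideanreal (h ` topspace X)"
    using assms image_compactin unfolding compact_space_def by blast
  then have "bounded (h ` topspace X)" by (simp add: compact_imp_bounded)
  then show ?thesis by (auto simp: bounded_iff)
qed

locale compact_soliton = metric_manifold X A g
  for X :: "'a topology" and A :: "('a, 'n::finite) chart set" and g +
  fixes f :: "'a \<Rightarrow> real" and lam :: real
  assumes connected: "connected_space X" and compact: "compact_space X"
    and soliton: "gradient_ricci_soliton A g f lam" and lam: "0 < lam"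
begin

lemma smooth_f: "smooth_function A f"
  using soliton by (simp add: gradient_ricci_soliton_def)

lemma soliton_eq: "c \<in> A \<Longrightarrow> x \<in> coord_image c \<Longrightarrow> hessian (g c) (in_coords c f) x + ricci (g c) x = lam *\<^sub>R g c x"
  using soliton by (simp add: gradient_ricci_soliton_def)

text \<open>Hamilton's conservation law R + |\<nabla>f|^2 - 2\<lambda>f = const for the scalar
  curvature R, rewritten with the traced soliton equation R = n\<lambda> - \<Delta>f. The difference
  of the two sides has vanishing partial derivatives in every chart.\<close>

lemma hamilton_identity: "\<exists>C. \<forall>p\<in>topspace X. lap f p = grad_sq f p - 2 * lam * f p + C"
proof -
  define h where "h p = lap f p + (- 1 * grad_sq f p + (2 * lam) * f p)" for p
  note sm = smooth_lap[OF smooth_f] smooth_grad_sq[OF smooth_f]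
  have hc: "in_coords c h = (\<lambda>x. in_coords c (lap f) x + (- 1 * in_coords c (grad_sq f) x + (2 * lam) * in_coords c f x))" for c
    by (simp add: h_def in_coords_def o_def)
  have h: "smooth_function A h"
    unfolding smooth_function_def hc
    by (intro ballI smooth_on_add smooth_on_mult smooth_on_const open_coord_image smooth_in_coords sm smooth_f)
  have "h constant_on topspace X"
  proof (rule constant_on_if_partials_zero[OF connected h])
    fix c x i assume c: "c \<in> A" and x: "x \<in> coord_image c"
    interpret riemannian_coords "coord_image c" "g c" by (rule riemannian_coords_chart[OF c])
    note fc = smooth_in_coords[OF smooth_f c]
    have d: "in_coords c f differentiable at x" "laplacian (g c) (in_coords c f) differentiable at x"
      "grad_prod (g c) (in_coords c f) (in_coords c f) differentiable at x"
      using fc smooth_laplacian[OF fc] smooth_grad_prod[OF fc fc] differentiable_S[OF _ x] by auto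
    have "partial_deriv i (in_coords c h) x = partial_deriv i (\<lambda>x. laplacian (g c) (in_coords c f) x
        + ((- 1) * grad_prod (g c) (in_coords c f) (in_coords c f) x + (2 * lam) * in_coords c f x)) x"
      by (rule partial_deriv_cong_open[OF open_S x]) (simp add: hc lap_chart grad_sq_chart smooth_f c)
    also have "\<dots> = partial_deriv i (laplacian (g c) (in_coords c f)) x
        + ((- 1) * partial_deriv i (grad_prod (g c) (in_coords c f) (in_coords c f)) x + (2 * lam) * partial_deriv i (in_coords c f) x)"
      using d by (subst partial_deriv_add, simp, simp, subst partial_deriv_add, simp, simp) (simp only: partial_deriv_cmult)
    also have "\<dots> = 0"
      using soliton_partial_laplacian[OF x fc soliton_eq[OF c]] by simp
    finally show "partial_deriv i (in_coords c h) x = 0" .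
  qed
  then obtain C where "\<And>p. p \<in> topspace X \<Longrightarrow> h p = C" unfolding constant_on_def by blast
  then show ?thesis by (intro exI[of _ C]) (force simp: h_def)
qed

lemma grad_sq_nonneg: "p \<in> topspace X \<Longrightarrow> 0 \<le> grad_sq f p"
  using chart_cover chart_at riemannian_coords.grad_prod_nonneg[OF riemannian_coords_chart coord_imageI]
  unfolding grad_sq_def by blast

text \<open>At a maximum the Laplacian is nonpositive and the drift term vanishes with the gradient.
  Constancy of the second invariant turns 2 |Hess f|^2 - u^2 into u^2 - 4 \<open>s2\<close>.\<close>

lemma drift_at_max:
  assumes S2: "\<And>p. p \<in> topspace X \<Longrightarrow> hessian_invariant A g 2 f p = s2"
    and q: "q \<in> topspace X"
    and max: "\<And>p. p \<in> topspace X \<Longrightarrow> (lap f p + - (2 * lam)) * exp (- 1 * f p + k) + \<epsilon> * f p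
      \<le> (lap f q + - (2 * lam)) * exp (- 1 * f q + k) + \<epsilon> * f q"
  shows "exp (k - f q) * ((lap f q)\<^sup>2 - 4 * s2) + \<epsilon> * (lap f q + grad_sq f q) \<le> 0"
proof -
  define h where "h p = (lap f p + - (2 * lam)) * exp (- 1 * f p + k) + \<epsilon> * f p" for p
  obtain c where c: "c \<in> A" "q \<in> fst c" using chart_cover q by blast
  have hc: "in_coords d h x = (laplacian (g d) (in_coords d f) x + - (2 * lam)) * exp (- 1 * in_coords d f x + k) + \<epsilon> * in_coords d f x"
    if "d \<in> A" "x \<in> coord_image d" for d x
    using lap_chart[OF smooth_f that] by (simp add: h_def in_coords_def)
  have h: "smooth_function A h"
    unfolding smooth_function_def
  proof
    fix d assume d: "d \<in> A"
    interpret riemannian_coords "coord_image d" "g d" by (rule riemannian_coords_chart[OF d])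
    show "smooth_on (coord_image d) (in_coords d h)"
    \<comment> \<open>\<open>soliton_drift_laplacian\<close> is formulated at a point of the chart,
      so a chart with empty domain is treated separately.\<close>
    proof (cases "coord_image d = {}")
      case True
      then show ?thesis by (simp add: smooth_on_def differentiable_on_def)
    next
      case False
      then obtain x where x: "x \<in> coord_image d" by blast
      show ?thesis
        using soliton_drift_laplacian(1)[OF x smooth_in_coords[OF smooth_f d] soliton_eq[OF d]]
        by (subst smooth_on_cong[OF open_S hc[OF d]])
    qed
  qed
  let ?x = "snd c q" and ?f = "in_coords c f"
  interpret riemannian_coords "coord_image c" "g c" by (rule riemannian_coords_chart[OF c(1)])
  have x: "?x \<in> coord_image c" by (rule coord_imageI[OF c(2)])
  let ?\<phi> = "\<lambda>y. (laplacian (g c) ?f y + - (2 * lam)) * exp (- 1 * ?f y + k) + \<epsilon> * ?f y"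
  have m: "h p \<le> h q" if "p \<in> topspace X" for p using max[OF that] by (simp add: h_def)
  have "laplacian (g c) (in_coords c h) ?x + grad_prod (g c) ?f (in_coords c h) ?x \<le> 0"
    using laplacian_at_max[OF h c m] by simp
  moreover have "laplacian (g c) (in_coords c h) ?x = laplacian (g c) ?\<phi> ?x"
    by (rule laplacian_cong[OF x hc[OF c(1)]])
  moreover have "grad_prod (g c) ?f (in_coords c h) ?x = grad_prod (g c) ?f ?\<phi> ?x"
    by (rule grad_prod_cong[OF x refl hc[OF c(1)]])
  ultimately have "exp (k - ?f ?x) * (2 * trace (hessian_endo (g c) ?f ?x ** hessian_endo (g c) ?f ?x)
      - (laplacian (g c) ?f ?x)\<^sup>2) + \<epsilon> * (laplacian (g c) ?f ?x + grad_prod (g c) ?f ?f ?x) \<le> 0"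
    using soliton_drift_laplacian(2)[OF x smooth_in_coords[OF smooth_f c(1)] soliton_eq[OF c(1)], of k \<epsilon>] by simp
  moreover have "laplacian (g c) ?f ?x = lap f q" "grad_prod (g c) ?f ?f ?x = grad_sq f q" "?f ?x = f q"
    using lap_chart[OF smooth_f c(1) x] grad_sq_chart[OF smooth_f c(1) x] in_coords_chart[OF c] by simp_all
  moreover have "2 * trace (hessian_endo (g c) ?f ?x ** hessian_endo (g c) ?f ?x) = 2 * (lap f q)\<^sup>2 - 4 * s2"
    using hessian_invariant_2[OF smooth_f c] S2[OF q] by simp
  ultimately show ?thesis by simp
qed

lemma constant_potential:
  assumes S2: "\<And>p. p \<in> topspace X \<Longrightarrow> hessian_invariant A g 2 f p = s2"
  shows "f constant_on topspace X"
proof (cases "topspace X = {}")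
  case True
  then show ?thesis by (simp add: constant_on_def)
next
  case ne: False
  note cont = continuous_map_smooth_function
  have "s2 \<le> 0"
  proof (rule ccontr)
    assume pos: "\<not> s2 \<le> 0"
    have nz: "lap f p \<noteq> 0" if p: "p \<in> topspace X" for p
    proof
      assume "lap f p = 0"
      obtain c where c: "c \<in> A" "p \<in> fst c" using chart_cover p by blast
      \<comment> \<open>A zero of u would make |Hess f|^2 = u^2 - 2 \<open>s2\<close>
        negative.\<close>
      have "0 \<le> - 2 * s2"
        using hessian_invariant_2[OF smooth_f c] S2[OF p] \<open>lap f p = 0\<close>
          riemannian_coords.trace_hessian_endo_sq_nonneg[OF riemannian_coords_chart[OF c(1)] coord_imageI[OF c(2)]
            smooth_in_coords[OF smooth_f c(1)]] by simp
      with pos show False by simp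
    qed
    obtain p where p: "p \<in> topspace X" "\<And>q. q \<in> topspace X \<Longrightarrow> f q \<le> f p"
      using continuous_map_attains_max[OF compact cont[OF smooth_f] ne] by blast
    obtain q where q: "q \<in> topspace X" "\<And>r. r \<in> topspace X \<Longrightarrow> f q \<le> f r"
      using continuous_map_attains_max[OF compact cont[OF smooth_function_cmult[OF smooth_f, of "- 1"]] ne] by auto
    have "connectedin euclideanreal (lap f ` topspace X)"
      using connectedin_continuous_map_image[OF cont[OF smooth_lap[OF smooth_f]]] connected by (simp add: connectedin_topspace)
    then have "is_interval (lap f ` topspace X)" by (simp add: is_interval_connected_1)
    then have "0 \<in> lap f ` topspace X"
      using lap_at_extrema(1)[OF smooth_f p] lap_at_extrema(2)[OF smooth_f q] p(1) q(1)
      unfolding is_interval_1 by blast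
    with nz show False by auto
  qed
  obtain C where C: "\<And>p. p \<in> topspace X \<Longrightarrow> lap f p = grad_sq f p - 2 * lam * f p + C"
    using hamilton_identity by blast
  \<comment> \<open>The shift absorbs \<open>C\<close>, with F = f - k. The potential f itself is
    kept in the drift lemma: exp (k - f) is exp (- F), and \<epsilon>f differs from \<epsilon>F by a
    constant, so the maxima are the same.\<close>
  define k where "k = C / (2 * lam)"
  have Ck: "C = 2 * lam * k" using lam by (simp add: k_def)
  have smF: "smooth_function A (\<lambda>p. f p - k)"
    using smooth_f smooth_on_diff[OF open_coord_image _ smooth_on_const]
    by (simp add: smooth_function_def in_coords_def o_def)
  obtain B1 where B1: "\<And>p. p \<in> topspace X \<Longrightarrow> \<bar>f p - k\<bar> \<le> B1"
    using continuous_map_bounded[OF compact cont[OF smF]] by blast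
  obtain B2 where B2: "\<And>p. p \<in> topspace X \<Longrightarrow> \<bar>lap f p\<bar> \<le> B2"
    using continuous_map_bounded[OF compact cont[OF smooth_lap[OF smooth_f]]] by blast
  have "f p - k = 0" if p: "p \<in> topspace X" for p
  proof (rule perturbed_max_imp_zero[OF lam, where M = "topspace X" and F = "\<lambda>p. f p - k" and u = "lap f"
        and s = "grad_sq f" and B = "max B1 B2"])
    fix \<epsilon> :: real assume eps: "0 < \<epsilon>"
    have "continuous_map X euclideanreal (\<lambda>p. (lap f p + - (2 * lam)) * exp (- 1 * f p + k) + \<epsilon> * f p)"
      using cont[OF smooth_lap[OF smooth_f]] cont[OF smooth_f]
      by (intro continuous_map_add continuous_map_real_mult continuous_map_const[THEN iffD2]
          continuous_map_compose[of X euclideanreal _ euclideanreal exp, unfolded o_def]) (auto intro: continuous_intros)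
    from continuous_map_attains_max[OF compact this ne] obtain q where q: "q \<in> topspace X"
      and mx: "\<And>p. p \<in> topspace X \<Longrightarrow> (lap f p + - (2 * lam)) * exp (- 1 * f p + k) + \<epsilon> * f p
        \<le> (lap f q + - (2 * lam)) * exp (- 1 * f q + k) + \<epsilon> * f q" by blast
    have "exp (k - f q) * ((lap f q)\<^sup>2 - 4 * s2) + \<epsilon> * (lap f q + grad_sq f q) \<le> 0"
      by (rule drift_at_max[OF S2 q mx])
    moreover have "exp (k - f q) * (lap f q)\<^sup>2 \<le> exp (k - f q) * ((lap f q)\<^sup>2 - 4 * s2)"
      using \<open>s2 \<le> 0\<close> by simp
    ultimately have "exp (k - f q) * (lap f q)\<^sup>2 + \<epsilon> * (lap f q + grad_sq f q) \<le> 0" by linarith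
    then have "exp (- (f q - k)) * (lap f q)\<^sup>2 + \<epsilon> * (lap f q + grad_sq f q) \<le> 0" by simp
    moreover have "(lap f p - 2 * lam) * exp (- (f p - k)) + \<epsilon> * (f p - k)
        \<le> (lap f q - 2 * lam) * exp (- (f q - k)) + \<epsilon> * (f q - k)" if "p \<in> topspace X" for p
      using mx[OF that] by (simp add: algebra_simps)
    ultimately show "\<exists>q\<in>topspace X. exp (- (f q - k)) * (lap f q)\<^sup>2 + \<epsilon> * (lap f q + grad_sq f q) \<le> 0 \<and>
        (\<forall>p\<in>topspace X. (lap f p - 2 * lam) * exp (- (f p - k)) + \<epsilon> * (f p - k)
          \<le> (lap f q - 2 * lam) * exp (- (f q - k)) + \<epsilon> * (f q - k))"
      using q by blast
  next
    show "\<bar>f p - k\<bar> \<le> max B1 B2" "\<bar>lap f p\<bar> \<le> max B1 B2" if "p \<in> topspace X" for p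
      using B1[OF that] B2[OF that] by linarith+
    show "lap f p = grad_sq f p - 2 * lam * (f p - k)" if "p \<in> topspace X" for p
      using C[OF that] Ck by (simp add: algebra_simps)
  qed (use grad_sq_nonneg p in auto)
  then show ?thesis unfolding constant_on_def by (metis eq_iff_diff_eq_0)
qed

lemma einstein_if_constant:
  assumes "f constant_on topspace X"
  shows "einstein A g"
proof -
  obtain v where v: "\<And>p. p \<in> topspace X \<Longrightarrow> f p = v" using assms unfolding constant_on_def by blast
  have "ricci (g c) x = lam *\<^sub>R g c x" if c: "c \<in> A" and x: "x \<in> coord_image c" for c x
  proof -
    interpret riemannian_coords "coord_image c" "g c" by (rule riemannian_coords_chart[OF c])
    have "in_coords c f y = v" if "y \<in> coord_image c" for y
      using that v chart_subset[OF c] by (auto elim!: coord_imageE simp: in_coords_chart c)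
    then have "hessian (g c) (in_coords c f) x = hessian (g c) (\<lambda>y. v) x"
      by (rule hessian_cong[OF x])
    also have "\<dots> = 0"
    proof -
      have "partial_deriv i (\<lambda>y::real^'n. v) = (\<lambda>y. 0)" for i by (rule ext) simp
      then show ?thesis by (simp add: hessian_def vec_eq_iff)
    qed
    finally show ?thesis using soliton_eq[OF c x] by simp
  qed
  then show ?thesis unfolding einstein_def by blast
qed

end

theorem theorem1p1:
  fixes X :: "'a topology"
    and A :: "('a, 'n::finite) chart set"
    and g :: "('a, 'n) tensor_field"
    and f :: "'a \<Rightarrow> real"
    and lam :: real
  assumes "riemannian_manifold X A g"
    and "compact_space X"
    and "gradient_ricci_soliton A g f lam"
    and "lam > 0"
    and "hessian_invariant A g 2 f constant_on topspace X"
  shows "trivial_soliton X A g f \<and> einstein A g"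
proof -
  interpret compact_soliton X A g f lam
    using assms(1-4) by unfold_locales (auto simp: riemannian_manifold_def smooth_manifold_def)
  obtain s2 where "\<And>p. p \<in> topspace X \<Longrightarrow> hessian_invariant A g 2 f p = s2"
    using assms(5) unfolding constant_on_def by blast
  from constant_potential[OF this] have "f constant_on topspace X" .
  then show ?thesis using einstein_if_constant by (simp add: trivial_soliton_def)
qed

end
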